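(* Let $\omega$ be a non-quasianalytic concave weight function, and let $\sigma$ be a weight function satisfying $\sigma(t)=o(t)$ as $t\to\infty$. Assume that $(\omega,\sigma)$ is $r$-strong for some $r\in(0,1)$. If $\tau$ is a weight function such that $\sigma(t)=o(\tau(t))$ as $t\to\infty$, then for each non-empty closed subset $A\subseteq\mathbb{R}^n$ there exists a continuous linear extension operator $T_A:\mathcal{E}^{\{\tau\}}(A)\to\mathcal{E}^{(\omega)}(\mathbb{R}^n)$, i.e. a continuous linear map $T_A$ with $j_A^\infty(T_AF)=F$ for all $F\in\mathcal{E}^{\{\tau\}}(A)$.
   Context: Weight functions. A weight function is a continuous increasing (not necessarily strictly) function $\omega:[0,\infty)\to[0,\infty)$ with $\omega(0)=0$ such that $\omega(2t)=O(\omega(t))$ as $t\to\infty$, $\log t=o(\omega(t))$ as $t\to\infty$, and $\varphi_\omega(t):=\omega(e^t)$ is convex on $\mathbb{R}$. It is non-quasianalytic if $\int_1^\infty \omega(t)t^{-2}\,dt<\infty$. The Young conjugate is $\varphi_\omega^*(t):=\sup_{s\ge0}(st-\varphi_\omega(s))$, $t\ge0$. An ordered pair $(\omega,\sigma)$ of weight functions is called $r$-strong if there is $C>0$ such that for all $t>0$ $$\int_1^\infty \frac{\omega(tu)}{u^{1+r}}\,du\le C\sigma(t)+C.$$ Functions. All functions are real-valued and $\mathbb{N}=\{0,1,2,\dots\}$. For $U\subseteq\mathbb{R}^n$ open and $\rho>0$ put $$\|f\|^\omega_{U,\rho}:=\sup_{x\in U,\ \alpha\in\mathbb{N}^n}|\partial^\alpha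 f(x)|\exp\big(-\tfrac1\rho\varphi_\omega^*(\rho|\alpha|)\big).$$ The Beurling class $\mathcal{E}^{(\omega)}(\mathbb{R}^n)$ is the space of all $f\in C^\infty(\mathbb{R}^n)$ such that $\|f\|^\omega_{U,1/k}<\infty$ for all relatively compact open $U\subseteq\mathbb{R}^n$ and all integers $k\ge1$, with the locally convex topology defined by these seminorms. Jets. Let $A\subseteq\mathbb{R}^n$ be closed and non-empty. For $F=(F^\alpha)_{\alpha\in\mathbb{N}^n}$ with continuous $F^\alpha:A\to\mathbb{R}$ set $$(R^p_xF)^\alpha(y):=F^\alpha(y)-\sum_{|\beta|\le p-|\alpha|}\frac{(y-x)^\beta}{\beta!}F^{\alpha+\beta}(x),\qquad |\alpha|\le p.$$ $\mathcal{E}(A)$ is the set of Whitney jets, i.e. those $F$ such that for all compact $K\subseteq A$, all $p\in\mathbb{N}$ and all $|\alpha|\le p$ one has $(R^p_xF)^\alpha(y)=o(|y-x|^{p-|\alpha|})$ as $|y-x|\to0$, $x,y\in K$. For a weight function $\tau$, compact $K\subseteq A$ and $\rho>0$ put $$\|F\|^\tau_{K,\rho}:=\sup_{x\in K}\sup_{\alpha\in\mathbb{N}^n}|F^\alpha(x)|\exp\big(-\tfrac1\rho\varphi_\tau^*(\rho|\alpha|)\big),$$ $$|F|^\tau_{K,\rho}:=\sup_{x\ne y\in K}\ \sup_{p\in\mathbb{N}}\ \sup_{|\alpha|\le p}|(R^p_xF)^\alpha(y)|\frac{(p+1-|\alpha|)!}{|x-y|^{p+1-|\alpha|}}\exp\big(-\tfrac1\rho\varphi_\tau^*(\rho(p+1))\big).$$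 The space of $\tau$-Whitney ultrajets of Roumieu type on $A$ is $$\mathcal{E}^{\{\tau\}}(A):=\{F\in\mathcal{E}(A):\ \forall K\subseteq A \text{ compact }\exists m\in\mathbb{N}_{\ge1}:\ \|F\|^\tau_{K,m}+|F|^\tau_{K,m}<\infty\}$$ with its natural locally convex topology: for compact non-empty $K$, $\mathcal{E}^{\{\tau\}}(K)$ carries the locally convex inductive limit topology over $m\in\mathbb{N}_{\ge1}$ of the Banach spaces $\{F\in\mathcal{E}(K):\|F\|^\tau_{K,m}+|F|^\tau_{K,m}<\infty\}$ with norm $\|F\|^\tau_{K,m}+|F|^\tau_{K,m}$, and $\mathcal{E}^{\{\tau\}}(A)$ carries the coarsest locally convex topology making all restriction maps $\mathcal{E}^{\{\tau\}}(A)\to\mathcal{E}^{\{\tau\}}(K)$, $K\subseteq A$ compact non-empty, continuous. The jet mapping is $j^\infty_A(f):=(\partial^\alpha f|_A)_{\alpha\in\mathbb{N}^n}$ for $f\in C^\infty(\mathbb{R}^n)$. *)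

theory Defs
  imports "HOL-Analysis.Analysis" "HOL-Library.Function_Algebras" "HOL-Library.Landau_Symbols"
begin

section \<open>Locally convex topologies on subspaces\<close>

instantiation "fun" :: (type, real_vector) real_vector
begin

definition scaleR_fun_def: "c *\<^sub>R f = (\<lambda>x. c *\<^sub>R f x)"

instance
  by standard
    (simp_all add: scaleR_fun_def fun_eq_iff scaleR_add_right scaleR_add_left)

end

text \<open>A locally convex space is a linear subspace \<open>V\<close> of an ambient real vector space together with
  a topology with carrier \<open>V\<close>. Seminorms only matter on \<open>V\<close>.\<close>

definition seminorm_on :: "'a::real_vector set \<Rightarrow> ('a \<Rightarrow> real) \<Rightarrow> bool" where
  "seminorm_on V p \<longleftrightarrow>
     (\<forall>x\<in>V. 0 \<le> p x) \<and>
     (\<forall>c. \<forall>x\<in>V. p (c *\<^sub>R x) = \<bar>c\<bar> * p x) \<and>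
     (\<forall>x\<in>V. \<forall>y\<in>V. p (x + y) \<le> p x + p y)"

definition seminorm_topology :: "'a::real_vector set \<Rightarrow> ('a \<Rightarrow> real) set \<Rightarrow> 'a topology" where
  "seminorm_topology V P =
     topology_generated_by (insert V {{y \<in> V. p (y - x) < e} | p x e. p \<in> P \<and> x \<in> V \<and> 0 < e})"

definition locally_convex_topology :: "'a::real_vector set \<Rightarrow> 'a topology \<Rightarrow> bool" where
  "locally_convex_topology V T \<longleftrightarrow> (\<exists>P. (\<forall>p\<in>P. seminorm_on V p) \<and> T = seminorm_topology V P)"

text \<open>The finest locally convex topology on \<open>V\<close> for which the inclusions of all the steps
  \<open>S i\<close>, \<open>i \<in> I\<close>, are continuous: the join of all locally convex topologies with this property,
  which is again locally convex (see below).\<close>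

definition lc_inductive_topology ::
    "'a::real_vector set \<Rightarrow> 'i set \<Rightarrow> ('i \<Rightarrow> 'a topology) \<Rightarrow> 'a topology" where
  "lc_inductive_topology V I S =
     topology_generated_by
       (\<Union>T \<in> {T. locally_convex_topology V T \<and> (\<forall>i\<in>I. continuous_map (S i) T (\<lambda>x. x))}. {U. openin T U})"

text \<open>The coarsest topology on \<open>V\<close> making all \<open>r i :: V \<rightarrow> T i\<close>, \<open>i \<in> I\<close>, continuous. For linear
  \<open>r i\<close> and locally convex \<open>T i\<close> it is locally convex.\<close>

definition initial_topology_on ::
    "'a set \<Rightarrow> 'i set \<Rightarrow> ('i \<Rightarrow> 'a \<Rightarrow> 'b) \<Rightarrow> ('i \<Rightarrow> 'b topology) \<Rightarrow> 'a topology" where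
  "initial_topology_on V I r T =
     topology_generated_by (insert V {{x \<in> V. r i x \<in> U} | i U. i \<in> I \<and> openin (T i) U})"

definition linear_map_on ::
    "'a::real_vector set \<Rightarrow> 'b::real_vector set \<Rightarrow> ('a \<Rightarrow> 'b) \<Rightarrow> bool" where
  "linear_map_on V W T \<longleftrightarrow>
     T ` V \<subseteq> W \<and>
     (\<forall>x\<in>V. \<forall>y\<in>V. T (x + y) = T x + T y) \<and>
     (\<forall>c. \<forall>x\<in>V. T (c *\<^sub>R x) = c *\<^sub>R T x)"

lemma topspace_seminorm_topology [simp]: "topspace (seminorm_topology V P) = V"
  by (auto simp: seminorm_topology_def)

lemma openin_seminorm_topology_ball:
  "p \<in> P \<Longrightarrow> x \<in> V \<Longrightarrow> 0 < e \<Longrightarrow> openin (seminorm_topology V P) {y \<in> V. p (y - x) < e}"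
  unfolding seminorm_topology_def by (rule topology_generated_by_Basis) blast

lemma locally_convex_topology_topspace: "locally_convex_topology V T \<Longrightarrow> topspace T = V"
  by (auto simp: locally_convex_topology_def)

lemma openin_lc_inductive_topology:
  assumes "locally_convex_topology V T" "\<And>i. i \<in> I \<Longrightarrow> continuous_map (S i) T (\<lambda>x. x)" "openin T U"
  shows "openin (lc_inductive_topology V I S) U"
  unfolding lc_inductive_topology_def
  by (rule topology_generated_by_Basis) (use assms in blast)

lemma topspace_lc_inductive_topology [simp]:
  assumes "\<And>i. i \<in> I \<Longrightarrow> topspace (S i) \<subseteq> V"
  shows "topspace (lc_inductive_topology V I S) = V"
proof -
  have T: "locally_convex_topology V (seminorm_topology V {})"
    by (auto simp: locally_convex_topology_def)
  have "openin (seminorm_topology V {}) U \<Longrightarrow> U = {} \<or> U = V" for U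
    unfolding seminorm_topology_def openin_topology_generated_by_iff
    by (induction rule: generate_topology_on.induct) auto
  then have "continuous_map (S i) (seminorm_topology V {}) (\<lambda>x. x)" if "i \<in> I" for i
    unfolding continuous_map_def
  proof (intro conjI allI impI)
    show "(\<lambda>x. x) \<in> topspace (S i) \<rightarrow> topspace (seminorm_topology V {})"
      using assms[OF that] by auto
    fix U assume "openin (seminorm_topology V {}) U"
    then have "U = {} \<or> U = V"
      using \<open>\<And>U. openin (seminorm_topology V {}) U \<Longrightarrow> U = {} \<or> U = V\<close> by blast
    then have "{x \<in> topspace (S i). x \<in> U} = {} \<or> {x \<in> topspace (S i). x \<in> U} = topspace (S i)"
      using assms[OF that] by blast
    then show "openin (S i) {x \<in> topspace (S i). x \<in> U}"
      by (metis openin_empty openin_topspace)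
  qed
  then have "openin (lc_inductive_topology V I S) V"
    using T openin_topspace[of "seminorm_topology V {}"]
    by (intro openin_lc_inductive_topology[where T = "seminorm_topology V {}"]) simp_all
  moreover have "topspace (lc_inductive_topology V I S) \<subseteq> V"
  proof
    fix x assume "x \<in> topspace (lc_inductive_topology V I S)"
    then obtain T U where "locally_convex_topology V T" "openin T U" "x \<in> U"
      unfolding lc_inductive_topology_def topology_generated_by_topspace by blast
    then show "x \<in> V"
      using locally_convex_topology_topspace openin_subset by blast
  qed
  ultimately show ?thesis
    using openin_subset by blast
qed

lemma topology_generated_by_coarsest:
  assumes "openin (topology_generated_by S) U" "\<And>s. s \<in> S \<Longrightarrow> openin T s"
  shows "openin T U"
proof -
  have "generate_topology_on S U"
    using assms(1) by (simp add: openin_topology_generated_by_iff)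
  then show ?thesis
  proof (induction rule: generate_topology_on.induct)
    case (Basis s)
    then show ?case by (rule assms(2))
  qed (simp_all add: openin_Int openin_Union)
qed

lemma seminorm_topology_coarsest:
  assumes "openin (seminorm_topology V P) U" "openin T V"
    and "\<And>p x e. p \<in> P \<Longrightarrow> x \<in> V \<Longrightarrow> 0 < e \<Longrightarrow> openin T {y \<in> V. p (y - x) < e}"
  shows "openin T U"
  using assms(1) unfolding seminorm_topology_def
proof (rule topology_generated_by_coarsest)
  fix s assume "s \<in> insert V {{y \<in> V. p (y - x) < e} | p x e. p \<in> P \<and> x \<in> V \<and> 0 < e}"
  then consider "s = V" | "\<exists>p x e. s = {y \<in> V. p (y - x) < e} \<and> p \<in> P \<and> x \<in> V \<and> 0 < e"
    by (simp only: insert_iff mem_Collect_eq) (elim disjE, assumption+)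
  then show "openin T s"
  proof cases
    case 2
    then obtain p x e where "s = {y \<in> V. p (y - x) < e}" "p \<in> P" "x \<in> V" "0 < e"
      by (elim exE conjE)
    then show ?thesis using assms(3)[of p x e] by simp
  qed (simp add: assms(2))
qed

lemma locally_convex_lc_inductive_topology:
  assumes "\<And>i. i \<in> I \<Longrightarrow> topspace (S i) \<subseteq> V"
  shows "locally_convex_topology V (lc_inductive_topology V I S)"
proof -
  define TT where "TT = {T. locally_convex_topology V T \<and> (\<forall>i\<in>I. continuous_map (S i) T (\<lambda>x. x))}"
  define PP where "PP = {P. (\<forall>p\<in>P. seminorm_on V p) \<and> seminorm_topology V P \<in> TT}"
  have L: "lc_inductive_topology V I S = topology_generated_by (\<Union>T\<in>TT. {U. openin T U})"
    by (simp add: lc_inductive_topology_def TT_def)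
  have 1: "openin (seminorm_topology V (\<Union>PP)) U" if T: "T \<in> TT" "openin T U" for T U
  proof -
    from T(1) obtain P where P: "\<forall>p\<in>P. seminorm_on V p" "T = seminorm_topology V P"
      unfolding TT_def locally_convex_topology_def by blast
    with T(1) have "P \<in> PP"
      by (simp add: PP_def)
    have "openin (seminorm_topology V P) U"
      using T(2) P(2) by simp
    then show ?thesis
    proof (rule seminorm_topology_coarsest)
      show "openin (seminorm_topology V (\<Union>PP)) V"
        using openin_topspace[of "seminorm_topology V (\<Union>PP)"] by simp
      show "openin (seminorm_topology V (\<Union>PP)) {y \<in> V. p (y - x) < e}"
        if "p \<in> P" "x \<in> V" "0 < e" for p x e
        using that \<open>P \<in> PP\<close> by (intro openin_seminorm_topology_ball) auto
    qed
  qed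
  have 2: "openin (lc_inductive_topology V I S) U" if "openin (seminorm_topology V (\<Union>PP)) U" for U
    using that
  proof (rule seminorm_topology_coarsest)
    show "openin (lc_inductive_topology V I S) V"
    proof -
      have "topspace (lc_inductive_topology V I S) = V"
        using assms by (rule topspace_lc_inductive_topology)
      then show ?thesis
        using openin_topspace[of "lc_inductive_topology V I S"] by simp
    qed
    show "openin (lc_inductive_topology V I S) {y \<in> V. p (y - x) < e}"
      if p: "p \<in> \<Union>PP" and x: "x \<in> V" "0 < e" for p x e
    proof -
      from p obtain P where P: "P \<in> PP" "p \<in> P" by blast
      have "openin (seminorm_topology V P) {y \<in> V. p (y - x) < e}"
        using P(2) x by (rule openin_seminorm_topology_ball)
      moreover have "seminorm_topology V P \<in> TT"
        using P(1) by (simp add: PP_def)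
      ultimately show ?thesis
        unfolding L by (intro topology_generated_by_Basis) blast
    qed
  qed
  have "lc_inductive_topology V I S = seminorm_topology V (\<Union>PP)"
    unfolding topology_eq
  proof (intro allI iffI)
    fix U assume "openin (lc_inductive_topology V I S) U"
    then show "openin (seminorm_topology V (\<Union>PP)) U"
      unfolding L by (rule topology_generated_by_coarsest) (use 1 in blast)
  qed (rule 2)
  moreover have "\<forall>p\<in>\<Union>PP. seminorm_on V p"
    unfolding PP_def by blast
  ultimately show ?thesis
    unfolding locally_convex_topology_def by (intro exI[of _ "\<Union>PP"] conjI)
qed

section \<open>Weight functions\<close>

text \<open>Weight functions live on \<open>[0,\<infinity>)\<close>; their values at negative arguments are irrelevant.\<close>

definition weight_function :: "(real \<Rightarrow> real) \<Rightarrow> bool" where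
  "weight_function w \<longleftrightarrow>
     continuous_on {0..} w \<and> mono_on {0..} w \<and> (\<forall>t\<ge>0. 0 \<le> w t) \<and> w 0 = 0 \<and>
     (\<lambda>t. w (2 * t)) \<in> O[at_top](w) \<and>
     ln \<in> o[at_top](w) \<and>
     convex_on UNIV (\<lambda>t. w (exp t))"

definition non_quasianalytic :: "(real \<Rightarrow> real) \<Rightarrow> bool" where
  "non_quasianalytic w \<longleftrightarrow> (\<integral>\<^sup>+ t\<in>{1..}. ennreal (w t / t\<^sup>2) \<partial>lborel) < \<infinity>"

definition young_conj :: "(real \<Rightarrow> real) \<Rightarrow> real \<Rightarrow> real" where
  "young_conj w t = (SUP s\<in>{0..}. s * t - w (exp s))"

definition strong_pair :: "real \<Rightarrow> (real \<Rightarrow> real) \<Rightarrow> (real \<Rightarrow> real) \<Rightarrow> bool" where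
  "strong_pair r w s \<longleftrightarrow>
     (\<exists>C>0. \<forall>t>0. (\<integral>\<^sup>+ u\<in>{1..}. ennreal (w (t * u) / u powr (1 + r)) \<partial>lborel) \<le> ennreal (C * s t + C))"

section \<open>Multi-indices and smooth functions\<close>

type_synonym 'n mindex = "'n \<Rightarrow> nat"
type_synonym 'n jet = "'n mindex \<Rightarrow> real^'n \<Rightarrow> real"

definition mlen :: "'n::finite mindex \<Rightarrow> nat" where
  "mlen a = (\<Sum>i\<in>UNIV. a i)"

definition mfact :: "'n::finite mindex \<Rightarrow> real" where
  "mfact a = (\<Prod>i\<in>UNIV. fact (a i))"

definition mpow :: "real^'n::finite \<Rightarrow> 'n mindex \<Rightarrow> real" where
  "mpow x a = (\<Prod>i\<in>UNIV. (x $ i) ^ a i)"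

definition partial :: "'n::finite \<Rightarrow> (real^'n \<Rightarrow> real) \<Rightarrow> real^'n \<Rightarrow> real" where
  "partial i f x = deriv (\<lambda>t. f (x + t *\<^sub>R axis i 1)) 0"

definition partials :: "'n::finite list \<Rightarrow> (real^'n \<Rightarrow> real) \<Rightarrow> real^'n \<Rightarrow> real" where
  "partials is f = foldr partial is f"

definition smooth :: "(real^'n::finite \<Rightarrow> real) \<Rightarrow> bool" where
  "smooth f \<longleftrightarrow>
     (\<forall>is. continuous_on UNIV (partials is f) \<and>
        (\<forall>i x. (\<lambda>t. partials is f (x + t *\<^sub>R axis i 1)) field_differentiable at 0))"

text \<open>The order of differentiation is chosen arbitrarily (the index type \<open>'n\<close> is not ordered);
  by Schwarz' theorem it is immaterial for smooth functions.\<close>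

definition mderiv :: "'n::finite mindex \<Rightarrow> (real^'n \<Rightarrow> real) \<Rightarrow> real^'n \<Rightarrow> real" where
  "mderiv a f = partials (SOME is. \<forall>i. count_list is i = a i) f"

section \<open>The Beurling class\<close>

definition weight_factor :: "(real \<Rightarrow> real) \<Rightarrow> real \<Rightarrow> nat \<Rightarrow> real" where
  "weight_factor w \<rho> k = exp (- (1 / \<rho>) * young_conj w (\<rho> * real k))"

definition fun_norm ::
    "(real \<Rightarrow> real) \<Rightarrow> (real^'n::finite) set \<Rightarrow> real \<Rightarrow> (real^'n \<Rightarrow> real) \<Rightarrow> ennreal" where
  "fun_norm w U \<rho> f = (SUP x\<in>U. SUP a. ennreal (\<bar>mderiv a f x\<bar> * weight_factor w \<rho> (mlen a)))"

definition beurling_class :: "(real \<Rightarrow> real) \<Rightarrow> (real^'n::finite \<Rightarrow> real) set" where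
  "beurling_class w =
     {f. smooth f \<and> (\<forall>U k. open U \<and> compact (closure U) \<and> 1 \<le> (k::nat) \<longrightarrow> fun_norm w U (1 / real k) f < \<infinity>)}"

definition beurling_topology :: "(real \<Rightarrow> real) \<Rightarrow> (real^'n::finite \<Rightarrow> real) topology" where
  "beurling_topology w =
     seminorm_topology (beurling_class w)
       {(\<lambda>f. enn2real (fun_norm w U (1 / real k) f)) | U k. open U \<and> compact (closure U) \<and> 1 \<le> (k::nat)}"

section \<open>Whitney jets and ultrajets\<close>

text \<open>A jet on \<open>A\<close> is represented by its extension by \<open>0\<close> outside \<open>A\<close>.\<close>

definition jet_restrict :: "(real^'n::finite) set \<Rightarrow> 'n jet \<Rightarrow> 'n jet" where
  "jet_restrict A F = (\<lambda>a x. if x \<in> A then F a x else 0)"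

definition jet_remainder ::
    "nat \<Rightarrow> 'n::finite jet \<Rightarrow> real^'n \<Rightarrow> 'n mindex \<Rightarrow> real^'n \<Rightarrow> real" where
  "jet_remainder p F x a y =
     F a y - (\<Sum>b | mlen b \<le> p - mlen a. mpow (y - x) b / mfact b * F (\<lambda>i. a i + b i) x)"

definition whitney_jets :: "(real^'n::finite) set \<Rightarrow> 'n jet set" where
  "whitney_jets A =
     {F. (\<forall>a. continuous_on A (F a)) \<and> (\<forall>a x. x \<notin> A \<longrightarrow> F a x = 0) \<and>
         (\<forall>K p a. compact K \<and> K \<subseteq> A \<and> mlen a \<le> p \<longrightarrow>
            (\<forall>e>0. \<exists>d>0. \<forall>x\<in>K. \<forall>y\<in>K. norm (y - x) < d \<longrightarrow>
               \<bar>jet_remainder p F x a y\<bar> \<le> e * norm (y - x) ^ (p - mlen a)))}"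

definition jet_norm1 ::
    "(real \<Rightarrow> real) \<Rightarrow> (real^'n::finite) set \<Rightarrow> real \<Rightarrow> 'n jet \<Rightarrow> ennreal" where
  "jet_norm1 w K \<rho> F = (SUP x\<in>K. SUP a. ennreal (\<bar>F a x\<bar> * weight_factor w \<rho> (mlen a)))"

definition jet_norm2 ::
    "(real \<Rightarrow> real) \<Rightarrow> (real^'n::finite) set \<Rightarrow> real \<Rightarrow> 'n jet \<Rightarrow> ennreal" where
  "jet_norm2 w K \<rho> F =
     (SUP x\<in>K. SUP y\<in>K - {x}. SUP p. SUP a\<in>{a. mlen a \<le> p}.
        ennreal (\<bar>jet_remainder p F x a y\<bar> * fact (p + 1 - mlen a) / norm (x - y) ^ (p + 1 - mlen a)
                 * weight_factor w \<rho> (p + 1)))"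

definition jet_norm ::
    "(real \<Rightarrow> real) \<Rightarrow> (real^'n::finite) set \<Rightarrow> real \<Rightarrow> 'n jet \<Rightarrow> ennreal" where
  "jet_norm w K \<rho> F = jet_norm1 w K \<rho> F + jet_norm2 w K \<rho> F"

definition ultrajets :: "(real \<Rightarrow> real) \<Rightarrow> (real^'n::finite) set \<Rightarrow> 'n jet set" where
  "ultrajets w A =
     {F \<in> whitney_jets A. \<forall>K. compact K \<and> K \<subseteq> A \<longrightarrow> (\<exists>m::nat. 1 \<le> m \<and> jet_norm w K (real m) F < \<infinity>)}"

definition ultrajet_step_topology ::
    "(real \<Rightarrow> real) \<Rightarrow> (real^'n::finite) set \<Rightarrow> nat \<Rightarrow> 'n jet topology" where
  "ultrajet_step_topology w K m =
     seminorm_topology {F \<in> whitney_jets K. jet_norm w K (real m) F < \<infinity>}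
       {\<lambda>F. enn2real (jet_norm w K (real m) F)}"

definition ultrajet_compact_topology ::
    "(real \<Rightarrow> real) \<Rightarrow> (real^'n::finite) set \<Rightarrow> 'n jet topology" where
  "ultrajet_compact_topology w K =
     lc_inductive_topology (ultrajets w K) {1..} (ultrajet_step_topology w K)"

definition ultrajet_topology ::
    "(real \<Rightarrow> real) \<Rightarrow> (real^'n::finite) set \<Rightarrow> 'n jet topology" where
  "ultrajet_topology w A =
     initial_topology_on (ultrajets w A) {K. compact K \<and> K \<noteq> {} \<and> K \<subseteq> A}
       jet_restrict (ultrajet_compact_topology w)"

definition jet_map :: "(real^'n::finite) set \<Rightarrow> (real^'n \<Rightarrow> real) \<Rightarrow> 'n jet" where
  "jet_map A f = jet_restrict A (\<lambda>a. mderiv a f)"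

end

theory Submission
  imports Defs
begin

text \<open>Whitney's construction glues Taylor polynomials of the jet \<open>F\<close>: near a point at distance about \<open>e j\<close> from \<open>A\<close>
the extension looks like the Taylor polynomial of degree below \<open>q j\<close> at a closest point of \<open>A\<close>. For the
operator to be linear, the degrees \<open>q j\<close> and the cut-offs may depend on the scale \<open>j\<close> and on the weights only.
Every step between two scales pays for the derivatives of the cut-offs and gains from the difference of two Taylor
polynomials, and the proof consists in choosing scales and degrees such that the gain beats every power of the cost.

\<^emph>\<open>The operator.\<close> At scale \<open>j\<close>, translates of a product of smooth steps form a lattice partition of unity into
cells of width comparable to \<open>e j\<close>. Each cell is anchored at a point of \<open>A\<close>, and \<open>patch F j\<close> is the sum of
the cells times the Taylor polynomials at their anchors. The extension is the series of the layers, where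
\<open>layer F (Suc j)\<close> is \<open>patch F (Suc j) - patch F j\<close>, localised to the cells of scale \<open>Suc j\<close> that are near \<open>A\<close>.
Around a point of \<open>A\<close> the layers telescope, so that the partial sums of the series have there the jets of the patches
(\<open>sum_layers_close\<close>). Consequently a single estimate suffices: if all derivatives of the layers are summable, then the
extension is smooth, satisfies the same bounds, and has the prescribed jet
(\<open>growth_layer\<close>, \<open>growth_extension\<close>, \<open>partials_extension_at\<close>). No separate study of points approaching \<open>A\<close>
is needed.

\<^emph>\<open>The estimate.\<close> First \<open>\<omega>\<close> is replaced by a weight \<open>w\<close> that dominates every multiple of \<open>\<omega>\<close>, so that one Roumieu-type
bound by the sequence \<open>M = conj_seq w\<close> implies all Beurling-type bounds for \<open>\<omega>\<close> (\<open>conj_seq_absorb\<close>). Let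
\<open>I t\<close> be the integral of \<open>w v / v\<^sup>2\<close> over \<open>v \<ge> t\<close>. A smooth step of width \<open>2 * I t\<close> exists whose derivative of
order \<open>l\<close> is at most \<open>exp (w t)\<close> times \<open>M l\<close>, up to a geometric factor (\<open>conj_seq_cutoff\<close>). With \<open>t = 2 ^ j\<close> and
\<open>e j = 2 * I t\<close>, the logarithm of the cost is at most a multiple of \<open>t * I t\<close>. On the other side lies
a log-convex weight \<open>s\<close> with \<open>\<sigma> \<lless> s \<lless> \<tau>\<close>. The jets of the Roumieu class of \<open>\<tau>\<close> are bounded by the conjugate of \<open>s\<close>,
and if the degree is the slope of \<open>s\<close> at \<open>t\<close> on the logarithmic scale, then the difference of two Taylor polynomials at
distance about \<open>e j\<close> is at most \<open>exp (- s t)\<close> up to the exponential of a multiple of \<open>t * e j\<close>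
(\<open>young_conj_degree\<close>, \<open>partials_taylor_diff_le\<close>). The pair being strong, \<open>w\<close> and \<open>s\<close> can be chosen such that
\<open>s t\<close> exceeds every multiple of \<open>t * I t + ln t\<close> up to a constant (\<open>boosted_weight\<close>), and the gain wins.

\<^emph>\<open>Continuity.\<close> On a ball the extension depends only on the restriction of \<open>F\<close> to a compact part of \<open>A\<close>, and each
Beurling seminorm of it is at most a constant times each of the norms defining the inductive limit over that part. It is
therefore a continuous seminorm of the inductive limit (\<open>local_seminorm\<close>).\<close>

section \<open>Iterated partial derivatives\<close>

definition has_partial :: "'n::finite \<Rightarrow> (real^'n \<Rightarrow> real) \<Rightarrow> real \<Rightarrow> real^'n \<Rightarrow> bool" where
  "has_partial i f d x \<longleftrightarrow> ((\<lambda>t. f (x + t *\<^sub>R axis i 1)) has_real_derivative d) (at 0)"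

text \<open>Smoothness on a set is needed because a jet is bounded on compact parts of \<open>A\<close> only: the estimates for its
extension are valid on balls, with constants that depend on the ball.\<close>

definition smooth_on :: "(real^'n::finite) set \<Rightarrow> (real^'n \<Rightarrow> real) \<Rightarrow> bool" where
  "smooth_on S f \<longleftrightarrow>
     (\<forall>is. continuous_on S (partials is f) \<and> (\<forall>i. \<forall>x\<in>S. has_partial i (partials is f) (partials (i # is) f x) x))"

lemma partials_Nil [simp]: "partials [] f = f"
  by (simp add: partials_def)

lemma partials_Cons: "partials (i # is) f = partial i (partials is f)"
  by (simp add: partials_def)

lemma has_partial_imp_partial: "has_partial i f d x \<Longrightarrow> partial i f x = d"
  unfolding has_partial_def partial_def by (rule DERIV_imp_deriv)

lemma has_partial_iff_differentiable:
  "has_partial i f (partial i f x) x \<longleftrightarrow> (\<lambda>t. f (x + t *\<^sub>R axis i 1)) field_differentiable at 0"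
  unfolding has_partial_def partial_def field_differentiable_def
  by (auto simp: DERIV_deriv_iff_field_differentiable field_differentiable_def dest: DERIV_imp_deriv)

lemma smooth_on_UNIV_iff: "smooth f \<longleftrightarrow> smooth_on UNIV f"
  unfolding smooth_def smooth_on_def partials_Cons has_partial_iff_differentiable by blast

lemma has_partial_add:
  "has_partial i f a x \<Longrightarrow> has_partial i g b x \<Longrightarrow> has_partial i (\<lambda>x. f x + g x) (a + b) x"
  unfolding has_partial_def by (rule DERIV_add)

lemma has_partial_cmult: "has_partial i f a x \<Longrightarrow> has_partial i (\<lambda>x. c * f x) (c * a) x"
  unfolding has_partial_def by (rule DERIV_cmult)

lemma has_partial_mult:
  assumes "has_partial i f a x" "has_partial i g b x"
  shows "has_partial i (\<lambda>x. f x * g x) (a * g x + f x * b) x"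
  using DERIV_mult[OF assms[unfolded has_partial_def]]
  unfolding has_partial_def by (simp add: mult.commute)

lemma has_partial_const: "has_partial i (\<lambda>_. c) 0 x"
  unfolding has_partial_def by simp

lemma has_partial_sum_list:
  assumes "\<And>y. y \<in> set ys \<Longrightarrow> has_partial i (f y) (d y) x"
  shows "has_partial i (\<lambda>x. \<Sum>y\<leftarrow>ys. f y x) (\<Sum>y\<leftarrow>ys. d y) x"
  using assms by (induction ys) (auto intro: has_partial_add has_partial_const)

lemma eventually_line_mem_open:
  fixes x v :: "'a::real_normed_vector"
  assumes "open S" "x \<in> S"
  shows "\<forall>\<^sub>F t in nhds (0::real). x + t *\<^sub>R v \<in> S"
proof -
  have "((\<lambda>t::real. x + t *\<^sub>R v) \<longlongrightarrow> x + 0 *\<^sub>R v) (nhds 0)"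
    by (intro tendsto_intros) (auto simp: filterlim_ident)
  then show ?thesis
    using assms topological_tendstoD by fastforce
qed

lemma has_partial_cong_open:
  assumes "open S" "x \<in> S" "\<And>y. y \<in> S \<Longrightarrow> f y = g y"
  shows "has_partial i f d x \<longleftrightarrow> has_partial i g d x"
  unfolding has_partial_def
proof (rule DERIV_cong_ev)
  show "\<forall>\<^sub>F t in nhds 0. f (x + t *\<^sub>R axis i 1) = g (x + t *\<^sub>R axis i 1)"
    using eventually_line_mem_open[OF assms(1,2)] by eventually_elim (rule assms(3))
qed auto

text \<open>Recognition principle: a family of functions indexed by lists of directions, in which each member is a partial
derivative of its predecessor, is the family of iterated partial derivatives. Sums, products, series and Taylor
polynomials are all differentiated by exhibiting such a family.\<close>

lemma partials_tower:
  assumes "open S" "\<And>x. x \<in> S \<Longrightarrow> D [] x = f x"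
    and "\<And>is i x. x \<in> S \<Longrightarrow> has_partial i (D is) (D (i # is) x) x" and "x \<in> S"
  shows "partials is f x = D is x"
  using assms(4)
proof (induction "is" arbitrary: x)
  case (Cons i "is")
  have "has_partial i (partials is f) (D (i # is) x) x"
    using has_partial_cong_open[OF assms(1) Cons.prems, of "partials is f" "D is"] Cons.IH
      assms(3)[OF Cons.prems] by blast
  then show ?case
    by (simp add: partials_Cons has_partial_imp_partial)
qed (simp add: assms(2))

lemma smooth_on_tower:
  assumes "open S" "\<And>x. x \<in> S \<Longrightarrow> D [] x = f x"
    and "\<And>is i x. x \<in> S \<Longrightarrow> has_partial i (D is) (D (i # is) x) x"
    and "\<And>is. continuous_on S (D is)"
  shows "smooth_on S f"
  unfolding smooth_on_def
proof (intro allI conjI ballI)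
  note T = partials_tower[where f = f and D = D, OF assms(1,2,3)]
  show "continuous_on S (partials is f)" for "is"
    using assms(4)[of "is"] by (rule continuous_on_eq) (simp add: T)
  show "has_partial i (partials is f) (partials (i # is) f x) x" if "x \<in> S" for i x "is"
    using has_partial_cong_open[OF assms(1) that, of "partials is f" "D is"] T assms(3)[OF that] that
    by simp
qed

lemma smooth_on_partial:
  "smooth_on S f \<Longrightarrow> x \<in> S \<Longrightarrow> has_partial i (partials is f) (partials (i # is) f x) x"
  by (simp add: smooth_on_def)

lemma smooth_on_cont: "smooth_on S f \<Longrightarrow> continuous_on S (partials is f)"
  by (simp add: smooth_on_def)

lemma smooth_on_subset: "smooth_on S f \<Longrightarrow> T \<subseteq> S \<Longrightarrow> smooth_on T f"
  unfolding smooth_on_def by (meson continuous_on_subset subsetD)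

lemma partials_cong_open:
  assumes "open S" "\<And>y. y \<in> S \<Longrightarrow> f y = g y" "x \<in> S"
  shows "partials is f x = partials is g x"
  using assms(3)
proof (induction "is" arbitrary: x)
  case (Cons i "is")
  have "(\<forall>\<^sub>F t in nhds 0. partials is f (x + t *\<^sub>R axis i 1) = partials is g (x + t *\<^sub>R axis i 1))"
    using eventually_line_mem_open[OF assms(1) Cons.prems] by eventually_elim (rule Cons.IH)
  then show ?case
    unfolding partials_Cons partial_def by (rule deriv_cong_ev) simp
qed (simp add: assms(2))

lemma smooth_on_cong_open:
  assumes "open S" "\<And>y. y \<in> S \<Longrightarrow> f y = g y" "smooth_on S f"
  shows "smooth_on S g"
proof (rule smooth_on_tower[where D = "\<lambda>is. partials is f"])
  show "has_partial i (partials is f) (partials (i # is) f x) x" if "x \<in> S" for i x "is"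
    using smooth_on_partial[OF assms(3) that] .
qed (use assms smooth_on_cont in auto)

lemma
  assumes "open S" "smooth_on S f" "smooth_on S g"
  shows smooth_on_add: "smooth_on S (\<lambda>x. f x + g x)"
    and partials_add: "x \<in> S \<Longrightarrow> partials is (\<lambda>x. f x + g x) x = partials is f x + partials is g x"
proof -
  let ?D = "\<lambda>is x. partials is f x + partials is g x"
  have D: "has_partial i (?D is) (?D (i # is) x) x" if "x \<in> S" for i x "is"
    using assms that by (intro has_partial_add smooth_on_partial)
  show "smooth_on S (\<lambda>x. f x + g x)"
    by (rule smooth_on_tower[where D = ?D, OF assms(1) _ D])
      (use assms smooth_on_cont in \<open>auto intro!: continuous_intros\<close>)
  show "x \<in> S \<Longrightarrow> partials is (\<lambda>x. f x + g x) x = partials is f x + partials is g x"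
    by (rule partials_tower[where D = ?D, OF assms(1) _ D]) auto
qed

lemma
  assumes "open S" "smooth_on S f"
  shows smooth_on_cmult: "smooth_on S (\<lambda>x. c * f x)"
    and partials_cmult: "x \<in> S \<Longrightarrow> partials is (\<lambda>x. c * f x) x = c * partials is f x"
proof -
  let ?D = "\<lambda>is x. c * partials is f x"
  have D: "has_partial i (?D is) (?D (i # is) x) x" if "x \<in> S" for i x "is"
    using assms that by (intro has_partial_cmult smooth_on_partial)
  show "smooth_on S (\<lambda>x. c * f x)"
    by (rule smooth_on_tower[where D = ?D, OF assms(1) _ D])
      (use assms smooth_on_cont in \<open>auto intro!: continuous_intros\<close>)
  show "x \<in> S \<Longrightarrow> partials is (\<lambda>x. c * f x) x = c * partials is f x"
    by (rule partials_tower[where D = ?D, OF assms(1) _ D]) auto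
qed

lemma
  assumes "open S"
  shows smooth_on_const: "smooth_on S (\<lambda>_. c)"
    and partials_const: "x \<in> S \<Longrightarrow> partials is (\<lambda>_. c) x = (if is = [] then c else 0)"
proof -
  let ?D = "\<lambda>is x. if is = [] then c else 0"
  have D: "has_partial i (?D is) (?D (i # is) x) x" if "x \<in> S" for i x "is"
    using has_partial_const by auto
  show "smooth_on S (\<lambda>_. c)"
    by (rule smooth_on_tower[where D = ?D, OF assms(1) _ D]) auto
  show "x \<in> S \<Longrightarrow> partials is (\<lambda>_. c) x = (if is = [] then c else 0)"
    by (rule partials_tower[where D = ?D, OF assms(1) _ D]) auto
qed

lemma
  assumes "open S" "finite I" "\<And>i. i \<in> I \<Longrightarrow> smooth_on S (f i)"
  shows smooth_on_sum: "smooth_on S (\<lambda>x. \<Sum>i\<in>I. f i x)"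
    and partials_sum: "x \<in> S \<Longrightarrow> partials is (\<lambda>x. \<Sum>i\<in>I. f i x) x = (\<Sum>i\<in>I. partials is (f i) x)"
proof -
  have "smooth_on S (\<lambda>x. \<Sum>i\<in>I. f i x) \<and>
     (\<forall>x\<in>S. partials is (\<lambda>x. \<Sum>i\<in>I. f i x) x = (\<Sum>i\<in>I. partials is (f i) x))"
    using assms(2,3)
  proof (induction I rule: finite_induct)
    case empty
    then show ?case
      using smooth_on_const[OF assms(1)] partials_const[OF assms(1), of _ "is" 0] by auto
  next
    case (insert i I)
    then show ?case
      using smooth_on_add[OF assms(1), of "f i" "\<lambda>x. \<Sum>i\<in>I. f i x"]
        partials_add[OF assms(1), of "f i" "\<lambda>x. \<Sum>i\<in>I. f i x"] by auto
  qed
  then show "smooth_on S (\<lambda>x. \<Sum>i\<in>I. f i x)"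
    and "x \<in> S \<Longrightarrow> partials is (\<lambda>x. \<Sum>i\<in>I. f i x) x = (\<Sum>i\<in>I. partials is (f i) x)"
    by auto
qed

text \<open>The ways to distribute a list of directions over two factors. Leibniz' rule over these splittings needs
neither binomial coefficients nor the symmetry of iterated derivatives.\<close>

fun splits :: "'a list \<Rightarrow> ('a list \<times> 'a list) list" where
  "splits [] = [([], [])]"
| "splits (i # is) = map (\<lambda>(l, r). (i # l, r)) (splits is) @ map (\<lambda>(l, r). (l, i # r)) (splits is)"

lemma length_splits: "(l, r) \<in> set (splits is) \<Longrightarrow> length l + length r = length is"
  by (induction "is" arbitrary: l r) auto

lemma sum_splits_power:
  "(\<Sum>(l, r)\<leftarrow>splits is. a ^ length l * b ^ length r) = (a + b :: real) ^ length is"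
proof (induction "is")
  case (Cons i "is")
  have "(\<Sum>(l, r)\<leftarrow>splits (i # is). a ^ length l * b ^ length r) =
     a * (\<Sum>(l, r)\<leftarrow>splits is. a ^ length l * b ^ length r) + b * (\<Sum>(l, r)\<leftarrow>splits is. a ^ length l * b ^ length r)"
    by (simp add: o_def case_prod_unfold sum_list_const_mult[symmetric] mult_ac)
  then show ?case
    using Cons.IH by (simp add: algebra_simps)
qed auto

lemma
  assumes "open S" "smooth_on S f" "smooth_on S g"
  shows smooth_on_mult: "smooth_on S (\<lambda>x. f x * g x)"
    and partials_mult: "x \<in> S \<Longrightarrow> partials is (\<lambda>x. f x * g x) x =
      (\<Sum>(l, r)\<leftarrow>splits is. partials l f x * partials r g x)"
proof -
  let ?D = "\<lambda>is x. \<Sum>(l, r)\<leftarrow>splits is. partials l f x * partials r g x"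
  have D: "has_partial i (?D is) (?D (i # is) x) x" if "x \<in> S" for i x "is"
  proof -
    have "has_partial i (?D is) (\<Sum>(l, r)\<leftarrow>splits is.
        partials (i # l) f x * partials r g x + partials l f x * partials (i # r) g x) x"
      unfolding case_prod_unfold using assms that
      by (intro has_partial_sum_list has_partial_mult smooth_on_partial)
    also have "(\<Sum>(l, r)\<leftarrow>splits is.
        partials (i # l) f x * partials r g x + partials l f x * partials (i # r) g x) = ?D (i # is) x"
      by (simp add: o_def case_prod_unfold sum_list_addf)
    finally show ?thesis .
  qed
  have C: "continuous_on S (\<lambda>x. \<Sum>(l, r)\<leftarrow>ys. partials l f x * partials r g x)" for ys
    by (induction ys) (use assms smooth_on_cont in \<open>auto intro!: continuous_intros\<close>)
  show "smooth_on S (\<lambda>x. f x * g x)"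
    by (rule smooth_on_tower[where D = ?D, OF assms(1) _ D C]) auto
  show "x \<in> S \<Longrightarrow> partials is (\<lambda>x. f x * g x) x = ?D is x"
    by (rule partials_tower[where D = ?D, OF assms(1) _ D]) auto
qed

lemma
  fixes D :: "nat \<Rightarrow> real \<Rightarrow> real" and S :: "(real^'n::finite) set"
  assumes "open S" and D: "\<And>l x. (D l has_real_derivative D (Suc l) x) (at x)"
  shows smooth_on_coordinate: "smooth_on S (\<lambda>x. D 0 (x $ k))"
    and partials_coordinate: "x \<in> S \<Longrightarrow> partials is (\<lambda>x. D 0 (x $ k)) x =
      (if set is \<subseteq> {k} then D (length is) (x $ k) else 0)"
proof -
  let ?D = "\<lambda>is x. if set is \<subseteq> {k} then D (length is) (x $ k) else 0"
  have 1: "has_partial i (?D is) (?D (i # is) x) x" if "x \<in> S" for i x "is"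
  proof (cases "set is \<subseteq> {k} \<and> i = k")
    case True
    have "((\<lambda>t. D (length is) (x $ k + t)) has_real_derivative D (Suc (length is)) (x $ k + 0)) (at 0)"
      using D[of "length is" "x $ k + 0"] DERIV_shift[of "D (length is)" _ 0 "x $ k"]
      by (simp add: add.commute)
    then show ?thesis
      using True by (simp add: has_partial_def)
  next
    case False
    then have "(\<lambda>t. ?D is (x + t *\<^sub>R axis i 1)) = (\<lambda>t. ?D is x)"
      by (auto simp: axis_def)
    then show ?thesis
      using False by (simp add: has_partial_def split: if_splits)
  qed
  have "continuous_on T (D l)" for T l
    using D by (meson DERIV_isCont continuous_at_imp_continuous_on)
  then have "continuous_on S (\<lambda>x. D l (x $ k))" for l
    by (rule continuous_on_compose2[of UNIV]) (auto intro!: continuous_intros)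
  then have C: "continuous_on S (?D is)" for "is"
    by (cases "set is \<subseteq> {k}") simp_all
  show "smooth_on S (\<lambda>x. D 0 (x $ k))"
    by (rule smooth_on_tower[where D = ?D, OF assms(1) _ 1 C]) auto
  show "x \<in> S \<Longrightarrow> partials is (\<lambda>x. D 0 (x $ k)) x = ?D is x"
    by (rule partials_tower[where D = ?D, OF assms(1) _ 1]) auto
qed

text \<open>On each line, the one-dimensional theorem on termwise differentiation applies, because the dominating series makes
all the series of derivatives converge uniformly.\<close>

lemma
  fixes u :: "nat \<Rightarrow> real^'n::finite \<Rightarrow> real"
  assumes S: "open S" and u: "\<And>j. smooth_on S (u j)"
    and b: "\<And>is. summable (b is)" "\<And>is j x. x \<in> S \<Longrightarrow> \<bar>partials is (u j) x\<bar> \<le> b is j"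
  shows smooth_on_suminf: "smooth_on S (\<lambda>x. \<Sum>j. u j x)"
    and partials_suminf: "x \<in> S \<Longrightarrow> partials is (\<lambda>x. \<Sum>j. u j x) x = (\<Sum>j. partials is (u j) x)"
proof -
  let ?D = "\<lambda>is x. \<Sum>j. partials is (u j) x"
  have unif: "uniform_limit S (\<lambda>n x. \<Sum>j<n. partials is (u j) x) (?D is) sequentially" for "is"
    by (rule Weierstrass_m_test) (use b in auto)
  have C: "continuous_on S (?D is)" for "is"
    by (rule uniform_limit_theorem[OF _ unif])
       (use u smooth_on_cont in \<open>auto intro!: continuous_intros always_eventually\<close>)
  have D: "has_partial i (?D is) (?D (i # is) x) x" if x: "x \<in> S" for i x "is"
  proof -
    let ?p = "\<lambda>t::real. x + t *\<^sub>R axis i 1"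
    obtain d where d: "d > 0" "\<And>t. \<bar>t\<bar> < d \<Longrightarrow> ?p t \<in> S"
      using eventually_line_mem_open[OF S x, of "axis i 1"]
      by (auto simp: eventually_nhds_metric dist_real_def)
    let ?T = "{-d<..<d}"
    have pT: "?p t \<in> S" if "t \<in> ?T" for t
      using d(2)[of t] that by auto
    have "((\<lambda>t. \<Sum>j. partials is (u j) (?p t)) has_field_derivative
            (\<Sum>j. partials (i # is) (u j) (?p 0))) (at 0)"
    proof (rule has_field_derivative_series'(2)[where S = ?T and ?x0.0 = 0])
      show "((\<lambda>t. partials is (u n) (?p t)) has_field_derivative partials (i # is) (u n) (?p t))
              (at t within ?T)" if t: "t \<in> ?T" for n t
      proof -
        have "has_partial i (partials is (u n)) (partials (i # is) (u n) (?p t)) (?p t)"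
          using smooth_on_partial[OF u pT[OF t]] .
        then have "((\<lambda>s. partials is (u n) (?p (s + t))) has_real_derivative
             partials (i # is) (u n) (?p t)) (at 0)"
          by (simp add: has_partial_def algebra_simps)
        then have "((\<lambda>t. partials is (u n) (?p t)) has_real_derivative
             partials (i # is) (u n) (?p t)) (at t)"
          using DERIV_shift[of "\<lambda>t. partials is (u n) (?p t)" _ 0 t] by simp
        then show ?thesis
          by (rule has_field_derivative_at_within)
      qed
      have "uniform_limit ?T (\<lambda>n t. \<Sum>j<n. partials (i # is) (u j) (?p t))
               (\<lambda>t. \<Sum>j. partials (i # is) (u j) (?p t)) sequentially"
        by (rule Weierstrass_m_test[OF _ b(1)[of "i # is"]]) (use b pT in auto)
      then show "uniformly_convergent_on ?T (\<lambda>n t. \<Sum>j<n. partials (i # is) (u j) (?p t))"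
        by (auto simp: uniformly_convergent_on_def)
      show "summable (\<lambda>n. partials is (u n) (?p 0))"
        by (rule summable_comparison_test'[OF b(1)[of "is"], of 0]) (use b x in auto)
    qed (use d in auto)
    then show ?thesis
      by (simp add: has_partial_def)
  qed
  show "smooth_on S (\<lambda>x. \<Sum>j. u j x)"
    by (rule smooth_on_tower[where D = ?D, OF S _ D C]) auto
  show "x \<in> S \<Longrightarrow> partials is (\<lambda>x. \<Sum>j. u j x) x = ?D is x"
    by (rule partials_tower[where D = ?D, OF S _ D]) auto
qed

text \<open>The bound that is propagated through the construction. It refers to a single point, so that it can be
sharper where a factor vanishes. Under products the first constant multiplies and the second one adds.\<close>

definition growth_at ::
    "(nat \<Rightarrow> real) \<Rightarrow> real^'n::finite \<Rightarrow> real \<Rightarrow> real \<Rightarrow> (real^'n \<Rightarrow> real) \<Rightarrow> bool" where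
  "growth_at M x C L f \<longleftrightarrow> (\<forall>is. \<bar>partials is f x\<bar> \<le> C * L ^ length is * M (length is))"

text \<open>Leibniz' rule: supermultiplicativity of \<open>M\<close> collects the orders of both factors, and the splittings of a list
sum to the binomial expansion of \<open>(L + L') ^ k\<close>.\<close>

lemma growth_at_mult:
  assumes "open S" "smooth_on S f" "smooth_on S g" "x \<in> S"
    and M: "\<And>k l. M k * M l \<le> M (k + l)" "\<And>k. 0 \<le> M k"
    and f: "growth_at M x C L f" and g: "growth_at M x C' L' g"
    and nonneg: "0 \<le> C" "0 \<le> C'" "0 \<le> L" "0 \<le> L'"
  shows "growth_at M x (C * C') (L + L') (\<lambda>x. f x * g x)"
  unfolding growth_at_def
proof
  fix "is" :: "'a list"
  have *: "\<bar>partials l f x * partials r g x\<bar> \<le> C * C' * M (length is) * (L ^ length l * L' ^ length r)"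
    if "(l, r) \<in> set (splits is)" for l r
  proof -
    have "\<bar>partials l f x * partials r g x\<bar> \<le>
        (C * L ^ length l * M (length l)) * (C' * L' ^ length r * M (length r))"
      using f g M nonneg unfolding abs_mult growth_at_def by (intro mult_mono) auto
    also have "\<dots> = C * C' * (L ^ length l * L' ^ length r) * (M (length l) * M (length r))"
      by (simp add: mult_ac)
    also have "\<dots> \<le> C * C' * (L ^ length l * L' ^ length r) * M (length is)"
      using M(1)[of "length l" "length r"] nonneg length_splits[OF that] by (intro mult_left_mono) auto
    finally show ?thesis
      by (simp add: mult_ac)
  qed
  have "\<bar>partials is (\<lambda>x. f x * g x) x\<bar> \<le>
      (\<Sum>(l, r)\<leftarrow>splits is. \<bar>partials l f x * partials r g x\<bar>)"
    unfolding partials_mult[OF assms(1-4)]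
    using sum_list_abs[of "map (\<lambda>(l, r). partials l f x * partials r g x) (splits is)"]
    by (simp add: o_def case_prod_unfold)
  also have "\<dots> \<le> (\<Sum>(l, r)\<leftarrow>splits is. C * C' * M (length is) * (L ^ length l * L' ^ length r))"
    by (rule sum_list_mono) (use * in auto)
  also have "\<dots> = C * C' * M (length is) * (\<Sum>(l, r)\<leftarrow>splits is. L ^ length l * L' ^ length r)"
    by (simp add: case_prod_unfold sum_list_const_mult)
  also have "\<dots> = C * C' * (L + L') ^ length is * M (length is)"
    by (simp add: sum_splits_power)
  finally show "\<bar>partials is (\<lambda>x. f x * g x) x\<bar> \<le> C * C' * (L + L') ^ length is * M (length is)" .
qed

lemma smooth_on_prod:
  assumes "open S" "finite I" "\<And>i. i \<in> I \<Longrightarrow> smooth_on S (f i)"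
  shows "smooth_on S (\<lambda>x. \<Prod>i\<in>I. f i x)"
  using assms(2,3)
  by (induction I rule: finite_induct) (auto simp: smooth_on_const smooth_on_mult assms(1))

lemma growth_at_prod:
  assumes "open S" "x \<in> S" "finite I" "\<And>i. i \<in> I \<Longrightarrow> smooth_on S (f i)"
    and M: "\<And>k l. M k * M l \<le> M (k + l)" "\<And>k. 0 \<le> M k" "1 \<le> M 0"
    and "\<And>i. i \<in> I \<Longrightarrow> growth_at M x (C i) (L i) (f i)"
    and "\<And>i. i \<in> I \<Longrightarrow> 0 \<le> C i" "\<And>i. i \<in> I \<Longrightarrow> 0 \<le> L i"
  shows "growth_at M x (\<Prod>i\<in>I. C i) (\<Sum>i\<in>I. L i) (\<lambda>x. \<Prod>i\<in>I. f i x)"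
  using assms(3,4,8-10)
proof (induction I rule: finite_induct)
  case empty
  then show ?case
    using M by (simp add: growth_at_def partials_const[OF assms(1,2)])
next
  case (insert i I)
  then show ?case
    using assms(1,2) M
    by (simp add: growth_at_mult[OF assms(1) _ smooth_on_prod] prod_nonneg sum_nonneg)
qed

section \<open>Taylor polynomials of jets\<close>

definition mono_term :: "real^'n::finite \<Rightarrow> 'n mindex \<Rightarrow> real" where
  "mono_term x b = mpow x b / mfact b"

definition taylor :: "nat \<Rightarrow> 'n::finite jet \<Rightarrow> real^'n \<Rightarrow> real^'n \<Rightarrow> real" where
  "taylor q F a x = (\<Sum>b | mlen b < q. mono_term (x - a) b * F b a)"

definition jet_shift :: "'n::finite mindex \<Rightarrow> 'n jet \<Rightarrow> 'n jet" where
  "jet_shift c F = (\<lambda>b. F (\<lambda>i. c i + b i))"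

lemma mono_term_altdef: "mono_term x b = (\<Prod>i\<in>UNIV. (x $ i) ^ b i / fact (b i))"
  by (simp add: mono_term_def mpow_def mfact_def prod_dividef)

lemma le_mlen: "b i \<le> mlen (b :: 'n::finite mindex)"
  unfolding mlen_def by (rule member_le_sum) auto

lemma finite_mlen_less: "finite {b :: 'n::finite mindex. mlen b < q}"
proof (rule finite_subset)
  show "{b :: 'n mindex. mlen b < q} \<subseteq> PiE UNIV (\<lambda>_. {..<q})"
    using le_mlen le_less_trans by fastforce
qed (auto intro: finite_PiE)

lemma mlen_add: "mlen (\<lambda>i. a i + b i) = mlen a + mlen b"
  by (simp add: mlen_def sum.distrib)

lemma mlen_fun_upd_Suc: "mlen (c(i := Suc (c i))) = Suc (mlen c)"
proof -
  have "mlen (c(i := k)) = k + (\<Sum>j\<in>UNIV - {i}. c j)" for k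
    unfolding mlen_def by (subst sum.remove[of UNIV i]) (auto intro!: sum.cong)
  from this[of "c i"] this[of "Suc (c i)"] show ?thesis by simp
qed

lemma mlen_count_list: "mlen (count_list is) = length is"
  unfolding mlen_def by (rule sum_count_set) auto

lemma has_partial_mono_term:
  "has_partial i (\<lambda>x. mono_term (x - a) b)
     (if b i = 0 then 0 else mono_term (x - a) (b(i := b i - 1))) x"
proof -
  define R where "R = (\<Prod>j\<in>UNIV - {i}. ((x - a) $ j) ^ b j / fact (b j))"
  have split: "mono_term y c = (y $ i) ^ c i / fact (c i) * (\<Prod>j\<in>UNIV - {i}. (y $ j) ^ c j / fact (c j))"
    for y :: "real^'a" and c
    unfolding mono_term_altdef by (rule prod.remove) auto
  have 1: "mono_term (x + t *\<^sub>R axis i 1 - a) b = ((x - a) $ i + t) ^ b i / fact (b i) * R" for t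
    unfolding split[of _ b] R_def
    by (intro arg_cong2[of _ _ _ _ "(*)"] prod.cong) (auto simp: axis_def algebra_simps)
  have 2: "mono_term (x - a) (b(i := b i - 1)) = ((x - a) $ i) ^ (b i - 1) / fact (b i - 1) * R"
    unfolding split[of _ "b(i := b i - 1)"] R_def by (intro arg_cong2[of _ _ _ _ "(*)"] prod.cong) auto
  have 3: "((\<lambda>t::real. (y + t) ^ n / fact n) has_real_derivative
      (if n = 0 then 0 else y ^ (n - 1) / fact (n - 1))) (at 0)" for y :: real and n
  proof (cases n)
    case (Suc m)
    then show ?thesis
      by (auto intro!: derivative_eq_intros simp: field_simps simp del: of_nat_Suc power_Suc)
  qed auto
  show ?thesis
    unfolding has_partial_def 1
    using DERIV_cmult_right[OF 3[of "(x - a) $ i" "b i"], of R] 2 by (auto split: if_splits)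
qed

lemma has_partial_sum:
  assumes "finite I" "\<And>i. i \<in> I \<Longrightarrow> has_partial k (f i) (d i) x"
  shows "has_partial k (\<lambda>x. \<Sum>i\<in>I. f i x) (\<Sum>i\<in>I. d i) x"
  using assms unfolding has_partial_def by (intro DERIV_sum) auto

lemma has_partial_taylor:
  fixes F :: "'n::finite jet"
  shows "has_partial i (taylor q F a) (taylor (q - 1) (jet_shift (\<lambda>j. if j = i then 1 else 0) F) a x) x"
proof -
  let ?d = "\<lambda>b. (if b i = 0 then 0 else mono_term (x - a) (b(i := b i - 1)))"
  have "has_partial i (\<lambda>x. \<Sum>b | mlen b < q. F b a * mono_term (x - a) b) (\<Sum>b | mlen b < q. F b a * ?d b) x"
    by (intro has_partial_sum has_partial_cmult has_partial_mono_term finite_mlen_less)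
  also have "(\<lambda>x. \<Sum>b | mlen b < q. F b a * mono_term (x - a) b) = taylor q F a"
    by (auto simp: taylor_def fun_eq_iff mult.commute)
  also have "(\<Sum>b | mlen b < q. F b a * ?d b) =
      (\<Sum>b | mlen b < q \<and> b i \<noteq> 0. F b a * mono_term (x - a) (b(i := b i - 1)))"
    by (rule sum.mono_neutral_cong_right) (auto simp: finite_mlen_less)
  also have "\<dots> = (\<Sum>c | mlen c < q - 1. F (c(i := Suc (c i))) a * mono_term (x - a) c)"
  proof (rule sum.reindex_bij_witness[where j = "\<lambda>b. b(i := b i - 1)" and i = "\<lambda>c. c(i := Suc (c i))"])
    fix b :: "'n mindex" assume b: "b \<in> {b. mlen b < q \<and> b i \<noteq> 0}"
    show "b(i := b i - 1) \<in> {c. mlen c < q - 1}"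
      using mlen_fun_upd_Suc[of "b(i := b i - 1)" i] b by auto
  qed (auto simp: mlen_fun_upd_Suc)
  also have "\<dots> = taylor (q - 1) (jet_shift (\<lambda>j. if j = i then 1 else 0) F) a x"
  proof -
    have "c(i := Suc (c i)) = (\<lambda>j. (if j = i then 1 else 0) + c j)" for c
      by auto
    then show ?thesis
      by (simp add: taylor_def jet_shift_def mult.commute)
  qed
  finally show ?thesis .
qed

lemma jet_shift_shift: "jet_shift c (jet_shift d F) = jet_shift (\<lambda>i. c i + d i) F"
  by (simp add: jet_shift_def add_ac)

lemma jet_shift_Nil [simp]: "jet_shift (count_list []) F = F"
  by (simp add: jet_shift_def)

lemma
  fixes S :: "(real^'n::finite) set"
  assumes S: "open S"
  shows smooth_on_taylor: "smooth_on S (taylor q F a)"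
    and partials_taylor: "x \<in> S \<Longrightarrow>
      partials is (taylor q F a) x = taylor (q - length is) (jet_shift (count_list is) F) a x"
proof -
  let ?D = "\<lambda>is x. taylor (q - length is) (jet_shift (count_list is) F) a x"
  have D: "has_partial i (?D is) (?D (i # is) x) x" for i "is" x
  proof -
    have "jet_shift (\<lambda>j. if j = i then 1 else 0) (jet_shift (count_list is) F) = jet_shift (count_list (i # is)) F"
      unfolding jet_shift_shift by (intro arg_cong[of _ _ "\<lambda>c. jet_shift c F"]) auto
    then show ?thesis
      using has_partial_taylor[of i "q - length is" "jet_shift (count_list is) F" a x] by simp
  qed
  have C: "continuous_on S (?D is)" for "is"
    unfolding taylor_def mono_term_altdef by (intro continuous_intros) auto
  show "smooth_on S (taylor q F a)"
    by (rule smooth_on_tower[where D = ?D, OF S _ D C]) simp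
  show "x \<in> S \<Longrightarrow> partials is (taylor q F a) x = ?D is x"
    by (rule partials_tower[where D = ?D, OF S _ D]) simp
qed

text \<open>The binomial theorem in each coordinate, multiplied out.\<close>

lemma mono_term_add:
  "mono_term (x + y) d = (\<Sum>b | \<forall>i. b i \<le> d i. mono_term x b * mono_term y (\<lambda>i. d i - b i))"
proof -
  have "mono_term (x + y) d = (\<Prod>i\<in>UNIV. \<Sum>k\<le>d i. (x $ i) ^ k / fact k * ((y $ i) ^ (d i - k) / fact (d i - k)))"
    unfolding mono_term_altdef
  proof (intro prod.cong refl)
    fix i
    show "((x + y) $ i) ^ d i / fact (d i) = (\<Sum>k\<le>d i. (x $ i) ^ k / fact k * ((y $ i) ^ (d i - k) / fact (d i - k)))"
      using exp_series_add_commuting[of "x $ i" "y $ i" "d i"] by (simp add: mult.commute divide_inverse)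
  qed
  also have "\<dots> = (\<Sum>b\<in>PiE UNIV (\<lambda>i. {..d i}). \<Prod>i\<in>UNIV. (x $ i) ^ b i / fact (b i) * ((y $ i) ^ (d i - b i) / fact (d i - b i)))"
    by (rule prod_sum_PiE) auto
  also have "PiE UNIV (\<lambda>i. {..d i}) = {b. \<forall>i. b i \<le> d i}"
    by (auto simp: PiE_def)
  finally show ?thesis
    unfolding mono_term_altdef prod.distrib .
qed

lemma taylor_recentre:
  fixes F :: "'n::finite jet"
  shows "taylor q F b x =
     (\<Sum>c | mlen c < q. mono_term (x - a) c * (\<Sum>e | mlen e < q - mlen c. mono_term (a - b) e * F (\<lambda>i. c i + e i) b))"
proof -
  have fin: "finite {c :: 'n mindex. \<forall>i. c i \<le> d i}" for d
    using finite_PiE[of UNIV "\<lambda>i. {..d i}"] by (simp add: PiE_def Pi_def)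
  have "taylor q F b x = (\<Sum>d | mlen d < q. \<Sum>c | \<forall>i. c i \<le> d i.
      mono_term (x - a) c * mono_term (a - b) (\<lambda>i. d i - c i) * F d b)"
    unfolding taylor_def using mono_term_add[of "x - a" "a - b"] by (simp add: sum_distrib_right)
  also have "\<dots> = (\<Sum>(d, c)\<in>(SIGMA d:{d. mlen d < q}. {c. \<forall>i. c i \<le> d i}).
      mono_term (x - a) c * mono_term (a - b) (\<lambda>i. d i - c i) * F d b)"
    by (rule sum.Sigma) (use fin finite_mlen_less in auto)
  also have "\<dots> = (\<Sum>(c, e)\<in>(SIGMA c:{c. mlen c < q}. {e. mlen e < q - mlen c}).
      mono_term (x - a) c * (mono_term (a - b) e * F (\<lambda>i. c i + e i) b))"
  proof (rule sum.reindex_bij_witness[where j = "\<lambda>(d, c). (c, \<lambda>i. d i - c i)" and i = "\<lambda>(c, e). (\<lambda>i. c i + e i, c)"])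
    fix p :: "'n mindex \<times> 'n mindex"
    assume "p \<in> (SIGMA d:{d. mlen d < q}. {c. \<forall>i. c i \<le> d i})"
    then obtain d c where p: "p = (d, c)" "mlen d < q" "\<forall>i. c i \<le> d i" by auto
    have "mlen c + mlen (\<lambda>i. d i - c i) = mlen d"
      using p(3) mlen_add[of c "\<lambda>i. d i - c i"] by simp
    then show "(\<lambda>(d, c). (c, \<lambda>i. d i - c i)) p \<in> (SIGMA c:{c. mlen c < q}. {e. mlen e < q - mlen c})"
      using p by auto
  qed (auto simp: mlen_add)
  also have "\<dots> = (\<Sum>c | mlen c < q. \<Sum>e | mlen e < q - mlen c.
      mono_term (x - a) c * (mono_term (a - b) e * F (\<lambda>i. c i + e i) b))"
    by (rule sum.Sigma[symmetric]) (auto simp: finite_mlen_less)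
  finally show ?thesis
    by (simp add: sum_distrib_left)
qed

text \<open>Expanding the polynomial centred at \<open>b\<close> around \<open>a\<close> shows that two Taylor polynomials differ by the remainders
that the definition of ultrajets controls.\<close>

lemma taylor_diff_remainder:
  "taylor q F a x - taylor q F b x = (\<Sum>c | mlen c < q. mono_term (x - a) c * jet_remainder (q - 1) F b c a)"
proof -
  have "{e :: 'a mindex. mlen e < q - mlen c} = {e. mlen e \<le> q - 1 - mlen c}" if "mlen c < q" for c :: "'a mindex"
    using that by auto
  then show ?thesis
    unfolding taylor_recentre[of q F b x a] unfolding taylor_def
    by (simp add: sum_subtractf[symmetric] jet_remainder_def mono_term_def right_diff_distrib)
qed

lemma abs_mono_term_le:
  assumes "norm x \<le> r"
  shows "\<bar>mono_term x b\<bar> \<le> r ^ mlen b / mfact b"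
proof -
  have "\<bar>mpow x b\<bar> \<le> (\<Prod>i\<in>UNIV. r ^ b i)"
    unfolding mpow_def abs_prod power_abs
    by (intro prod_mono power_mono conjI) (use component_le_norm_cart[of x] assms order_trans in auto)
  then show ?thesis
    by (simp add: mono_term_def mfact_def mlen_def power_sum abs_prod divide_right_mono prod_nonneg)
qed

lemma sum_power_div_fact_le_exp:
  fixes y :: real
  assumes "0 \<le> y" "finite K"
  shows "(\<Sum>k\<in>K. y ^ k / fact k) \<le> exp y"
proof -
  have "(\<lambda>k. y ^ k / fact k) sums exp y"
    using exp_converges[of y] by (simp add: divide_inverse mult.commute)
  then have "summable (\<lambda>k. y ^ k / fact k)" "(\<Sum>k. y ^ k / fact k) = exp y"
    by (auto simp: sums_iff)
  then show ?thesis
    using sum_le_suminf[of "\<lambda>k. y ^ k / fact k" K] assms by simp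
qed

lemma power_div_fact_le_exp: "0 \<le> y \<Longrightarrow> y ^ k / fact k \<le> exp (y::real)"
  using sum_power_div_fact_le_exp[of y "{k}"] by simp

text \<open>Enlarging the simplex of multi-indices to a cube makes the sum a product of exponential series.\<close>

lemma sum_power_mfact_le:
  fixes y :: real
  assumes "0 \<le> y"
  shows "(\<Sum>b | mlen b < q. y ^ mlen b / mfact (b :: 'n::finite mindex)) \<le> exp (CARD('n) * y)"
proof -
  have "(\<Sum>b | mlen b < q. y ^ mlen b / mfact (b :: 'n mindex)) =
      (\<Sum>b | mlen b < q. \<Prod>i\<in>(UNIV :: 'n set). y ^ b i / fact (b i))"
    by (simp add: mlen_def mfact_def power_sum prod_dividef)
  also have "\<dots> \<le> (\<Sum>b\<in>PiE UNIV (\<lambda>_. {..<q}). \<Prod>i\<in>(UNIV :: 'n set). y ^ b i / fact (b i))"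
  proof (rule sum_mono2)
    show "{b :: 'n mindex. mlen b < q} \<subseteq> PiE UNIV (\<lambda>_. {..<q})"
      using le_mlen le_less_trans by fastforce
  qed (use assms in \<open>auto intro!: finite_PiE prod_nonneg\<close>)
  also have "\<dots> = (\<Prod>i\<in>(UNIV :: 'n set). \<Sum>k<q. y ^ k / fact k)"
    by (rule prod_sum_PiE[symmetric]) auto
  also have "\<dots> \<le> (\<Prod>i\<in>(UNIV :: 'n set). exp y)"
  proof (intro prod_mono conjI)
    show "(\<Sum>k<q. y ^ k / fact k) \<le> exp y"
      using assms by (rule sum_power_div_fact_le_exp) simp
  qed (use assms in \<open>auto intro!: sum_nonneg\<close>)
  also have "\<dots> = exp (CARD('n) * y)"
    by (simp add: exp_of_nat_mult)
  finally show ?thesis .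
qed

text \<open>What the norm of an ultrajet measures, for an arbitrary sequence \<open>N\<close> instead of the reciprocal weight factors
and with \<open>x = y\<close> allowed.\<close>

definition jet_bounded :: "(real^'n::finite) set \<Rightarrow> (nat \<Rightarrow> real) \<Rightarrow> real \<Rightarrow> 'n jet \<Rightarrow> bool" where
  "jet_bounded K N B F \<longleftrightarrow>
     (\<forall>x\<in>K. \<forall>a. \<bar>F a x\<bar> \<le> B * N (mlen a)) \<and>
     (\<forall>x\<in>K. \<forall>y\<in>K. \<forall>p a. mlen a \<le> p \<longrightarrow>
        \<bar>jet_remainder p F x a y\<bar> \<le> B * N (p + 1) * norm (x - y) ^ (p + 1 - mlen a) / fact (p + 1 - mlen a))"

lemma jet_remainder_shift:
  "mlen c \<le> p \<Longrightarrow> jet_remainder (p - mlen c) (jet_shift c F) x b y = jet_remainder p F x (\<lambda>i. c i + b i) y"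
  by (simp add: jet_remainder_def jet_shift_def mlen_add add_ac)

text \<open>The gain in the construction. Two errors are compared: the change of degree, which consists of terms of
degrees between \<open>q\<close> and \<open>q'\<close>, and the change of centre, which consists of remainders of order \<open>q\<close>. In both cases a
factor \<open>r ^ i / i!\<close> meets a bound \<open>s ^ i\<close> from \<open>N\<close>, so that the sum is an exponential of \<open>s * r\<close>. Only orders in the
window from \<open>q\<close> to \<open>q'\<close> occur; this is what permits to choose the window where \<open>N\<close> is small.\<close>

lemma partials_taylor_diff_le:
  fixes F :: "'n::finite jet"
  assumes F: "jet_bounded K N B F" and ab: "a \<in> K" "b \<in> K" and r: "norm (x - a) \<le> r" "norm (x - b) \<le> r"
    and N: "\<And>p. q \<le> p \<Longrightarrow> p \<le> q' \<Longrightarrow> N p \<le> C * s ^ Suc p" and q: "q \<le> q'"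
    and nonneg: "0 \<le> s" "0 \<le> C" "0 \<le> B"
  shows "\<bar>partials is (\<lambda>x. taylor q' F a x - taylor q F b x) x\<bar>
     \<le> 2 * B * C * s ^ Suc (length is) * exp (real (CARD('n) + 2) * (s * r))"
proof -
  define l where "l = length is"
  define c where "c = count_list is"
  define G where "G = jet_shift c F"
  have c: "mlen c = l"
    by (simp add: c_def l_def mlen_count_list)
  have r0: "0 \<le> r"
    using r(1) norm_ge_zero order_trans by blast
  define E where "E = B * C * s ^ Suc l"
  have sr: "0 \<le> s * r" and BC: "0 \<le> E"
    using nonneg r0 by (auto simp: E_def)
  have "partials is (\<lambda>x. taylor q' F a x - taylor q F b x) x =
      partials is (\<lambda>x. taylor q' F a x + (-1) * taylor q F b x) x"
    by simp
  also have "\<dots> = partials is (taylor q' F a) x + (-1) * partials is (taylor q F b) x"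
    by (simp only: partials_add[OF open_UNIV smooth_on_taylor smooth_on_cmult[OF open_UNIV smooth_on_taylor]]
      partials_cmult[OF open_UNIV smooth_on_taylor] open_UNIV UNIV_I)
  also have "\<dots> = taylor (q' - l) G a x - taylor (q - l) G b x"
    by (simp add: partials_taylor[OF open_UNIV] G_def l_def c_def)
  finally have eq: "partials is (\<lambda>x. taylor q' F a x - taylor q F b x) x =
      (taylor (q' - l) G a x - taylor (q - l) G a x) + (taylor (q - l) G a x - taylor (q - l) G b x)"
    by simp
  have 1: "\<bar>taylor (q' - l) G a x - taylor (q - l) G a x\<bar> \<le> E * exp (CARD('n) * (s * r))"
  proof -
    have eq1: "taylor (q' - l) G a x - taylor (q - l) G a x =
        (\<Sum>e\<in>{e. mlen e < q' - l} - {e. mlen e < q - l}. mono_term (x - a) e * G e a)"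
      unfolding taylor_def by (rule sum_diff[symmetric]) (use finite_mlen_less q in auto)
    have "\<bar>taylor (q' - l) G a x - taylor (q - l) G a x\<bar> \<le> (\<Sum>e\<in>{e :: 'n mindex. mlen e < q' - l} - {e. mlen e < q - l}.
        E * ((s * r) ^ mlen e / mfact e))"
      unfolding eq1
    proof (rule order.trans[OF sum_abs], rule sum_mono)
      fix e :: "'n mindex" assume e: "e \<in> {e. mlen e < q' - l} - {e. mlen e < q - l}"
      have "\<bar>G e a\<bar> \<le> B * N (l + mlen e)"
        using F ab by (simp add: jet_bounded_def G_def jet_shift_def c[symmetric] mlen_add[symmetric])
      also have "\<dots> \<le> B * (C * s ^ Suc (l + mlen e))"
        using e nonneg by (intro mult_left_mono[OF N]) auto
      finally have "\<bar>mono_term (x - a) e * G e a\<bar> \<le> (r ^ mlen e / mfact e) * (B * (C * s ^ Suc (l + mlen e)))"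
        unfolding abs_mult using abs_mono_term_le[OF r(1), of e] r0
        by (intro mult_mono) (auto simp: mfact_def prod_nonneg)
      then show "\<bar>mono_term (x - a) e * G e a\<bar> \<le> E * ((s * r) ^ mlen e / mfact e)"
        by (simp add: E_def power_add power_mult_distrib mult_ac)
    qed
    also have "\<dots> \<le> (\<Sum>e | mlen (e :: 'n mindex) < q' - l. E * ((s * r) ^ mlen e / mfact e))"
      using BC zero_le_power[OF sr] by (intro sum_mono2 mult_nonneg_nonneg divide_nonneg_nonneg)
        (auto simp: finite_mlen_less mfact_def prod_nonneg simp del: zero_le_power_eq)
    also have "\<dots> \<le> E * exp (CARD('n) * (s * r))"
      unfolding sum_distrib_left[symmetric] using BC sr by (intro mult_left_mono sum_power_mfact_le)
    finally show ?thesis .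
  qed
  have 2: "\<bar>taylor (q - l) G a x - taylor (q - l) G b x\<bar> \<le>
      E * exp (2 * (s * r)) * exp (CARD('n) * (s * r))"
  proof (cases "l < q")
    case True
    have "norm (b - a) \<le> norm (x - a) + norm (x - b)"
      using norm_triangle_ineq4[of "x - a" "x - b"] by (simp add: algebra_simps)
    then have ba: "norm (b - a) \<le> 2 * r"
      using r by simp
    have "\<bar>taylor (q - l) G a x - taylor (q - l) G b x\<bar> \<le>
        (\<Sum>e | mlen (e :: 'n mindex) < q - l. E * exp (2 * (s * r)) * ((s * r) ^ mlen e / mfact e))"
      unfolding taylor_diff_remainder
    proof (rule order.trans[OF sum_abs], rule sum_mono)
      fix e :: "'n mindex" assume e: "e \<in> {e. mlen e < q - l}"
      define k where "k = q - l - mlen e"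
      have k: "q - 1 - l = q - l - 1" "q - 1 + 1 = q" "q - (l + mlen e) = k" "q = l + mlen e + k"
        using True e by (auto simp: k_def)
      have "\<bar>jet_remainder (q - l - 1) G b e a\<bar> = \<bar>jet_remainder (q - 1) F b (\<lambda>i. c i + e i) a\<bar>"
        using jet_remainder_shift[of c "q - 1" F b e a] True unfolding c k(1) G_def by simp
      also have "\<dots> \<le> B * N q * norm (b - a) ^ k / fact k"
      proof -
        have "mlen (\<lambda>i. c i + e i) \<le> q - 1" "q - mlen (\<lambda>i. c i + e i) = k"
          using e k(3) by (auto simp: mlen_add c)
        note d = this
        have "\<bar>jet_remainder p F b d a\<bar> \<le> B * N (p + 1) * norm (b - a) ^ (p + 1 - mlen d) / fact (p + 1 - mlen d)"
          if "mlen d \<le> p" for p d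
          using F ab that unfolding jet_bounded_def by blast
        from this[OF d(1)] show ?thesis
          unfolding k(2) d(2) .
      qed
      also have "\<dots> \<le> B * (C * s ^ Suc q) * (2 * r) ^ k / fact k"
      proof -
        have "N q * norm (b - a) ^ k \<le> (C * s ^ Suc q) * (2 * r) ^ k"
          using N[of q] q nonneg ba by (intro mult_mono power_mono) auto
        then show ?thesis
          using nonneg by (simp add: divide_right_mono mult.assoc mult_left_mono)
      qed
      also have "\<dots> = E * s ^ mlen e * ((2 * (s * r)) ^ k / fact k)"
        unfolding k(4) by (simp add: E_def power_add power_mult_distrib mult_ac)
      also have "\<dots> \<le> E * s ^ mlen e * exp (2 * (s * r))"
        using BC nonneg sr by (intro mult_left_mono power_div_fact_le_exp) auto
      finally have "\<bar>mono_term (x - a) e * jet_remainder (q - l - 1) G b e a\<bar> \<le>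
          (r ^ mlen e / mfact e) * (E * s ^ mlen e * exp (2 * (s * r)))"
        unfolding abs_mult using abs_mono_term_le[OF r(1), of e] r0
        by (intro mult_mono) (auto simp: mfact_def prod_nonneg)
      then show "\<bar>mono_term (x - a) e * jet_remainder (q - l - 1) G b e a\<bar> \<le>
          E * exp (2 * (s * r)) * ((s * r) ^ mlen e / mfact e)"
        by (simp add: power_mult_distrib mult_ac)
    qed
    also have "\<dots> \<le> E * exp (2 * (s * r)) * exp (CARD('n) * (s * r))"
      unfolding sum_distrib_left[symmetric] using BC sr by (intro mult_left_mono sum_power_mfact_le) auto
    finally show ?thesis .
  next
    case False
    then show ?thesis
      using BC by (simp add: taylor_def)
  qed
  have "E * exp (CARD('n) * (s * r)) \<le> E * exp (2 * (s * r)) * exp (CARD('n) * (s * r))"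
    using BC sr by (intro mult_right_mono) (auto simp: mult_le_cancel_left1)
  then have "\<bar>partials is (\<lambda>x. taylor q' F a x - taylor q F b x) x\<bar> \<le>
      2 * (E * exp (2 * (s * r)) * exp (CARD('n) * (s * r)))"
    unfolding eq using 1 2 by linarith
  also have "\<dots> = 2 * B * C * s ^ Suc (length is) * exp (real (CARD('n) + 2) * (s * r))"
    by (simp add: E_def l_def mult.assoc exp_add[symmetric] distrib_right)
  finally show ?thesis .
qed

section \<open>Smooth steps from repeated averaging\<close>

text \<open>Convolution with the uniform distribution on \<open>[0, a]\<close>.\<close>

definition box_average :: "real \<Rightarrow> (real \<Rightarrow> real) \<Rightarrow> real \<Rightarrow> real" where
  "box_average a f x = integral {0..1} (\<lambda>u. f (x - a * u))"

lemma continuous_on_affine_comp: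
  "continuous_on UNIV f \<Longrightarrow> continuous_on T (\<lambda>u. f (x - a * u :: real))"
  by (rule continuous_on_compose2[of UNIV f]) (auto intro!: continuous_intros)

lemma integrable_affine_comp:
  fixes f :: "real \<Rightarrow> real"
  assumes "continuous_on UNIV f"
  shows "(\<lambda>u. f (x - a * u)) integrable_on {0..1}"
  by (rule integrable_continuous_real) (rule continuous_on_affine_comp[OF assms])

lemma box_average_mono:
  assumes "continuous_on UNIV f" "continuous_on UNIV g"
    and "\<And>u. u \<in> {0..1} \<Longrightarrow> f (x - a * u) \<le> g (y - b * u)"
  shows "box_average a f x \<le> box_average b g y"
  unfolding box_average_def
  by (rule integral_le) (use assms integrable_affine_comp in auto)

lemma box_average_const: "box_average a (\<lambda>_. c) x = c"
  by (simp add: box_average_def)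

lemma box_average_le_add:
  assumes "continuous_on UNIV f" "continuous_on UNIV g"
    and "\<And>u. u \<in> {0..1} \<Longrightarrow> f (x - a * u) \<le> g (y - b * u) + d"
  shows "box_average a f x \<le> box_average b g y + d"
proof -
  have "integral {0..1} (\<lambda>u. f (x - a * u)) \<le> integral {0..1} (\<lambda>u. g (y - b * u) + d)"
    by (rule integral_le[OF integrable_affine_comp integrable_add[OF integrable_affine_comp integrable_const_ivl]])
      (use assms in auto)
  also have "\<dots> = integral {0..1} (\<lambda>u. g (y - b * u)) + d"
    using integral_add[OF integrable_affine_comp[OF assms(2), of y b] integrable_const_ivl[of d 0 1]] by simp
  finally show ?thesis
    by (simp add: box_average_def)
qed

lemma box_average_dist_le:
  assumes "continuous_on UNIV f" "continuous_on UNIV g"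
    and "\<And>u. u \<in> {0..1} \<Longrightarrow> \<bar>f (x - a * u) - g (y - b * u)\<bar> \<le> d"
  shows "\<bar>box_average a f x - box_average b g y\<bar> \<le> d"
proof -
  have "box_average a f x \<le> box_average b g y + d"
    by (rule box_average_le_add) (use assms in \<open>auto simp: abs_le_iff algebra_simps\<close>)
  moreover have "box_average b g y \<le> box_average a f x + d"
    by (rule box_average_le_add) (use assms in \<open>auto simp: abs_le_iff algebra_simps\<close>)
  ultimately show ?thesis by linarith
qed

lemma has_derivative_box_average:
  assumes f: "continuous_on UNIV f" and a: "a > 0"
  shows "(box_average a f has_real_derivative (f x - f (x - a)) / a) (at x)"
proof -
  have "isCont f y" for y
    using f by (simp add: continuous_on_eq_continuous_at)
  then obtain F where "\<And>y. (F has_vector_derivative f y) (at y)"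
    using einterval_antiderivative[of "-\<infinity>" \<infinity> f] by auto
  then have F: "(F has_real_derivative f y) (at y)" for y
    by (simp add: has_real_derivative_iff_has_vector_derivative)
  have "box_average a f = (\<lambda>y. (F y - F (y - a)) / a)"
  proof
    fix y
    have "((\<lambda>u. f (y - a * u)) has_integral (- F (y - a * 1) / a - - F (y - a * 0) / a)) {0..1}"
    proof (rule fundamental_theorem_of_calculus)
      fix u :: real
      have "((\<lambda>u. F (y - a * u)) has_real_derivative f (y - a * u) * (- a)) (at u)"
        by (rule DERIV_chain2[OF F]) (auto intro!: derivative_eq_intros)
      then have "((\<lambda>u. - F (y - a * u) / a) has_real_derivative - (f (y - a * u) * (- a)) / a) (at u)"
        by (intro DERIV_cdivide DERIV_minus)
      then show "((\<lambda>u. - F (y - a * u) / a) has_vector_derivative f (y - a * u)) (at u within {0..1})"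
        using a by (simp add: has_real_derivative_iff_has_vector_derivative has_vector_derivative_at_within)
    qed simp
    then show "box_average a f y = (F y - F (y - a)) / a"
      by (simp add: box_average_def integral_unique diff_divide_distrib)
  qed
  moreover have "((\<lambda>y. F (y - a)) has_real_derivative f (x - a)) (at x)"
    using DERIV_shift[of F "f (x - a)" x "- a"] F[of "x - a"] by simp
  then have "((\<lambda>y. (F y - F (y - a)) / a) has_real_derivative (f x - f (x - a)) / a) (at x)"
    by (intro DERIV_cdivide DERIV_diff F)
  ultimately show ?thesis
    by simp
qed

text \<open>Averages over the boxes of widths \<open>a l, \<dots>, a (l + d - 1)\<close>. The starting index \<open>l\<close> is kept because differentiation
removes the first box: the derivative of the average is a difference quotient of step \<open>a l\<close> of the averages
starting at \<open>Suc l\<close>.\<close>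

fun iter_average :: "(nat \<Rightarrow> real) \<Rightarrow> (real \<Rightarrow> real) \<Rightarrow> nat \<Rightarrow> nat \<Rightarrow> real \<Rightarrow> real" where
  "iter_average a S l 0 = S"
| "iter_average a S l (Suc d) = box_average (a l) (iter_average a S (Suc l) d)"

fun iter_quotient :: "(nat \<Rightarrow> real) \<Rightarrow> nat \<Rightarrow> (real \<Rightarrow> real) \<Rightarrow> real \<Rightarrow> real" where
  "iter_quotient a 0 f = f"
| "iter_quotient a (Suc l) f = iter_quotient a l (\<lambda>x. (f x - f (x - a l)) / a l)"

lemma iter_quotient_bound:
  assumes "\<And>k. a k > 0" "\<And>x. \<bar>f x\<bar> \<le> B"
  shows "\<bar>iter_quotient a l f x\<bar> \<le> (\<Prod>i<l. 2 / a i) * B"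
  using assms(2)
proof (induction l arbitrary: f B)
  case (Suc l)
  have "\<bar>(f x - f (x - a l)) / a l\<bar> \<le> 2 / a l * B" for x
    using Suc.prems[of x] Suc.prems[of "x - a l"] assms(1)[of l] by (auto simp: field_simps abs_le_iff)
  from Suc.IH[OF this] show ?case
    by (simp add: mult_ac)
qed simp

lemma has_derivative_iter_quotient:
  assumes "\<And>k. a k > 0" "\<And>x. (f has_real_derivative g x) (at x)"
  shows "(iter_quotient a l f has_real_derivative iter_quotient a l g x) (at x)"
  using assms(2)
proof (induction l arbitrary: f g)
  case (Suc l)
  have "((\<lambda>x. (f x - f (x - a l)) / a l) has_real_derivative (g x - g (x - a l)) / a l) (at x)" for x
  proof -
    have "((\<lambda>x. f (x - a l)) has_real_derivative g (x - a l)) (at x)"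
      using DERIV_shift[of f "g (x - a l)" x "- a l"] Suc.prems[of "x - a l"] by simp
    then show ?thesis
      by (intro DERIV_cdivide DERIV_diff Suc.prems)
  qed
  from Suc.IH[OF this] show ?case by simp
qed simp

lemma lipschitz_on_real_iff:
  "L-lipschitz_on UNIV (f :: real \<Rightarrow> real) \<longleftrightarrow> 0 \<le> L \<and> (\<forall>x y. \<bar>f x - f y\<bar> \<le> L * \<bar>x - y\<bar>)"
  by (auto simp: lipschitz_on_def dist_real_def)

lemma
  assumes S: "L-lipschitz_on UNIV S" "\<And>x. 0 \<le> S x" "\<And>x. S x \<le> 1"
    "\<And>x. x \<le> 0 \<Longrightarrow> S x = 0" "\<And>x. w \<le> x \<Longrightarrow> S x = 1" and a: "\<And>k. 0 < a k"
  shows lipschitz_iter_average: "L-lipschitz_on UNIV (iter_average a S l d)"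
    and iter_average_ge_0: "0 \<le> iter_average a S l d x"
    and iter_average_le_1: "iter_average a S l d x \<le> 1"
    and iter_average_eq_0: "x \<le> 0 \<Longrightarrow> iter_average a S l d x = 0"
    and iter_average_eq_1: "w + (\<Sum>i<d. a (l + i)) \<le> x \<Longrightarrow> iter_average a S l d x = 1"
    and iter_average_step: "\<bar>iter_average a S l (Suc d) x - iter_average a S l d x\<bar> \<le> L * a (l + d)"
proof -
  have L: "0 \<le> L"
    using S(1) by (simp add: lipschitz_on_real_iff)
  have lip: "L-lipschitz_on UNIV (iter_average a S l d)" for l d
  proof (induction d arbitrary: l)
    case (Suc d)
    have c: "continuous_on UNIV (iter_average a S (Suc l) d)"
      using Suc.IH by (rule lipschitz_on_continuous_on)
    have "\<bar>iter_average a S (Suc l) d (x - a l * u) - iter_average a S (Suc l) d (y - a l * u)\<bar> \<le> L * \<bar>x - y\<bar>" for x y u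
      using Suc.IH[of "Suc l"] unfolding lipschitz_on_real_iff
      by (elim conjE allE[of _ "x - a l * u"] allE[of _ "y - a l * u"]) simp
    then have "\<bar>box_average (a l) (iter_average a S (Suc l) d) x - box_average (a l) (iter_average a S (Suc l) d) y\<bar> \<le> L * \<bar>x - y\<bar>" for x y
      by (intro box_average_dist_le[OF c c])
    then show ?case
      using L by (simp add: lipschitz_on_real_iff)
  qed (use S in simp)
  then show "L-lipschitz_on UNIV (iter_average a S l d)" .
  have c: "continuous_on UNIV (iter_average a S l d)" for l d
    using lip by (rule lipschitz_on_continuous_on)
  have const: "continuous_on UNIV (\<lambda>_. k)" for k :: real
    by simp
  have "0 \<le> iter_average a S l d x \<and> iter_average a S l d x \<le> 1" for l x
  proof (induction d arbitrary: l x)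
    case (Suc d)
    have "box_average 0 (\<lambda>_. 0) 0 \<le> box_average (a l) (iter_average a S (Suc l) d) x"
      by (rule box_average_mono[OF const c]) (use Suc.IH in auto)
    moreover have "box_average (a l) (iter_average a S (Suc l) d) x \<le> box_average 0 (\<lambda>_. 1) 0"
      by (rule box_average_mono[OF c const]) (use Suc.IH in auto)
    ultimately show ?case
      by (simp add: box_average_const)
  qed (use S in simp)
  then show "0 \<le> iter_average a S l d x" and "iter_average a S l d x \<le> 1"
    by auto
  show "x \<le> 0 \<Longrightarrow> iter_average a S l d x = 0"
  proof (induction d arbitrary: l x)
    case (Suc d)
    have "iter_average a S (Suc l) d (x - a l * u) = 0" if "u \<in> {0..1}" for u
      by (rule Suc.IH) (use that a[of l] Suc.prems in \<open>auto intro: order.trans\<close>)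
    then have "integral {0..1} (\<lambda>u. iter_average a S (Suc l) d (x - a l * u)) = integral {0..1} (\<lambda>u::real. 0::real)"
      by (rule integral_cong)
    then show ?case
      by (simp add: box_average_def)
  qed (use S in simp)
  show "w + (\<Sum>i<d. a (l + i)) \<le> x \<Longrightarrow> iter_average a S l d x = 1"
  proof (induction d arbitrary: l x)
    case (Suc d)
    have "iter_average a S (Suc l) d (x - a l * u) = 1" if "u \<in> {0..1}" for u
    proof (rule Suc.IH)
      have "a l * u \<le> a l * 1"
        using that a[of l] by (intro mult_left_mono) auto
      then show "w + (\<Sum>i<d. a (Suc l + i)) \<le> x - a l * u"
        using Suc.prems by (simp add: sum.lessThan_Suc_shift del: sum.lessThan_Suc)
    qed
    then have "integral {0..1} (\<lambda>u. iter_average a S (Suc l) d (x - a l * u)) = integral {0..1} (\<lambda>u::real. 1::real)"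
      by (rule integral_cong)
    then show ?case
      by (simp add: box_average_def)
  qed (use S in simp)
  show "\<bar>iter_average a S l (Suc d) x - iter_average a S l d x\<bar> \<le> L * a (l + d)"
  proof (induction d arbitrary: l x)
    case 0
    have "\<bar>box_average (a l) S x - box_average 0 (\<lambda>_. S x) 0\<bar> \<le> L * a l"
    proof (rule box_average_dist_le[OF _ const])
      fix u :: real assume u: "u \<in> {0..1}"
      have "\<bar>S (x - a l * u) - S x\<bar> \<le> L * \<bar>(x - a l * u) - x\<bar>"
        using S(1) unfolding lipschitz_on_real_iff by blast
      also have "\<dots> \<le> L * a l"
        using u a[of l] L by (intro mult_left_mono) (auto simp: abs_mult mult_left_le)
      finally show "\<bar>S (x - a l * u) - S x\<bar> \<le> L * a l" .
    qed (use c[of l 0] in simp)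
    then show ?case
      by (simp add: box_average_const)
  next
    case (Suc d)
    have "\<bar>box_average (a l) (iter_average a S (Suc l) (Suc d)) x - box_average (a l) (iter_average a S (Suc l) d) x\<bar> \<le> L * a (Suc l + d)"
      by (rule box_average_dist_le[OF c c]) (rule Suc.IH)
    then show ?case by simp
  qed
qed

text \<open>Averaging over infinitely many boxes of summable widths turns a Lipschitz ramp into a smooth step: the averages
converge uniformly because each changes a Lipschitz function by at most its width, and each of the first \<open>l\<close> boxes
pays for one derivative, at the price of a factor \<open>2 / a i\<close>.\<close>

lemma smooth_step_exists:
  assumes a: "\<And>k. 0 < a k" "summable a" "suminf a \<le> \<epsilon>" and "0 < \<epsilon>"
  obtains D :: "nat \<Rightarrow> real \<Rightarrow> real" where
    "\<And>l x. (D l has_real_derivative D (Suc l) x) (at x)"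
    "\<And>x. x \<le> 0 \<Longrightarrow> D 0 x = 0" "\<And>x. 2 * \<epsilon> \<le> x \<Longrightarrow> D 0 x = 1"
    "\<And>l x. \<bar>D l x\<bar> \<le> (\<Prod>i<l. 2 / a i)"
proof -
  define S where "S = (\<lambda>x. max 0 (min 1 (x / \<epsilon>)))"
  define L where "L = 1 / \<epsilon>"
  have "\<bar>S x - S y\<bar> \<le> L * \<bar>x - y\<bar>" for x y
  proof -
    have "\<bar>S x - S y\<bar> \<le> \<bar>x / \<epsilon> - y / \<epsilon>\<bar>"
      unfolding S_def by linarith
    also have "\<dots> = L * \<bar>x - y\<bar>"
      using \<open>0 < \<epsilon>\<close> by (simp add: L_def diff_divide_distrib[symmetric])
    finally show ?thesis .
  qed
  then have "L-lipschitz_on UNIV S"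
    using \<open>0 < \<epsilon>\<close> by (simp add: lipschitz_on_real_iff L_def)
  moreover have "0 \<le> S x" "S x \<le> 1" for x
    by (simp_all add: S_def)
  moreover have "S x = 0" if "x \<le> 0" for x
    using divide_nonpos_pos[OF that \<open>0 < \<epsilon>\<close>] by (simp add: S_def max_def min_def)
  moreover have "S x = 1" if "\<epsilon> \<le> x" for x
    using that \<open>0 < \<epsilon>\<close> by (simp add: S_def)
  ultimately have S: "L-lipschitz_on UNIV S" "\<And>x. 0 \<le> S x" "\<And>x. S x \<le> 1"
    "\<And>x. x \<le> 0 \<Longrightarrow> S x = 0" "\<And>x. \<epsilon> \<le> x \<Longrightarrow> S x = 1"
    by blast+
  have I: "L-lipschitz_on UNIV (iter_average a S l d)"
    "0 \<le> iter_average a S l d x" "iter_average a S l d x \<le> 1"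
    "x \<le> 0 \<Longrightarrow> iter_average a S l d x = 0"
    "\<epsilon> + (\<Sum>i<d. a (l + i)) \<le> x \<Longrightarrow> iter_average a S l d x = 1"
    "\<bar>iter_average a S l (Suc d) x - iter_average a S l d x\<bar> \<le> L * a (l + d)" for l d x
    using lipschitz_iter_average[OF S] iter_average_ge_0[OF S] iter_average_le_1[OF S]
      iter_average_eq_0[OF S] iter_average_eq_1[OF S] iter_average_step[OF S] a(1)
    by metis+
  define H where "H = iter_average a S"
  \<comment> \<open>\<open>G l\<close> is the average over all boxes from \<open>a l\<close> on; as a telescoping series it has the uniform limit at hand.\<close>
  define G where "G = (\<lambda>l x. S x + (\<Sum>d. H l (Suc d) x - H l d x))"
  have H_eq: "H l d x = S x + (\<Sum>i<d. H l (Suc i) x - H l i x)" for l d x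
    using sum_lessThan_telescope[of "\<lambda>i. H l i x" d] iter_average.simps(1)[of a S l]
    unfolding H_def by simp
  have unif: "uniform_limit UNIV (H l) (G l) sequentially" for l
  proof -
    have "uniform_limit UNIV (\<lambda>d x. \<Sum>i<d. H l (Suc i) x - H l i x) (\<lambda>x. \<Sum>i. H l (Suc i) x - H l i x) sequentially"
    proof (rule Weierstrass_m_test[where M = "\<lambda>d. L * a (l + d)"])
      show "summable (\<lambda>d. L * a (l + d))"
        using a(2) summable_iff_shift[of a l] by (intro summable_mult) (simp add: add.commute)
    qed (use I(6) in \<open>auto simp: H_def\<close>)
    then have "uniform_limit UNIV (\<lambda>d x. S x + (\<Sum>i<d. H l (Suc i) x - H l i x)) (G l) sequentially"
      unfolding G_def by (rule uniform_limit_add[OF uniform_limit_const])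
    then show ?thesis
      unfolding H_eq[of l, symmetric] .
  qed
  have lim: "(\<lambda>d. H l d x) \<longlonglongrightarrow> G l x" for l x
    using tendsto_uniform_limitI[OF unif] by simp
  have contH: "continuous_on UNIV (H l d)" for l d
    unfolding H_def by (rule lipschitz_on_continuous_on[OF I(1)])
  have cont: "continuous_on UNIV (G l)" for l
    by (rule uniform_limit_theorem[OF _ unif]) (auto simp: contH)
  have G_rec: "G l = box_average (a l) (G (Suc l))" for l
  proof
    fix x
    have "(\<lambda>d. H l (Suc d) x) \<longlonglongrightarrow> box_average (a l) (G (Suc l)) x"
    proof (rule metric_LIMSEQ_I)
      fix e :: real assume "0 < e"
      then have "\<forall>\<^sub>F d in sequentially. \<forall>x\<in>UNIV. dist (H (Suc l) d x) (G (Suc l) x) < e / 2"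
        using unif by (intro uniform_limitD) auto
      then obtain N where N: "\<And>d x. N \<le> d \<Longrightarrow> \<bar>H (Suc l) d x - G (Suc l) x\<bar> < e / 2"
        by (auto simp: eventually_sequentially dist_real_def)
      have "dist (H l (Suc d) x) (box_average (a l) (G (Suc l)) x) < e" if "N \<le> d" for d
      proof -
        have "\<bar>box_average (a l) (H (Suc l) d) x - box_average (a l) (G (Suc l)) x\<bar> \<le> e / 2"
          by (rule box_average_dist_le[OF contH cont]) (use N[OF that] less_imp_le in blast)
        then show ?thesis
          using \<open>0 < e\<close> by (simp add: H_def dist_real_def)
      qed
      then show "\<exists>N. \<forall>d\<ge>N. dist (H l (Suc d) x) (box_average (a l) (G (Suc l)) x) < e"
        by blast
    qed
    then show "G l x = box_average (a l) (G (Suc l)) x"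
      using LIMSEQ_Suc[OF lim[of l x]] LIMSEQ_unique by blast
  qed
  define D where "D = (\<lambda>l. iter_quotient a l (G l))"
  show thesis
  proof (rule that[of D])
    show "(D l has_real_derivative D (Suc l) x) (at x)" for l x
      unfolding D_def iter_quotient.simps
    proof (rule has_derivative_iter_quotient[OF a(1)])
      show "(G l has_real_derivative (G (Suc l) x - G (Suc l) (x - a l)) / a l) (at x)" for x
        by (subst G_rec) (rule has_derivative_box_average[OF cont a(1)])
    qed
    show "D 0 x = 0" if "x \<le> 0" for x
    proof -
      have "(\<lambda>d. H 0 d x) = (\<lambda>d. 0)"
        using I(4)[OF that] by (auto simp: H_def)
      then show ?thesis
        using lim[of 0 x] by (simp add: D_def LIMSEQ_const_iff)
    qed
    show "D 0 x = 1" if "2 * \<epsilon> \<le> x" for x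
    proof -
      have "H 0 d x = 1" for d
        unfolding H_def
      proof (rule I(5))
        have "(\<Sum>i<d. a (0 + i)) \<le> suminf a"
          using sum_le_suminf[OF a(2), of "{..<d}"] a(1) by (simp add: less_imp_le)
        then show "\<epsilon> + (\<Sum>i<d. a (0 + i)) \<le> x"
          using a(3) that by linarith
      qed
      then show ?thesis
        using lim[of 0 x] by (simp add: D_def LIMSEQ_const_iff)
    qed
    show "\<bar>D l x\<bar> \<le> (\<Prod>i<l. 2 / a i)" for l x
    proof -
      have "\<bar>G l x\<bar> \<le> 1" for x
        using LIMSEQ_le_const[OF lim[of l x], of 0] LIMSEQ_le_const2[OF lim[of l x], of 1] I(2,3)
        by (auto simp: H_def abs_le_iff)
      then show ?thesis
        using iter_quotient_bound[of a "G l" 1 l x] a(1) by (simp add: D_def)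
    qed
  qed
qed

section \<open>Weights and domination\<close>

text \<open>\<open>f = o(g)\<close> for nonnegative functions that are bounded on bounded sets, in a form without limits. Arguments start at \<open>1\<close>, where
the logarithm and all weights are nonnegative.\<close>

definition dominates :: "(real \<Rightarrow> real) \<Rightarrow> (real \<Rightarrow> real) \<Rightarrow> bool" where
  "dominates g f \<longleftrightarrow> (\<forall>N. \<exists>C. \<forall>t\<ge>1. N * f t \<le> g t + C)"

lemma dominatesD:
  assumes "dominates g f"
  obtains C where "0 \<le> C" "\<And>t. 1 \<le> t \<Longrightarrow> N * f t \<le> g t + C"
proof -
  obtain C where C: "\<And>t. 1 \<le> t \<Longrightarrow> N * f t \<le> g t + C"
    using assms by (auto simp: dominates_def)
  show thesis
    by (rule that[of "max 0 C"]) (use C in \<open>force+\<close>)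
qed

lemma dominates_trans:
  assumes "dominates h g" "dominates g f"
  shows "dominates h f"
  unfolding dominates_def
proof
  fix N
  obtain C where C: "\<And>t. 1 \<le> t \<Longrightarrow> N * f t \<le> g t + C"
    using dominatesD[OF assms(2)] by metis
  obtain C' where C': "\<And>t. 1 \<le> t \<Longrightarrow> 1 * g t \<le> h t + C'"
    using dominatesD[OF assms(1)] by metis
  have "N * f t \<le> h t + (C + C')" if "1 \<le> t" for t
    using C[OF that] C'[OF that] by simp
  then show "\<exists>C. \<forall>t\<ge>1. N * f t \<le> h t + C" by blast
qed

lemma smallo_imp_dominates:
  assumes "f \<in> o[at_top](g)" "mono_on {1..} f" "\<And>t. 1 \<le> t \<Longrightarrow> 0 \<le> f t" "\<And>t. 1 \<le> t \<Longrightarrow> 0 \<le> g t"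
  shows "dominates g f"
  unfolding dominates_def
proof
  fix N :: real
  define n where "n = max N 1"
  have "\<forall>\<^sub>F t in at_top. \<bar>f t\<bar> \<le> (1 / n) * \<bar>g t\<bar>"
    using landau_o.smallD[OF assms(1), of "1 / n"] by (simp add: n_def)
  then obtain T where T: "\<And>t. T \<le> t \<Longrightarrow> \<bar>f t\<bar> \<le> (1 / n) * \<bar>g t\<bar>"
    by (auto simp: eventually_at_top_linorder)
  define X where "X = max T 1"
  have "N * f t \<le> g t + n * f X" if t: "1 \<le> t" for t
  proof -
    have n: "n \<ge> 1" "N \<le> n"
      by (auto simp: n_def)
    have f: "0 \<le> f t" "0 \<le> g t" "0 \<le> f X"
      using assms(3,4) t by (auto simp: X_def)
    have "N * f t \<le> n * f t"
      using n f by (intro mult_right_mono)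
    also have "\<dots> \<le> g t + n * f X"
    proof (cases "T \<le> t")
      case True
      then have "f t \<le> (1 / n) * g t"
        using T[OF True] f by simp
      then have "n * f t \<le> g t"
        using n by (simp add: field_simps)
      then show ?thesis
        using n f by (simp add: add_increasing2)
    next
      case False
      then have "f t \<le> f X"
        using t by (intro mono_onD[OF assms(2)]) (auto simp: X_def)
      then have "n * f t \<le> n * f X"
        using n by (intro mult_left_mono) auto
      then show ?thesis
        using f by simp
    qed
    finally show ?thesis .
  qed
  then show "\<exists>C. \<forall>t\<ge>1. N * f t \<le> g t + C" by blast
qed

lemma
  assumes "weight_function w"
  shows weight_mono: "0 \<le> s \<Longrightarrow> s \<le> t \<Longrightarrow> w s \<le> w t"
    and weight_nonneg: "0 \<le> t \<Longrightarrow> 0 \<le> w t"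
    and weight_dominates_ln: "dominates w ln"
    and weight_convex: "convex_on UNIV (\<lambda>t. w (exp t))"
proof -
  show "0 \<le> s \<Longrightarrow> s \<le> t \<Longrightarrow> w s \<le> w t"
    using assms by (auto simp: weight_function_def intro: mono_onD)
  show nonneg: "0 \<le> t \<Longrightarrow> 0 \<le> w t" for t
    using assms by (auto simp: weight_function_def)
  show "dominates w ln"
    by (rule smallo_imp_dominates)
       (use assms nonneg in \<open>auto simp: weight_function_def mono_on_def\<close>)
  show "convex_on UNIV (\<lambda>t. w (exp t))"
    using assms by (simp add: weight_function_def)
qed

text \<open>Doubling, iterated and made to hold for all arguments: geometric factors in front of derivatives can be absorbed
into the weight.\<close>

lemma weight_doubling:
  assumes w: "weight_function w"
  obtains C where "1 \<le> C" "\<And>t. 0 \<le> t \<Longrightarrow> w (2 ^ k * t) \<le> C * w t + C"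
proof -
  have "(\<lambda>t. w (2 * t)) \<in> O[at_top](w)"
    using w by (simp add: weight_function_def)
  then obtain c where c: "\<forall>\<^sub>F t in at_top. \<bar>w (2 * t)\<bar> \<le> c * \<bar>w t\<bar>"
    by (auto elim: landau_o.bigE)
  then obtain T where T: "\<And>t. T \<le> t \<Longrightarrow> \<bar>w (2 * t)\<bar> \<le> c * \<bar>w t\<bar>"
    by (auto simp: eventually_at_top_linorder)
  define X where "X = max T 0"
  define C where "C = max 1 (max c (w (2 * X)))"
  have C: "1 \<le> C" "c \<le> C" "w (2 * X) \<le> C"
    by (auto simp: C_def)
  have dbl: "w (2 * t) \<le> C * w t + C" if t: "0 \<le> t" for t
  proof (cases "T \<le> t")
    case True
    then have "w (2 * t) \<le> c * w t"
      using T[OF True] weight_nonneg[OF w, of t] weight_nonneg[OF w, of "2 * t"] t by simp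
    also have "\<dots> \<le> C * w t"
      using C weight_nonneg[OF w t] by (intro mult_right_mono)
    finally show ?thesis
      using C by simp
  next
    case False
    then have "w (2 * t) \<le> w (2 * X)"
      using t by (intro weight_mono[OF w]) (auto simp: X_def)
    also have "\<dots> \<le> C * w t + C"
      using C weight_nonneg[OF w t] by (intro add_increasing) auto
    finally show ?thesis .
  qed
  have "\<exists>C\<ge>1. \<forall>t\<ge>0. w (2 ^ k * t) \<le> C * w t + C"
  proof (induction k)
    case 0
    then show ?case by (intro exI[of _ 1]) auto
  next
    case (Suc k)
    then obtain D where D: "1 \<le> D" "\<And>t. 0 \<le> t \<Longrightarrow> w (2 ^ k * t) \<le> D * w t + D" by blast
    have "w (2 ^ Suc k * t) \<le> (2 * C * D) * w t + 2 * C * D" if t: "0 \<le> t" for t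
    proof -
      have "w (2 ^ Suc k * t) \<le> C * w (2 ^ k * t) + C"
        using dbl[of "2 ^ k * t"] t by (simp add: mult.assoc)
      also have "C * w (2 ^ k * t) \<le> C * (D * w t + D)"
        using D(2)[OF t] C by (intro mult_left_mono) auto
      also have "C * (D * w t + D) + C \<le> (2 * C * D) * w t + 2 * C * D"
      proof -
        have "C * 1 \<le> C * D"
          using C D by (intro mult_left_mono) auto
        moreover have "0 \<le> C * D * w t"
          using C D weight_nonneg[OF w t] by simp
        ultimately show ?thesis
          by (simp add: algebra_simps)
      qed
      finally show ?thesis by simp
    qed
    moreover have "1 \<le> 2 * C * D"
      using C D mult_mono[of 1 C 1 D] by simp
    ultimately show ?case by blast
  qed
  then show thesis
    using that by blast
qed

lemma young_upper:
  assumes "dominates w ln" "0 \<le> s"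
  shows "s * t - w (exp s) \<le> young_conj w t"
  unfolding young_conj_def
proof (rule cSUP_upper)
  obtain C where C: "\<And>u. 1 \<le> u \<Longrightarrow> t * ln u \<le> w u + C"
    using dominatesD[OF assms(1), of t] by metis
  show "bdd_above ((\<lambda>s. s * t - w (exp s)) ` {0..})"
  proof (rule bdd_aboveI2)
    fix s :: real assume "s \<in> {0..}"
    then show "s * t - w (exp s) \<le> C"
      using C[of "exp s"] by (simp add: mult.commute)
  qed
qed (use assms in auto)

lemma young_least:
  assumes "\<And>s. 0 \<le> s \<Longrightarrow> s * t - w (exp s) \<le> b"
  shows "young_conj w t \<le> b"
  unfolding young_conj_def by (rule cSUP_least) (use assms in auto)

text \<open>The supremum of the functions \<open>k * \<sigma> - C k\<close>, with constants \<open>C k\<close> so large that each of them stays below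
\<open>\<tau> / k\<close>. Being a supremum of log-convex functions it is log-convex, which later makes its slopes usable as degrees.\<close>

lemma intermediate_weight:
  assumes \<sigma>: "weight_function \<sigma>" and \<tau>: "weight_function \<tau>" and d: "dominates \<tau> \<sigma>"
  obtains s where "dominates s \<sigma>" "dominates \<tau> s" "convex_on UNIV (\<lambda>t. s (exp t))"
    "\<And>t u. 1 \<le> t \<Longrightarrow> t \<le> u \<Longrightarrow> s t \<le> s u"
proof -
  have "\<exists>C\<ge>0. \<forall>t\<ge>1. (real k)\<^sup>2 * \<sigma> t \<le> \<tau> t + C" for k
    using dominatesD[OF d, of "(real k)\<^sup>2"] by metis
  then obtain c where c: "\<And>k. 0 \<le> c k" "\<And>k t. 1 \<le> t \<Longrightarrow> (real k)\<^sup>2 * \<sigma> t \<le> \<tau> t + c k"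
    by metis
  \<comment> \<open>The truncation of \<open>t\<close> makes the definition meaningful for all real arguments.\<close>
  define s where "s = (\<lambda>t. SUP k. real k * \<sigma> (max t 1) - real k * c k)"
  have *: "real j * (real k * \<sigma> t - real k * c k) \<le> \<tau> t + c j" if t: "1 \<le> t" and j: "1 \<le> j" for j k t
  proof (cases "j \<le> k")
    case True
    have \<sigma>t: "0 \<le> \<sigma> t" and \<tau>t: "0 \<le> \<tau> t"
      using weight_nonneg[OF \<sigma>] weight_nonneg[OF \<tau>] t by auto
    have "real j * real k * \<sigma> t \<le> real k * real k * \<sigma> t"
      using True \<sigma>t by (intro mult_right_mono) auto
    also have "\<dots> \<le> \<tau> t + c k"
      using c(2)[OF t, of k] by (simp add: power2_eq_square)
    also have "c k \<le> real j * real k * c k"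
    proof -
      have "1 * 1 \<le> real j * real k"
        using j True by (intro mult_mono) auto
      then show ?thesis
        using c(1)[of k] mult_right_mono[of 1 "real j * real k" "c k"] by simp
    qed
    finally show ?thesis
      using c(1)[of j] by (simp add: algebra_simps)
  next
    case False
    have \<sigma>t: "0 \<le> \<sigma> t"
      using weight_nonneg[OF \<sigma>] t by auto
    have "real j * (real k * \<sigma> t - real k * c k) \<le> real j * (real k * \<sigma> t)"
      using c(1)[of k] by (intro mult_left_mono) auto
    also have "\<dots> \<le> real j * (real j * \<sigma> t)"
      using False \<sigma>t by (intro mult_left_mono mult_right_mono) auto
    also have "\<dots> \<le> \<tau> t + c j"
      using c(2)[OF t, of j] by (simp add: power2_eq_square)
    finally show ?thesis .
  qed
  have bdd: "bdd_above (range (\<lambda>k. real k * \<sigma> (max t 1) - real k * c k))" for t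
    using *[of "max t 1" 1] by (intro bdd_aboveI2[where M = "\<tau> (max t 1) + c 1"]) auto
  have upper: "real k * \<sigma> (max t 1) - real k * c k \<le> s t" for k t
    unfolding s_def by (rule cSUP_upper[OF _ bdd]) simp
  have least: "s t \<le> b" if "\<And>k. real k * \<sigma> (max t 1) - real k * c k \<le> b" for t b
    unfolding s_def by (rule cSUP_least) (use that in auto)
  show thesis
  proof (rule that[of s])
    show "dominates s \<sigma>"
      unfolding dominates_def
    proof
      fix N :: real
      obtain k where k: "N \<le> real k"
        using real_arch_simple by blast
      have "N * \<sigma> t \<le> s t + real k * c k" if t: "1 \<le> t" for t
      proof -
        have "N * \<sigma> t \<le> real k * \<sigma> t"
          using k weight_nonneg[OF \<sigma>, of t] t by (intro mult_right_mono) auto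
        then show ?thesis
          using upper[of k t] t by (simp add: max_def)
      qed
      then show "\<exists>C. \<forall>t\<ge>1. N * \<sigma> t \<le> s t + C" by blast
    qed
    have nonneg: "0 \<le> s t" for t
      using upper[of 0 t] by simp
    show "dominates \<tau> s"
      unfolding dominates_def
    proof
      fix N :: real
      obtain j :: nat where "max N 1 \<le> real j"
        using real_arch_simple by blast
      then have j: "N \<le> real j" "1 \<le> j"
        by auto
      have "N * s t \<le> \<tau> t + c j" if t: "1 \<le> t" for t
      proof -
        have "N * s t \<le> real j * s t"
          using j nonneg by (intro mult_right_mono) auto
        moreover have "s t \<le> (\<tau> t + c j) / real j"
          using *[OF t j(2)] j t by (intro least) (simp add: field_simps max_def)
        ultimately show ?thesis
          using j by (simp add: field_simps)
      qed
      then show "\<exists>C. \<forall>t\<ge>1. N * s t \<le> \<tau> t + C" by blast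
    qed
    show "s t \<le> s u" if "1 \<le> t" "t \<le> u" for t u
    proof (rule least)
      fix k
      have "real k * \<sigma> (max t 1) - real k * c k \<le> real k * \<sigma> (max u 1) - real k * c k"
        using that by (intro diff_right_mono mult_left_mono weight_mono[OF \<sigma>]) auto
      then show "real k * \<sigma> (max t 1) - real k * c k \<le> s u"
        using upper[of k u] by linarith
    qed
    show "convex_on UNIV (\<lambda>t. s (exp t))"
    proof (rule convex_onI)
      fix a x y :: real
      assume a: "0 < a" "a < 1"
      let ?z = "(1 - a) *\<^sub>R x + a *\<^sub>R y"
      have conv: "\<sigma> (max (exp ?z) 1) \<le> (1 - a) * \<sigma> (max (exp x) 1) + a * \<sigma> (max (exp y) 1)"
      proof -
        have m: "max (exp v) 1 = exp (max v 0)" for v :: real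
          by (simp add: max_def)
        have "max ?z 0 \<le> (1 - a) *\<^sub>R max x 0 + a *\<^sub>R max y 0"
          using a by (intro max.boundedI add_mono) (auto intro!: mult_left_mono add_nonneg_nonneg mult_nonneg_nonneg)
        then have "\<sigma> (exp (max ?z 0)) \<le> \<sigma> (exp ((1 - a) *\<^sub>R max x 0 + a *\<^sub>R max y 0))"
          by (intro weight_mono[OF \<sigma>]) auto
        also have "\<dots> \<le> (1 - a) * \<sigma> (exp (max x 0)) + a * \<sigma> (exp (max y 0))"
          using convex_onD[OF weight_convex[OF \<sigma>], of a "max x 0" "max y 0"] a by simp
        finally show ?thesis
          by (simp add: m)
      qed
      show "s (exp ?z) \<le> (1 - a) * s (exp x) + a * s (exp y)"
      proof (rule least)
        fix k
        have "real k * \<sigma> (max (exp ?z) 1) \<le> real k * ((1 - a) * \<sigma> (max (exp x) 1) + a * \<sigma> (max (exp y) 1))"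
          using conv by (intro mult_left_mono) auto
        then have "real k * \<sigma> (max (exp ?z) 1) - real k * c k \<le>
          (1 - a) * (real k * \<sigma> (max (exp x) 1) - real k * c k) + a * (real k * \<sigma> (max (exp y) 1) - real k * c k)"
          by (simp add: algebra_simps)
        also have "\<dots> \<le> (1 - a) * s (exp x) + a * s (exp y)"
          using a upper by (intro add_mono mult_left_mono) auto
        finally show "real k * \<sigma> (max (exp ?z) 1) - real k * c k \<le> (1 - a) * s (exp x) + a * s (exp y)" .
      qed
    qed simp
  qed
qed

section \<open>Boosting a weight in a strong pair\<close>

text \<open>Half of the width in which a cut-off adapted to \<open>w\<close> can be placed if it may cost \<open>exp (w t)\<close>.\<close>

definition tail_integral :: "(real \<Rightarrow> real) \<Rightarrow> real \<Rightarrow> ennreal" where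
  "tail_integral w t = (\<integral>\<^sup>+ v\<in>{t..}. ennreal (w v / v\<^sup>2) \<partial>lborel)"

lemma tail_integral_rescale:
  assumes [measurable]: "w \<in> borel_measurable borel" and t: "0 < t"
  shows "tail_integral w (t * s) = ennreal (1 / t) * (\<integral>\<^sup>+ u\<in>{s..}. ennreal (w (t * u) / u\<^sup>2) \<partial>lborel)"
proof -
  have "tail_integral w (t * s) = ennreal \<bar>t\<bar> * (\<integral>\<^sup>+ u. ennreal (w (0 + t * u) / (0 + t * u)\<^sup>2) * indicator {t * s..} (0 + t * u) \<partial>lborel)"
    unfolding tail_integral_def by (rule nn_integral_real_affine) (use t in auto)
  also have "\<dots> = (\<integral>\<^sup>+ u. ennreal \<bar>t\<bar> * (ennreal (w (0 + t * u) / (0 + t * u)\<^sup>2) * indicator {t * s..} (0 + t * u)) \<partial>lborel)"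
    by (rule nn_integral_cmult[symmetric]) measurable
  also have "\<dots> = (\<integral>\<^sup>+ u. ennreal (1 / t) * (ennreal (w (t * u) / u\<^sup>2) * indicator {s..} u) \<partial>lborel)"
  proof (rule nn_integral_cong)
    fix u
    have "indicator {t * s..} (0 + t * u) = (indicator {s..} u :: ennreal)"
      using t by (auto simp: indicator_def)
    moreover have "ennreal \<bar>t\<bar> * ennreal (w (0 + t * u) / (0 + t * u)\<^sup>2) = ennreal (1 / t) * ennreal (w (t * u) / u\<^sup>2)"
      using t by (subst (1 2) ennreal_mult'[symmetric]) (auto simp: power2_eq_square mult_ac)
    ultimately show "ennreal \<bar>t\<bar> * (ennreal (w (0 + t * u) / (0 + t * u)\<^sup>2) * indicator {t * s..} (0 + t * u)) =
      ennreal (1 / t) * (ennreal (w (t * u) / u\<^sup>2) * indicator {s..} u)"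
      by (simp add: mult.assoc[symmetric])
  qed
  also have "\<dots> = ennreal (1 / t) * (\<integral>\<^sup>+ u. ennreal (w (t * u) / u\<^sup>2) * indicator {s..} u \<partial>lborel)"
    by (rule nn_integral_cmult) measurable
  finally show ?thesis .
qed

lemma nn_integral_inverse_square:
  assumes "0 < t"
  shows "(\<integral>\<^sup>+ v\<in>{t..}. ennreal (1 / v\<^sup>2) \<partial>lborel) = ennreal (1 / t)"
proof -
  have "(\<integral>\<^sup>+ v. ennreal (1 / v\<^sup>2) * indicator {t..} v \<partial>lborel) = ennreal (0 - - inverse t)"
  proof (rule nn_integral_FTC_atLeast)
    show "((\<lambda>v. - inverse v) has_real_derivative 1 / v\<^sup>2) (at v)" if "t \<le> v" for v
      using that assms by (auto intro!: derivative_eq_intros simp: power2_eq_square field_simps)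
    show "((\<lambda>v::real. - inverse v) \<longlongrightarrow> 0) at_top"
      using tendsto_minus[OF tendsto_inverse_0_at_top[OF filterlim_ident]] by simp
  qed auto
  then show ?thesis
    by (simp add: divide_inverse)
qed

lemma tail_integral_antimono: "s \<le> t \<Longrightarrow> tail_integral w t \<le> tail_integral w s"
  unfolding tail_integral_def by (intro nn_integral_mono) (auto simp: indicator_def)

lemma
  assumes mono: "mono w" and nonneg: "\<And>t. 0 \<le> w t" and t: "0 < t"
  shows tail_integral_ge: "ennreal (w t / t) \<le> tail_integral w t"
    and tail_integral_double: "tail_integral w t \<le> 2 * tail_integral w (2 * t)"
proof -
  have [measurable]: "w \<in> borel_measurable borel"
    using mono by (rule borel_measurable_mono)
  have "ennreal (w t) * ennreal (1 / t) = (\<integral>\<^sup>+ v. ennreal (w t) * (ennreal (1 / v\<^sup>2) * indicator {t..} v) \<partial>lborel)"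
    unfolding nn_integral_inverse_square[OF t, symmetric] by (rule nn_integral_cmult[symmetric]) measurable
  also have "\<dots> \<le> tail_integral w t"
    unfolding tail_integral_def
  proof (intro nn_integral_mono)
    fix v
    show "ennreal (w t) * (ennreal (1 / v\<^sup>2) * indicator {t..} v) \<le> ennreal (w v / v\<^sup>2) * indicator {t..} v"
      using monoD[OF mono, of t v] nonneg
      by (auto simp: indicator_def ennreal_mult[symmetric] intro!: ennreal_leI divide_right_mono)
  qed
  finally show "ennreal (w t / t) \<le> tail_integral w t"
    using nonneg t by (simp add: ennreal_mult[symmetric])
  have "tail_integral w t \<le> (\<integral>\<^sup>+ u\<in>{t..}. ennreal (w (2 * u) / u\<^sup>2) \<partial>lborel)"
    unfolding tail_integral_def
  proof (intro nn_integral_mono)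
    fix v
    show "ennreal (w v / v\<^sup>2) * indicator {t..} v \<le> ennreal (w (2 * v) / v\<^sup>2) * indicator {t..} v"
      using monoD[OF mono, of v "2 * v"] t
      by (auto simp: indicator_def intro!: ennreal_leI divide_right_mono)
  qed
  also have "\<dots> = 2 * (ennreal (1 / 2) * (\<integral>\<^sup>+ u\<in>{t..}. ennreal (w (2 * u) / u\<^sup>2) \<partial>lborel))"
  proof -
    have "(2::ennreal) * ennreal (1 / 2) = 1"
      by (metis ennreal_1 ennreal_mult' ennreal_numeral nonzero_eq_divide_eq zero_le_numeral zero_neq_numeral mult.commute times_divide_eq_right)
    then show ?thesis
      by (simp add: mult.assoc[symmetric])
  qed
  also have "ennreal (1 / 2) * (\<integral>\<^sup>+ u\<in>{t..}. ennreal (w (2 * u) / u\<^sup>2) \<partial>lborel) = tail_integral w (2 * t)"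
    by (rule tail_integral_rescale[symmetric]) auto
  finally show "tail_integral w t \<le> 2 * tail_integral w (2 * t)" .
qed

text \<open>The largest increasing function below \<open>g\<close> that grows at most like a power of exponent \<open>\<theta>\<close>. It still tends to infinity:
the infimum over large \<open>s\<close> is large since \<open>g\<close> is, and for bounded \<open>s\<close> the power takes over.\<close>

lemma slow_minorant:
  fixes g :: "real \<Rightarrow> real"
  assumes g: "\<And>t. 1 \<le> t \<Longrightarrow> 1 \<le> g t" "filterlim g at_top at_top" and \<theta>: "0 < \<theta>"
  obtains h where "mono h" "\<And>t. 1 \<le> h t" "\<And>t. 1 \<le> t \<Longrightarrow> h t \<le> g t" "filterlim h at_top at_top"
    "\<And>t u. 0 \<le> t \<Longrightarrow> 1 \<le> u \<Longrightarrow> h (t * u) \<le> u powr \<theta> * h t"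
proof -
  define f where "f = (\<lambda>s t. g s * max 1 (t / s) powr \<theta>)"
  define h where "h = (\<lambda>t. INF s\<in>{1..}. f s t)"
  have f1: "1 \<le> f s t" if "1 \<le> s" for s t
  proof -
    have "1 \<le> max 1 (t / s) powr \<theta>"
      using \<theta> by (intro ge_one_powr_ge_zero) auto
    then show ?thesis
      unfolding f_def using g(1)[OF that] mult_mono[of 1 "g s" 1 "max 1 (t / s) powr \<theta>"] by simp
  qed
  have bdd: "bdd_below ((\<lambda>s. f s t) ` {1..})" for t
    using f1 by (intro bdd_belowI2[of _ 1]) auto
  have lower: "h t \<le> f s t" if "1 \<le> s" for s t
    unfolding h_def by (rule cINF_lower[OF bdd]) (use that in simp)
  have greatest: "b \<le> h t" if "\<And>s. 1 \<le> s \<Longrightarrow> b \<le> f s t" for b t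
    unfolding h_def by (rule cINF_greatest) (use that in auto)
  show thesis
  proof (rule that[of h])
    show "mono h"
    proof (rule monoI, rule greatest)
      fix t u s :: real assume tu: "t \<le> u" and s: "1 \<le> s"
      have "max 1 (t / s) powr \<theta> \<le> max 1 (u / s) powr \<theta>"
        using tu s \<theta> by (intro powr_mono2) (auto simp: divide_right_mono max.coboundedI2)
      then have "f s t \<le> f s u"
        unfolding f_def using g(1)[OF s] by (intro mult_left_mono) auto
      then show "h t \<le> f s u"
        using lower[OF s, of t] by linarith
    qed
    show "1 \<le> h t" for t
      by (rule greatest) (rule f1)
    show "h t \<le> g t" if "1 \<le> t" for t
      using lower[OF that, of t] that by (simp add: f_def)
    show "h (t * u) \<le> u powr \<theta> * h t" if t: "0 \<le> t" and u: "1 \<le> u" for t u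
    proof -
      have "h (t * u) / u powr \<theta> \<le> h t"
      proof (rule greatest)
        fix s :: real assume s: "1 \<le> s"
        have "max 1 (t * u / s) powr \<theta> \<le> (u * max 1 (t / s)) powr \<theta>"
        proof (intro powr_mono2 max.boundedI)
          show "1 \<le> u * max 1 (t / s)"
            using u mult_mono[of 1 u 1 "max 1 (t / s)"] by simp
          have "u * (t / s) \<le> u * max 1 (t / s)"
            using u by (intro mult_left_mono) auto
          then show "t * u / s \<le> u * max 1 (t / s)"
            by (simp add: mult.commute)
        qed (use \<theta> in auto)
        also have "\<dots> = u powr \<theta> * max 1 (t / s) powr \<theta>"
          using u by (intro powr_mult)
        finally have "f s (t * u) \<le> u powr \<theta> * f s t"
          unfolding f_def using g(1)[OF s] by (simp add: mult.left_commute mult_left_mono)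
        then show "h (t * u) / u powr \<theta> \<le> f s t"
          using lower[OF s, of "t * u"] u by (simp add: field_simps)
      qed
      then show ?thesis
        using u by (simp add: field_simps)
    qed
    show "filterlim h at_top at_top"
      unfolding filterlim_at_top
    proof
      fix Z :: real
      obtain S where S: "\<And>s. S \<le> s \<Longrightarrow> Z \<le> g s"
        using g(2) by (auto simp: filterlim_at_top eventually_at_top_linorder)
      define X where "X = max S 1"
      define Y where "Y = max Z 1"
      have "Z \<le> h t" if t: "X * Y powr (1 / \<theta>) \<le> t" for t
      proof (rule greatest)
        fix s :: real assume s: "1 \<le> s"
        have m: "1 \<le> max 1 (t / s) powr \<theta>"
          using \<theta> by (intro ge_one_powr_ge_zero) auto
        show "Z \<le> f s t"
        proof (cases "S \<le> s")
          case True
          have "g s * 1 \<le> f s t"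
            unfolding f_def using m g(1)[OF s] by (intro mult_left_mono) auto
          then show ?thesis
            using S[OF True] by simp
        next
          case False
          then have sX: "s \<le> X"
            by (simp add: X_def)
          have "Y powr (1 / \<theta>) * s \<le> Y powr (1 / \<theta>) * X"
            using sX by (intro mult_left_mono) auto
          then have "Y powr (1 / \<theta>) \<le> t / s"
            using t s by (simp add: pos_le_divide_eq mult.commute)
          then have "(Y powr (1 / \<theta>)) powr \<theta> \<le> max 1 (t / s) powr \<theta>"
            using \<theta> by (intro powr_mono2) auto
          then have "Y \<le> max 1 (t / s) powr \<theta>"
            using \<theta> by (simp add: powr_powr Y_def)
          moreover have "1 * max 1 (t / s) powr \<theta> \<le> f s t"
            unfolding f_def using g(1)[OF s] by (intro mult_right_mono) auto
          ultimately show ?thesis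
            by (simp add: Y_def)
        qed
      qed
      then show "\<forall>\<^sub>F t in at_top. Z \<le> h t"
        by (auto simp: eventually_at_top_linorder)
    qed
  qed
qed

text \<open>The weight \<open>\<omega>\<close> is multiplied by a slowly growing factor \<open>h\<close> that is, up to constants, at most the square root
of the quotient of \<open>s\<close> and \<open>\<sigma>\<close>. Since \<open>h (t * u) \<le> u powr (1 - r) * h t\<close>, the factor can be pulled out of the tail integral at the price of
replacing the exponent \<open>2\<close> by \<open>1 + r\<close>; the strong pair then bounds \<open>t\<close> times the tail integral by a multiple
of \<open>h t * \<sigma> t\<close>, which is at most of the order of the geometric mean of \<open>s\<close> and \<open>\<sigma>\<close>, hence \<open>o(s)\<close>.\<close>

lemma boosted_weight:
  assumes \<omega>: "weight_function \<omega>" and \<sigma>: "weight_function \<sigma>" and \<tau>: "weight_function \<tau>"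
    and dom: "dominates \<tau> \<sigma>" and strong: "strong_pair r \<omega> \<sigma>" and r: "r < 1"
  obtains w s where "mono w" "\<And>t. 0 \<le> w t" "dominates w \<omega>"
    "\<And>t. 1 \<le> t \<Longrightarrow> tail_integral w t < \<infinity>"
    "\<And>N. \<exists>C. \<forall>t\<ge>1. N * (t * enn2real (tail_integral w t)) + N * ln t \<le> s t + C"
    "dominates \<tau> s" "convex_on UNIV (\<lambda>t. s (exp t))" "\<And>t u. 1 \<le> t \<Longrightarrow> t \<le> u \<Longrightarrow> s t \<le> s u"
proof -
  obtain s where s: "dominates s \<sigma>" "dominates \<tau> s" "convex_on UNIV (\<lambda>t. s (exp t))"
    "\<And>t u. 1 \<le> t \<Longrightarrow> t \<le> u \<Longrightarrow> s t \<le> s u"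
    using intermediate_weight[OF \<sigma> \<tau> dom] by metis
  define \<theta> where "\<theta> = 1 - r"
  have \<theta>: "0 < \<theta>"
    using r by (simp add: \<theta>_def)
  obtain c where c: "0 \<le> c" "\<And>t. 1 \<le> t \<Longrightarrow> 1 * \<sigma> t \<le> s t + c"
    using dominatesD[OF s(1), of 1] by metis
  define g where "g = (\<lambda>t. (s t + c + 1) / (\<sigma> t + 1))"
  have \<sigma>0: "0 \<le> \<sigma> t" if "1 \<le> t" for t
    using weight_nonneg[OF \<sigma>] that by simp
  have g1: "1 \<le> g t" if "1 \<le> t" for t
    using c(2)[OF that] \<sigma>0[OF that] by (simp add: g_def field_simps)
  have g_mult: "g t * (\<sigma> t + 1) = s t + c + 1" if "1 \<le> t" for t
    using \<sigma>0[OF that] by (simp add: g_def)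
  have \<sigma>_top: "filterlim \<sigma> at_top at_top"
  proof -
    obtain C where C: "\<And>t. 1 \<le> t \<Longrightarrow> 1 * ln t \<le> \<sigma> t + C"
      using dominatesD[OF weight_dominates_ln[OF \<sigma>], of 1] by metis
    have ev: "\<forall>\<^sub>F t in at_top. - C + ln t \<le> \<sigma> t"
      using eventually_ge_at_top[of 1] by eventually_elim (use C in force)
    have lim: "filterlim (\<lambda>t::real. - C + ln t) at_top at_top"
      by (rule filterlim_tendsto_add_at_top[OF tendsto_const ln_at_top])
    show ?thesis
      by (rule filterlim_at_top_mono[OF lim ev])
  qed
  have g_top: "filterlim g at_top at_top"
    unfolding filterlim_at_top
  proof
    fix Z :: real
    define Y where "Y = max Z 1"
    obtain C where C: "\<And>t. 1 \<le> t \<Longrightarrow> (2 * Y) * \<sigma> t \<le> s t + C"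
      using dominatesD[OF s(1), of "2 * Y"] by metis
    have "\<forall>\<^sub>F t in at_top. C + Y \<le> \<sigma> t"
      using \<sigma>_top by (simp add: filterlim_at_top)
    then show "\<forall>\<^sub>F t in at_top. Z \<le> g t"
      using eventually_ge_at_top[of 1]
    proof eventually_elim
      case (elim t)
      have "1 * \<sigma> t \<le> Y * \<sigma> t"
        using \<sigma>0[OF elim(2)] by (intro mult_right_mono) (auto simp: Y_def)
      then have "Y * (\<sigma> t + 1) \<le> s t + c + 1"
        using C[OF elim(2)] elim(1) c(1) by (simp add: algebra_simps)
      then have "Y \<le> g t"
        using \<sigma>0[OF elim(2)] by (simp add: g_def field_simps)
      then show ?case
        by (simp add: Y_def)
    qed
  qed
  have sg1: "1 \<le> sqrt (g t)" if "1 \<le> t" for t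
    using g1[OF that] by simp
  obtain h where h: "mono h" "\<And>t. 1 \<le> h t" "\<And>t. 1 \<le> t \<Longrightarrow> h t \<le> sqrt (g t)" "filterlim h at_top at_top"
    "\<And>t u. 0 \<le> t \<Longrightarrow> 1 \<le> u \<Longrightarrow> h (t * u) \<le> u powr \<theta> * h t"
    using slow_minorant[OF sg1 filterlim_compose[OF sqrt_at_top g_top] \<theta>] by metis
  have h0: "0 \<le> h t" for t
    using h(2)[of t] by linarith
  define \<omega>' where "\<omega>' = (\<lambda>t. \<omega> (max t 0))"
  have \<omega>': "mono \<omega>'" "\<And>t. 0 \<le> \<omega>' t" "\<And>t. 0 \<le> t \<Longrightarrow> \<omega>' t = \<omega> t"
    using weight_mono[OF \<omega>] weight_nonneg[OF \<omega>] by (auto simp: \<omega>'_def mono_def)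
  define w where "w = (\<lambda>t. h t * \<omega>' t)"
  have w: "mono w" "\<And>t. 0 \<le> w t"
    using h0 \<omega>' h(1) by (auto simp: w_def mono_def intro!: mult_mono)
  have [measurable]: "\<omega>' \<in> borel_measurable borel" "w \<in> borel_measurable borel"
    using \<omega>'(1) w(1) by (auto intro: borel_measurable_mono)
  obtain C where C: "0 < C" "\<And>t. 0 < t \<Longrightarrow>
      (\<integral>\<^sup>+ u\<in>{1..}. ennreal (\<omega> (t * u) / u powr (1 + r)) \<partial>lborel) \<le> ennreal (C * \<sigma> t + C)"
    using strong by (auto simp: strong_pair_def)
  have C': "(\<integral>\<^sup>+ u\<in>{1..}. ennreal (\<omega>' (t * u) / u powr (1 + r)) \<partial>lborel) \<le> ennreal (C * \<sigma> t + C)" if "0 < t" for t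
  proof -
    have "(\<integral>\<^sup>+ u\<in>{1..}. ennreal (\<omega>' (t * u) / u powr (1 + r)) \<partial>lborel) =
        (\<integral>\<^sup>+ u\<in>{1..}. ennreal (\<omega> (t * u) / u powr (1 + r)) \<partial>lborel)"
      using that by (intro nn_integral_cong) (auto simp: indicator_def \<omega>'(3))
    then show ?thesis
      using C(2)[OF that] by simp
  qed
  define J where "J = (\<lambda>t. enn2real (tail_integral w t))"
  have tail_le: "tail_integral w t \<le> ennreal (h t * (C * \<sigma> t + C) / t)" if t: "1 \<le> t" for t
  proof -
    have "(\<integral>\<^sup>+ u\<in>{1..}. ennreal (w (t * u) / u\<^sup>2) \<partial>lborel) \<le>
        (\<integral>\<^sup>+ u. ennreal (h t) * (ennreal (\<omega>' (t * u) / u powr (1 + r)) * indicator {1..} u) \<partial>lborel)"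
    proof (intro nn_integral_mono)
      fix u :: real
      show "ennreal (w (t * u) / u\<^sup>2) * indicator {1..} u \<le>
          ennreal (h t) * (ennreal (\<omega>' (t * u) / u powr (1 + r)) * indicator {1..} u)"
      proof (cases "1 \<le> u")
        case True
        have "u powr \<theta> / u\<^sup>2 = u powr (\<theta> - 2)"
          using True by (simp add: powr_diff powr_numeral)
        also have "\<dots> \<le> u powr (- (1 + r))"
          using True r by (intro powr_mono) (auto simp: \<theta>_def)
        finally have p: "u powr \<theta> / u\<^sup>2 \<le> 1 / u powr (1 + r)"
          by (simp only: powr_minus_divide times_divide_eq_right mult_1_right)
        have "w (t * u) / u\<^sup>2 \<le> (u powr \<theta> * h t) * \<omega>' (t * u) / u\<^sup>2"
          unfolding w_def using h(5)[of t u] t True \<omega>'(2) by (intro divide_right_mono mult_right_mono) auto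
        also have "\<dots> = h t * \<omega>' (t * u) * (u powr \<theta> / u\<^sup>2)"
          by simp
        also have "\<dots> \<le> h t * \<omega>' (t * u) * (1 / u powr (1 + r))"
          using p h0 \<omega>'(2) by (intro mult_left_mono) auto
        finally show ?thesis
          using True h0 \<omega>'(2) by (simp add: ennreal_mult[symmetric] ennreal_leI)
      qed simp
    qed
    also have "\<dots> = ennreal (h t) * (\<integral>\<^sup>+ u\<in>{1..}. ennreal (\<omega>' (t * u) / u powr (1 + r)) \<partial>lborel)"
      by (rule nn_integral_cmult) measurable
    also have "\<dots> \<le> ennreal (h t) * ennreal (C * \<sigma> t + C)"
      using C'[of t] t by (intro mult_left_mono) auto
    finally have "tail_integral w t \<le> ennreal (1 / t) * (ennreal (h t) * ennreal (C * \<sigma> t + C))"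
      using tail_integral_rescale[of w t 1] t by (simp add: mult_left_mono)
    also have "\<dots> = ennreal (h t * (C * \<sigma> t + C) / t)"
      using t h0 C(1) \<sigma>0[OF t] by (simp add: ennreal_mult[symmetric] del: ennreal_plus)
    finally show ?thesis .
  qed
  show thesis
  proof (rule that[of w s])
    show "dominates w \<omega>"
      unfolding dominates_def
    proof
      fix N :: real
      define n where "n = max N 0"
      have "\<forall>\<^sub>F t in at_top. n \<le> h t"
        using h(4) by (simp add: filterlim_at_top)
      then obtain T where T: "\<And>t. T \<le> t \<Longrightarrow> n \<le> h t"
        by (auto simp: eventually_at_top_linorder)
      have "N * \<omega> t \<le> w t + n * \<omega> (max T 1)" if t: "1 \<le> t" for t
      proof -
        have \<omega>0: "0 \<le> \<omega> t" "0 \<le> n * \<omega> (max T 1)"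
          using weight_nonneg[OF \<omega>] t by (auto simp: n_def)
        have "N * \<omega> t \<le> n * \<omega> t"
          using \<omega>0 by (intro mult_right_mono) (auto simp: n_def)
        also have "\<dots> \<le> w t + n * \<omega> (max T 1)"
        proof (cases "T \<le> t")
          case True
          have "n * \<omega> t \<le> h t * \<omega> t"
            using T[OF True] \<omega>0 by (intro mult_right_mono)
          then show ?thesis
            using \<omega>'(3)[of t] t \<omega>0 by (simp add: w_def)
        next
          case False
          then have "n * \<omega> t \<le> n * \<omega> (max T 1)"
            using t by (intro mult_left_mono weight_mono[OF \<omega>]) (auto simp: n_def)
          then show ?thesis
            using w(2)[of t] by simp
        qed
        finally show ?thesis .
      qed
      then show "\<exists>C. \<forall>t\<ge>1. N * \<omega> t \<le> w t + C" by blast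
    qed
    show "tail_integral w t < \<infinity>" if "1 \<le> t" for t
      using le_less_trans[OF tail_le[OF that] ennreal_less_top] by simp
    show "\<exists>D. \<forall>t\<ge>1. N * (t * enn2real (tail_integral w t)) + N * ln t \<le> s t + D" for N
    proof -
      define n where "n = 3 * \<bar>N\<bar>"
      obtain A where A: "\<And>t. 1 \<le> t \<Longrightarrow> (n * C)\<^sup>2 * \<sigma> t \<le> s t + A"
        using dominatesD[OF s(1), of "(n * C)\<^sup>2"] by metis
      obtain B where B: "\<And>t. 1 \<le> t \<Longrightarrow> n * ln t \<le> s t + B"
        using dominatesD[OF dominates_trans[OF s(1) weight_dominates_ln[OF \<sigma>]], of n] by metis
      have "N * (t * J t) + N * ln t \<le> s t + (c + 1 + (n * C)\<^sup>2 + A + B) / 3" if t: "1 \<le> t" for t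
      proof -
        have g: "0 \<le> g t"
          using g1[OF t] by simp
        have "J t \<le> enn2real (ennreal (h t * (C * \<sigma> t + C) / t))"
          unfolding J_def by (rule enn2real_mono[OF tail_le[OF t]]) simp
        also have "\<dots> = h t * (C * \<sigma> t + C) / t"
          using h0 C(1) \<sigma>0[OF t] t by simp
        finally have "t * J t \<le> h t * (C * \<sigma> t + C)"
          using t by (simp add: field_simps)
        also have "\<dots> \<le> sqrt (g t) * (C * \<sigma> t + C)"
          using h(3)[OF t] C(1) \<sigma>0[OF t] by (intro mult_right_mono) auto
        finally have "n * (t * J t) \<le> n * (sqrt (g t) * (C * \<sigma> t + C))"
          by (intro mult_left_mono) (auto simp: n_def)
        also have "\<dots> = (n * C * sqrt (g t)) * (\<sigma> t + 1)"
          by (simp add: algebra_simps)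
        also have "\<dots> \<le> (g t + (n * C)\<^sup>2) * (\<sigma> t + 1)"
        proof (intro mult_right_mono)
          \<comment> \<open>\<open>s\<close> is \<open>g * \<sigma>\<close> up to constants, so a multiple of \<open>sqrt g * \<sigma>\<close> is absorbed by \<open>g * \<sigma>\<close> and a multiple of \<open>\<sigma>\<close>.\<close>
          have "2 * (n * C) * sqrt (g t) \<le> (n * C)\<^sup>2 + (sqrt (g t))\<^sup>2"
            using sum_squares_bound[of "n * C" "sqrt (g t)"] by (simp add: mult.assoc)
          moreover have "0 \<le> n * C * sqrt (g t)"
            using C(1) g by (simp add: n_def)
          ultimately show "n * C * sqrt (g t) \<le> g t + (n * C)\<^sup>2"
            using g by (simp add: mult.assoc)
        qed (use \<sigma>0[OF t] in simp)
        also have "\<dots> = s t + c + 1 + (n * C)\<^sup>2 * \<sigma> t + (n * C)\<^sup>2"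
          using g_mult[OF t] by (simp add: distrib_right) (simp add: algebra_simps)
        finally have 1: "n * (t * J t) \<le> 2 * s t + c + 1 + (n * C)\<^sup>2 + A"
          using A[OF t] by simp
        have "N * (t * J t) + N * ln t \<le> \<bar>N\<bar> * (t * J t) + \<bar>N\<bar> * ln t"
          using t by (intro add_mono mult_right_mono) (auto simp: J_def)
        also have "\<dots> = (n * (t * J t) + n * ln t) / 3"
          by (simp add: n_def)
        also have "\<dots> \<le> (3 * s t + (c + 1 + (n * C)\<^sup>2 + A + B)) / 3"
          using add_mono[OF 1 B[OF t]] by (intro divide_right_mono) (simp_all add: algebra_simps)
        also have "\<dots> = s t + (c + 1 + (n * C)\<^sup>2 + A + B) / 3"
          by (simp add: add_divide_distrib)
        finally show ?thesis .
      qed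
      then show ?thesis
        unfolding J_def by blast
    qed
  qed (use w s in auto)
qed

section \<open>Cut-offs adapted to a weight\<close>

text \<open>The weight sequence associated with \<open>w\<close>, normalised at \<open>0\<close> to be supermultiplicative.\<close>

definition conj_seq :: "(real \<Rightarrow> real) \<Rightarrow> nat \<Rightarrow> real" where
  "conj_seq w l = exp (young_conj w (real l) - young_conj w 0)"

lemma conj_seq_0 [simp]: "conj_seq w 0 = 1"
  by (simp add: conj_seq_def)

lemma conj_seq_pos: "0 < conj_seq w l"
  by (simp add: conj_seq_def)

text \<open>A supremum of affine functions is convex. Directly: of two points at which the suprema are nearly attained, the
larger one serves for \<open>a + b\<close> and the smaller one for \<open>0\<close>.\<close>

lemma young_conj_add_le:
  assumes "dominates w ln" "0 \<le> a" "0 \<le> b"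
  shows "young_conj w a + young_conj w b \<le> young_conj w (a + b) + young_conj w 0"
proof -
  have main: "(x * a - w (exp x)) + (y * b - w (exp y)) \<le> young_conj w (a + b) + young_conj w 0"
    if "0 \<le> x" "0 \<le> y" for x y
  proof -
    define z where "z = max x y"
    define z' where "z' = min x y"
    have "x * a + y * b \<le> z * (a + b)"
      using assms(2,3) mult_right_mono[of x z a] mult_right_mono[of y z b] by (simp add: z_def distrib_left)
    moreover have "w (exp x) + w (exp y) = w (exp z) + w (exp z')"
      by (auto simp: z_def z'_def max_def min_def)
    ultimately show ?thesis
      using young_upper[OF assms(1), of z "a + b"] young_upper[OF assms(1), of z' 0] that
      unfolding z_def z'_def by force
  qed
  have "young_conj w a \<le> young_conj w (a + b) + young_conj w 0 - young_conj w b"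
  proof (rule young_least)
    fix x :: real assume x: "0 \<le> x"
    have "young_conj w b \<le> young_conj w (a + b) + young_conj w 0 - (x * a - w (exp x))"
      by (rule young_least) (use main[OF x] in \<open>simp add: algebra_simps\<close>)
    then show "x * a - w (exp x) \<le> young_conj w (a + b) + young_conj w 0 - young_conj w b"
      by simp
  qed
  then show ?thesis by simp
qed

lemma conj_seq_mult_le:
  assumes "dominates w ln"
  shows "conj_seq w k * conj_seq w l \<le> conj_seq w (k + l)"
  using young_conj_add_le[OF assms, of "real k" "real l"] by (simp add: conj_seq_def exp_add[symmetric])

lemma power_le_conj_seq:
  assumes w: "dominates w ln" "\<And>t. 1 \<le> t \<Longrightarrow> 0 \<le> w t" and t: "1 \<le> t"
  shows "t ^ l \<le> conj_seq w l * exp (w t)"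
proof -
  have "young_conj w 0 \<le> 0"
    by (rule young_least) (use w(2) in simp)
  moreover have "ln t * real l - w (exp (ln t)) \<le> young_conj w (real l)"
    using t by (intro young_upper[OF w(1)]) simp
  ultimately have "real l * ln t \<le> (young_conj w (real l) - young_conj w 0) + w t"
    using t by (simp add: mult.commute)
  then have "exp (real l * ln t) \<le> exp (young_conj w (real l) - young_conj w 0) * exp (w t)"
    by (simp add: exp_add[symmetric])
  then show ?thesis
    using t by (simp add: conj_seq_def exp_of_nat_mult)
qed

text \<open>A geometric factor \<open>A ^ l\<close> translates the argument of the Young conjugate. Doubling turns the translation into a
factor in front of \<open>\<omega>\<close>, which \<open>w\<close> dominates together with \<open>k\<close>.\<close>

lemma conj_seq_absorb:
  assumes \<omega>: "weight_function \<omega>" and dom: "dominates w \<omega>" and k: "1 \<le> k" and A: "0 \<le> A"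
  obtains C where "\<And>l. A ^ l * conj_seq w l * weight_factor \<omega> (1 / real k) l \<le> C"
proof -
  obtain m where "A < 2 ^ m"
    using real_arch_pow[of 2 A] by auto
  define B :: real where "B = 2 ^ m"
  have B: "1 \<le> B" "A \<le> B"
    using \<open>A < 2 ^ m\<close> by (auto simp: B_def)
  obtain D where D: "1 \<le> D" "\<And>t. 0 \<le> t \<Longrightarrow> \<omega> (B * t) \<le> D * \<omega> t + D"
    using weight_doubling[OF \<omega>] unfolding B_def by metis
  obtain C where C: "\<And>t. 1 \<le> t \<Longrightarrow> (real k * D) * \<omega> t \<le> w t + C"
    using dominatesD[OF dom] by metis
  note ln_\<omega> = weight_dominates_ln[OF \<omega>]
  have young: "young_conj w (real l) \<le> real k * young_conj \<omega> (real l / real k) + C + real k * D - ln B * real l" for l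
  proof (rule young_least)
    fix x :: real assume x: "0 \<le> x"
    have "real k * \<omega> (B * exp x) \<le> real k * (D * \<omega> (exp x) + D)"
      using D(2)[of "exp x"] by (intro mult_left_mono) auto
    also have "\<dots> \<le> w (exp x) + C + real k * D"
      using C[of "exp x"] x by (simp add: algebra_simps)
    finally have 1: "real k * \<omega> (B * exp x) \<le> w (exp x) + C + real k * D" .
    have "(x + ln B) * (real l / real k) - \<omega> (exp (x + ln B)) \<le> young_conj \<omega> (real l / real k)"
      using x B by (intro young_upper[OF ln_\<omega>]) auto
    then have "real k * ((x + ln B) * (real l / real k) - \<omega> (B * exp x)) \<le> real k * young_conj \<omega> (real l / real k)"
      using B by (intro mult_left_mono) (auto simp: exp_add mult.commute)
    also have "real k * ((x + ln B) * (real l / real k) - \<omega> (B * exp x)) = (x + ln B) * real l - real k * \<omega> (B * exp x)"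
      using k by (simp add: right_diff_distrib)
    finally show "x * real l - w (exp x) \<le> real k * young_conj \<omega> (real l / real k) + C + real k * D - ln B * real l"
      using 1 by (simp add: algebra_simps)
  qed
  show thesis
  proof (rule that[of "exp (C + real k * D - young_conj w 0)"])
    fix l
    have wf: "weight_factor \<omega> (1 / real k) l = exp (- (real k * young_conj \<omega> (real l / real k)))"
      by (simp add: weight_factor_def)
    have "A ^ l * conj_seq w l * weight_factor \<omega> (1 / real k) l \<le> B ^ l * conj_seq w l * weight_factor \<omega> (1 / real k) l"
      using A B by (intro mult_right_mono power_mono) (auto simp: conj_seq_def wf)
    also have "B ^ l * conj_seq w l * weight_factor \<omega> (1 / real k) l =
       exp (ln B * real l + (young_conj w (real l) - young_conj w 0) - real k * young_conj \<omega> (real l / real k))"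
      using B by (simp add: exp_add exp_diff exp_minus field_simps conj_seq_def wf exp_of_nat_mult exp_of_nat2_mult)
    also have "\<dots> \<le> exp (C + real k * D - young_conj w 0)"
      using young[of l] by simp
    finally show "A ^ l * conj_seq w l * weight_factor \<omega> (1 / real k) l \<le> exp (C + real k * D - young_conj w 0)" .
  qed
qed

text \<open>The boxes have widths \<open>1 / (2 * v i)\<close>, where \<open>v i \<ge> t\<close> is the point at which \<open>w\<close> passes the value \<open>i\<close>. Their total
width is at most the tail integral, because the function counting the \<open>v i\<close> below \<open>x\<close> is at most \<open>w x\<close>. Conversely the
product of the first \<open>l\<close> of the \<open>v i\<close> is at most \<open>v l ^ l\<close>, and up to \<open>v l\<close> the weight is at most the larger
of \<open>l\<close> and \<open>w t\<close>, which by conjugation compares \<open>v l ^ l\<close> with \<open>conj_seq w l\<close>.\<close>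

lemma conj_seq_cutoff:
  assumes mono: "mono w" and nonneg: "\<And>t. 0 \<le> w t" and ln_w: "dominates w ln"
    and t: "1 \<le> t" and fin: "tail_integral w t < \<infinity>" and pos: "0 < enn2real (tail_integral w t)"
  obtains D :: "nat \<Rightarrow> real \<Rightarrow> real" where
    "\<And>l x. (D l has_real_derivative D (Suc l) x) (at x)"
    "\<And>x. x \<le> 0 \<Longrightarrow> D 0 x = 0" "\<And>x. 2 * enn2real (tail_integral w t) \<le> x \<Longrightarrow> D 0 x = 1"
    "\<And>l x. \<bar>D l x\<bar> \<le> exp (w t) * (4 * exp 1) ^ l * conj_seq w l"
proof -
  have [measurable]: "w \<in> borel_measurable borel"
    using mono by (rule borel_measurable_mono)
  define X where "X = (\<lambda>i::nat. {v. t \<le> v \<and> real i \<le> w v})"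
  define v where "v = (\<lambda>i. Inf (X i))"
  have ne: "X i \<noteq> {}" for i
  proof -
    obtain C where C: "\<And>t. 1 \<le> t \<Longrightarrow> 1 * ln t \<le> w t + C"
      using dominatesD[OF ln_w, of 1] by metis
    define u where "u = max t (exp (real i + C))"
    have "real i + C \<le> ln u"
      using t by (simp add: u_def ln_ge_iff)
    then have "u \<in> X i"
      using C[of u] t by (force simp: X_def u_def)
    then show ?thesis by blast
  qed
  have bdd: "bdd_below (X i)" for i
    by (rule bdd_belowI[of _ t]) (auto simp: X_def)
  have vt: "t \<le> v i" for i
    unfolding v_def by (rule cInf_greatest[OF ne]) (auto simp: X_def)
  have v_mono: "v i \<le> v j" if "i \<le> j" for i j
    unfolding v_def by (rule cInf_superset_mono[OF ne bdd]) (use that in \<open>auto simp: X_def\<close>)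
  have below: "w u < real i" if "t \<le> u" "u < v i" for u i
    using that cInf_lower[OF _ bdd, of u i] by (force simp: v_def X_def)
  have above: "real i \<le> w u" if vu: "v i < u" for u i
  proof -
    obtain x where "x \<in> X i" "x < u"
      using cInf_lessD[OF ne vu[unfolded v_def]] by blast
    then show ?thesis
      using monoD[OF mono, of x u] by (auto simp: X_def)
  qed
  have v_power: "v l ^ l \<le> exp (w t) * exp 1 ^ l * conj_seq w l" for l
  proof (cases "v l = t")
    case True
    have "t ^ l \<le> 1 * (conj_seq w l * exp (w t))"
      using power_le_conj_seq[OF ln_w nonneg t] by simp
    also have "\<dots> \<le> exp 1 ^ l * (conj_seq w l * exp (w t))"
      by (intro mult_right_mono) (auto intro!: one_le_power simp: conj_seq_def)
    finally show ?thesis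
      using True by (simp add: mult_ac)
  next
    case False
    then have tv: "t < v l"
      using vt[of l] by simp
    have "((\<lambda>u. u ^ l) \<longlongrightarrow> v l ^ l) (at_left (v l))"
      by (intro tendsto_intros)
    then have "v l ^ l \<le> exp 1 ^ l * conj_seq w l"
    proof (rule tendsto_upperbound)
      have "\<forall>\<^sub>F u in at_left (v l). u \<in> {t<..<v l}"
        using tv by (rule eventually_at_left_real)
      then show "\<forall>\<^sub>F u in at_left (v l). u ^ l \<le> exp 1 ^ l * conj_seq w l"
      proof eventually_elim
        case (elim u)
        have "u ^ l \<le> conj_seq w l * exp (w u)"
          using elim t by (intro power_le_conj_seq[OF ln_w nonneg]) auto
        also have "\<dots> \<le> conj_seq w l * exp (real l)"
          using below[of u l] elim conj_seq_pos[of w l] by (intro mult_left_mono) auto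
        finally show ?case
          by (simp add: exp_of_nat_mult[of l 1, simplified] mult.commute)
      qed
    qed simp
    also have "\<dots> \<le> exp (w t) * (exp 1 ^ l * conj_seq w l)"
      using nonneg[of t] conj_seq_pos[of w l] mult_right_mono[of 1 "exp (w t)" "exp 1 ^ l * conj_seq w l"]
      by simp
    finally show ?thesis
      by (simp add: mult_ac)
  qed
  \<comment> \<open>The factor \<open>2\<close> is a safety margin: at \<open>v i\<close> itself \<open>w\<close> may not yet have reached \<open>i\<close>, beyond it has.\<close>
  define a where "a = (\<lambda>i. 1 / (2 * v (Suc i)))"
  have v0: "0 < v i" for i
    using vt[of i] t by linarith
  then have a0: "0 < a i" for i
    by (simp add: a_def)
  have partial: "(\<Sum>i<n. a i) \<le> enn2real (tail_integral w t)" for n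
  proof -
    have "ennreal (\<Sum>i<n. a i) = (\<Sum>i<n. \<integral>\<^sup>+ x\<in>{2 * v (Suc i)..}. ennreal (1 / x\<^sup>2) \<partial>lborel)"
      using a0 v0 by (subst sum_ennreal[symmetric]) (auto simp: nn_integral_inverse_square a_def less_imp_le)
    also have "\<dots> = (\<integral>\<^sup>+ x. (\<Sum>i<n. ennreal (1 / x\<^sup>2) * indicator {2 * v (Suc i)..} x) \<partial>lborel)"
      by (rule nn_integral_sum[symmetric]) measurable
    also have "\<dots> \<le> tail_integral w t"
      unfolding tail_integral_def
    proof (intro nn_integral_mono)
      fix x :: real
      define S where "S = {i. i < n \<and> 2 * v (Suc i) \<le> x}"
      have [simp]: "finite S"
        by (simp add: S_def)
      have "(\<Sum>i<n. ennreal (1 / x\<^sup>2) * indicator {2 * v (Suc i)..} x) = (\<Sum>i\<in>S. ennreal (1 / x\<^sup>2))"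
        by (rule sum.mono_neutral_cong_right) (auto simp: S_def indicator_def)
      also have "\<dots> = ennreal (real (card S) / x\<^sup>2)"
        by (simp add: ennreal_of_nat_eq_real_of_nat ennreal_mult[symmetric])
      also have "\<dots> \<le> ennreal (w x / x\<^sup>2) * indicator {t..} x"
      proof (cases "S = {}")
        case False
        have S_le: "real (Suc i) \<le> w x" "t \<le> x" if "i \<in> S" for i
          using that above[of "Suc i" x] v0[of "Suc i"] vt[of "Suc i"] by (auto simp: S_def)
        have "S \<subseteq> {..<nat \<lfloor>w x\<rfloor>}"
          using S_le by (auto simp: nat_less_iff le_floor_iff less_floor_iff zless_nat_eq_int_zless) force
        then have "card S \<le> nat \<lfloor>w x\<rfloor>"
          using card_mono[of "{..<nat \<lfloor>w x\<rfloor>}" S] by simp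
        then have "real (card S) \<le> w x"
          using nonneg[of x] by linarith
        then show ?thesis
          using False S_le by (auto simp: divide_right_mono ennreal_leI)
      qed simp
      finally show "(\<Sum>i<n. ennreal (1 / x\<^sup>2) * indicator {2 * v (Suc i)..} x) \<le> ennreal (w x / x\<^sup>2) * indicator {t..} x" .
    qed
    finally have "enn2real (ennreal (\<Sum>i<n. a i)) \<le> enn2real (tail_integral w t)"
      using fin by (intro enn2real_mono) auto
    then show ?thesis
      using a0 by (simp add: sum_nonneg less_imp_le)
  qed
  have sm: "summable a"
    using a0 partial by (intro summableI_nonneg_bounded) (auto intro: less_imp_le)
  have le: "suminf a \<le> enn2real (tail_integral w t)"
    using suminf_le_const[OF sm partial] .
  obtain D :: "nat \<Rightarrow> real \<Rightarrow> real" where D: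
    "\<And>l x. (D l has_real_derivative D (Suc l) x) (at x)"
    "\<And>x. x \<le> 0 \<Longrightarrow> D 0 x = 0" "\<And>x. 2 * enn2real (tail_integral w t) \<le> x \<Longrightarrow> D 0 x = 1"
    "\<And>l x. \<bar>D l x\<bar> \<le> (\<Prod>i<l. 2 / a i)"
    using smooth_step_exists[of a "enn2real (tail_integral w t)"] a0 sm le pos by metis
  show thesis
  proof (rule that[of D, OF D(1-3)])
    fix l x
    have "\<bar>D l x\<bar> \<le> (\<Prod>i<l. 2 / a i)"
      by (rule D(4))
    also have "\<dots> \<le> (\<Prod>i<l. 4 * v l)"
      using v0 v_mono by (intro prod_mono) (auto simp: a_def less_imp_le)
    also have "\<dots> = 4 ^ l * v l ^ l"
      by (simp add: power_mult_distrib)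
    also have "\<dots> \<le> 4 ^ l * (exp (w t) * exp 1 ^ l * conj_seq w l)"
      by (intro mult_left_mono v_power) auto
    finally show "\<bar>D l x\<bar> \<le> exp (w t) * (4 * exp 1) ^ l * conj_seq w l"
      by (simp add: power_mult_distrib mult_ac)
  qed
qed

section \<open>Degrees of Taylor polynomials\<close>

lemma convex_on_secant:
  fixes f :: "real \<Rightarrow> real"
  assumes f: "convex_on UNIV f" and ab: "a < b" and x: "b \<le> x \<or> x \<le> a"
  shows "f a + (f b - f a) / (b - a) * (x - a) \<le> f x"
proof -
  have mid: "f v \<le> f u + (f y - f u) / (y - u) * (v - u)" if "u \<le> v" "v \<le> y" "u < y" for u v y
  proof -
    define c where "c = (v - u) / (y - u)"
    have c: "0 \<le> c" "c \<le> 1"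
      using that by (auto simp: c_def)
    have "c * (y - u) = v - u"
      using that by (simp add: c_def)
    then have c3: "(1 - c) *\<^sub>R u + c *\<^sub>R y = v"
      by (simp add: algebra_simps)
    have "f v \<le> (1 - c) * f u + c * f y"
      using convex_onD[OF f c(1,2), of u y] c3 by simp
    also have "\<dots> = f u + (f y - f u) / (y - u) * (v - u)"
    proof -
      have "(1 - c) * f u + c * f y = f u + c * (f y - f u)"
        by (simp add: algebra_simps)
      then show ?thesis
        by (simp add: c_def mult.commute)
    qed
    finally show ?thesis .
  qed
  show ?thesis
  proof (cases "b \<le> x")
    case True
    define d where "d = x - a"
    have d: "0 < d" using True ab by (simp add: d_def)
    have "f b - f a \<le> (f x - f a) / d * (b - a)"
      using mid[of a b x] ab True by (simp add: d_def)
    then have "(f b - f a) / (b - a) \<le> (f x - f a) / d"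
      using ab by (simp add: pos_divide_le_eq)
    then have "(f b - f a) / (b - a) * d \<le> f x - f a"
      using d by (simp add: pos_le_divide_eq)
    then show ?thesis
      by (simp add: d_def)
  next
    case False
    with x have xa: "x \<le> a" by simp
    define d where "d = b - x"
    have d: "0 < d" "0 < b - a" using xa ab by (auto simp: d_def)
    have "f a \<le> f x + (f b - f x) / d * (a - x)"
      using mid[of x a b] ab xa by (simp add: d_def)
    then have "f a * d \<le> f x * d + (f b - f x) * (a - x)"
      using d by (simp add: field_simps)
    then have "f a * (b - a) + (f b - f a) * (x - a) \<le> f x * (b - a)"
      by (simp add: d_def algebra_simps)
    then show ?thesis
      using d by (simp add: field_simps)
  qed
qed

text \<open>The slope of the secant of \<open>x \<mapsto> s (exp x)\<close> between \<open>j * ln 2\<close> and \<open>(j + 1) * ln 2\<close>. Secants over dyadic intervals serve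
as well as derivatives, since factors of \<open>2\<close> in the scale are harmless.\<close>

definition secant_slope :: "(real \<Rightarrow> real) \<Rightarrow> nat \<Rightarrow> real" where
  "secant_slope s j = (s (2 ^ Suc j) - s (2 ^ j)) / ln 2"

lemma exp_nat_ln2: "exp (real j * ln 2) = 2 ^ j"
  by (simp add: exp_of_nat_mult)

text \<open>If \<open>p\<close> lies between the rounded slopes \<open>q j\<close> and \<open>q (Suc j)\<close>, then by convexity \<open>x * p - s (exp x)\<close> is maximal, up to errors
of order \<open>p\<close>, for \<open>exp x\<close> between \<open>2 ^ j\<close> and \<open>4 * 2 ^ j\<close>, where monotonicity bounds \<open>s\<close> from below by \<open>s (2 ^ j)\<close>.\<close>

lemma
  fixes s :: "real \<Rightarrow> real"
  assumes conv: "convex_on UNIV (\<lambda>x. s (exp x))" and mono: "\<And>t u. 1 \<le> t \<Longrightarrow> t \<le> u \<Longrightarrow> s t \<le> s u"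
  defines "q \<equiv> \<lambda>j. nat \<lfloor>secant_slope s j\<rfloor>"
  shows mono_degree: "j \<le> k \<Longrightarrow> q j \<le> q k"
    and young_conj_degree: "q j \<le> p \<Longrightarrow> p \<le> q (Suc j) \<Longrightarrow>
      young_conj s (real p) \<le> real (Suc p) * ln (4 * 2 ^ j) - s (2 ^ j)"
    and filterlim_degree: "dominates s ln \<Longrightarrow> filterlim q at_top at_top"
proof -
  define \<phi> where "\<phi> = (\<lambda>x. s (exp x))"
  define L where "L = ln (2 :: real)"
  have L: "0 < L" by (simp add: L_def)
  have \<phi>: "\<phi> (real j * L) = s (2 ^ j)" for j
    by (simp add: \<phi>_def L_def exp_nat_ln2)
  have slope: "(\<phi> (real (Suc j) * L) - \<phi> (real j * L)) / (real (Suc j) * L - real j * L) = secant_slope s j" for j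
  proof -
    have "real (Suc j) * L - real j * L = L"
      by (simp add: algebra_simps)
    then show ?thesis
      unfolding \<phi> by (simp add: secant_slope_def L_def)
  qed
  have secant: "s (2 ^ j) + secant_slope s j * (x - real j * L) \<le> \<phi> x"
    if "real (Suc j) * L \<le> x \<or> x \<le> real j * L" for j x
  proof -
    have "real j * L < real (Suc j) * L"
      using L by simp
    from convex_on_secant[OF conv[folded \<phi>_def] this that] show ?thesis
      unfolding slope unfolding \<phi> .
  qed
  have slope_nonneg: "0 \<le> secant_slope s j" for j
    using mono[of "2 ^ j" "2 ^ Suc j"] by (simp add: secant_slope_def)
  have slope_Suc: "secant_slope s j \<le> secant_slope s (Suc j)" for j
  proof -
    have "s (2 ^ Suc j) = s (2 ^ j) + secant_slope s j * L"
      using L by (simp add: secant_slope_def L_def)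
    moreover have "s (2 ^ j) + secant_slope s j * (2 * L) \<le> s (2 ^ Suc (Suc j))"
      using secant[of j "real (Suc (Suc j)) * L"] L unfolding \<phi> by (simp add: algebra_simps)
    ultimately show ?thesis
      using L by (simp add: secant_slope_def[of s "Suc j"] L_def[symmetric] field_simps)
  qed
  have slope_mono: "secant_slope s j \<le> secant_slope s k" if "j \<le> k" for j k
    using lift_Suc_mono_le[of "secant_slope s", OF slope_Suc that] .
  show "j \<le> k \<Longrightarrow> q j \<le> q k"
    unfolding q_def by (intro nat_mono floor_mono slope_mono)
  show "young_conj s (real p) \<le> real (Suc p) * ln (4 * 2 ^ j) - s (2 ^ j)" if p: "q j \<le> p" "p \<le> q (Suc j)"
  proof (rule young_least)
    fix x :: real assume x: "0 \<le> x"
    have ln4: "ln (4 * 2 ^ j) = real (Suc (Suc j)) * L"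
    proof -
      have "(4 * 2 ^ j :: real) = 2 ^ Suc (Suc j)" by simp
      then show ?thesis
        unfolding L_def by (simp only: ln_realpow)
    qed
    have p1: "secant_slope s j \<le> real (Suc p)"
      using p(1) slope_nonneg[of j] unfolding q_def by linarith
    have p2: "real p \<le> secant_slope s (Suc j)"
      using p(2) slope_nonneg[of "Suc j"] unfolding q_def by linarith
    consider "x \<le> real j * L" | "real j * L \<le> x" "x \<le> real (Suc (Suc j)) * L" | "real (Suc (Suc j)) * L \<le> x"
      by linarith
    then have "x * real p - \<phi> x \<le> real (Suc p) * (real (Suc (Suc j)) * L) - s (2 ^ j)"
    proof cases
      case 1
      have "s (2 ^ j) - secant_slope s j * (real j * L - x) \<le> \<phi> x"
        using secant[of j x] 1 by (simp add: algebra_simps)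
      moreover have "secant_slope s j * (real j * L - x) \<le> real (Suc p) * (real j * L - x)"
        using p1 1 by (intro mult_right_mono) auto
      moreover have "real (Suc p) * (real j * L) \<le> real (Suc p) * (real (Suc (Suc j)) * L)"
        using L by (intro mult_left_mono mult_right_mono) auto
      ultimately show ?thesis
        using x by (simp add: algebra_simps)
    next
      case 2
      have "\<phi> (real j * L) \<le> \<phi> x"
        unfolding \<phi>_def using 2 L by (intro mono) auto
      moreover have "x * real p \<le> real (Suc p) * (real (Suc (Suc j)) * L)"
        using 2 x by (subst mult.commute, intro mult_mono) auto
      ultimately show ?thesis
        unfolding \<phi> by linarith
    next
      case 3
      have "s (2 ^ Suc j) + secant_slope s (Suc j) * (x - real (Suc j) * L) \<le> \<phi> x"
        by (rule secant) (use 3 in auto)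
      moreover have "real p * (x - real (Suc j) * L) \<le> secant_slope s (Suc j) * (x - real (Suc j) * L)"
        using p2 3 L by (intro mult_right_mono) (auto simp: algebra_simps)
      moreover have "s (2 ^ j) \<le> s (2 ^ Suc j)"
        by (rule mono) auto
      moreover have "real p * (real (Suc j) * L) \<le> real (Suc p) * (real (Suc (Suc j)) * L)"
        using L by (intro mult_mono) auto
      ultimately show ?thesis
        by (simp add: algebra_simps)
    qed
    then show "x * real p - s (exp x) \<le> real (Suc p) * ln (4 * 2 ^ j) - s (2 ^ j)"
      by (simp add: ln4 \<phi>_def)
  qed
  show "filterlim q at_top at_top" if dom: "dominates s ln"
    unfolding filterlim_at_top
  proof
    fix Z :: nat
    obtain C where C: "0 \<le> C" "\<And>t. 1 \<le> t \<Longrightarrow> (real Z + 1) * ln t \<le> s t + C"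
      using dominatesD[OF dom] by metis
    have "\<exists>k. real Z \<le> secant_slope s k"
    proof (rule ccontr)
      assume "\<not> ?thesis"
      then have less: "secant_slope s k < real Z" for k
        by (simp add: not_le)
      have "s (2 ^ k) \<le> s 1 + real k * (real Z * L)" for k
      proof (induction k)
        case (Suc k)
        have "s (2 ^ Suc k) = s (2 ^ k) + secant_slope s k * L"
          using L by (simp add: secant_slope_def L_def)
        moreover have "secant_slope s k * L \<le> real Z * L"
          using less[of k] L by simp
        ultimately show ?case
          using Suc.IH by (simp add: algebra_simps)
      qed simp
      moreover have "(real Z + 1) * (real k * L) \<le> s (2 ^ k) + C" for k
        using C(2)[of "2 ^ k"] by (simp add: L_def ln_realpow)
      ultimately have "(real Z + 1) * (real k * L) \<le> s 1 + real k * (real Z * L) + C" for k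
        by (meson add_mono_thms_linordered_semiring(3) order_trans)
      then have "real k * L \<le> s 1 + C" for k
        by (simp add: algebra_simps)
      moreover obtain k :: nat where "(s 1 + C) / L < real k"
        using reals_Archimedean2 by blast
      ultimately show False
        using L by (simp add: pos_divide_less_eq) (metis linorder_not_le)
    qed
    then obtain k where k: "real Z \<le> secant_slope s k" by blast
    have "Z \<le> q j" if "k \<le> j" for j
      using k slope_mono[OF that] unfolding q_def by linarith
    then show "\<forall>\<^sub>F j in at_top. Z \<le> q j"
      by (auto simp: eventually_at_top_linorder)
  qed
qed

section \<open>Cells and anchors\<close>

lemma partials_mult_eq_0:
  assumes "open S" "smooth_on S f" "smooth_on S g" "x \<in> S"
    and zero: "(\<forall>is. partials is f x = 0) \<or> (\<forall>is. partials is g x = 0)"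
  shows "partials is (\<lambda>x. f x * g x) x = 0"
proof -
  have "(\<Sum>(l, r)\<leftarrow>splits is. partials l f x * partials r g x) = (\<Sum>(l, r)\<leftarrow>splits is. 0)"
    using zero by (intro arg_cong[of _ _ sum_list] map_cong) auto
  also have "\<dots> = 0"
    by (simp add: case_prod_unfold sum_list_triv)
  finally show ?thesis
    by (simp add: partials_mult[OF assms(1-4)])
qed

lemma sum_int_telescope:
  fixes f :: "int \<Rightarrow> 'a::ab_group_add"
  shows "(\<Sum>k\<in>{- int N..int N}. f k - f (k + 1)) = f (- int N) - f (int N + 1)"
proof (induction N)
  case (Suc N)
  have "{- int (Suc N)..int (Suc N)} = insert (- int (Suc N)) (insert (int (Suc N)) {- int N..int N})"
    by auto
  then show ?case
    using Suc.IH by (simp add: algebra_simps)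
qed simp

text \<open>The jets with growth \<open>N\<close> to which the gain applies: in the window of degrees between scales \<open>j\<close> and \<open>Suc j\<close>,
\<open>N\<close> is at most a power of \<open>s j\<close> times the small number \<open>\<delta> j\<close>. For \<open>j = 0\<close> the window extends down to \<open>0\<close>, because the
first layer consists of full Taylor polynomials.\<close>

definition admissible :: "(nat \<Rightarrow> nat) \<Rightarrow> (nat \<Rightarrow> real) \<Rightarrow> (nat \<Rightarrow> real) \<Rightarrow> (nat \<Rightarrow> real) \<Rightarrow> real \<Rightarrow> bool" where
  "admissible q s \<delta> N C \<longleftrightarrow> 0 \<le> C \<and>
     (\<forall>j p. (q j \<le> p \<or> j = 0) \<longrightarrow> p \<le> q (Suc j) \<longrightarrow> N p \<le> C * \<delta> j * s j ^ Suc p)"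

text \<open>The data of the construction at scale \<open>j\<close>: the mesh \<open>e j\<close>, a smooth step \<open>H j\<close> of that width with its
derivatives, the cost \<open>b j\<close> of the step, the degree bound \<open>q j\<close>, the frequency \<open>s j\<close> (four times \<open>2 ^ j\<close> in the
application) and the gain \<open>\<delta> j\<close>. The summability assumption says that the gain beats the cost: the first factor counts
pairs of cells that meet a ball, \<open>b\<close> enters once for every coordinate of both cells and once for converting powers of
\<open>s j\<close> into \<open>M\<close>, and anchors are at distance at most \<open>8 * CARD('n) + 1\<close> times the mesh.\<close>

locale whitney_scheme =
  fixes A :: "(real^'n::finite) set" and M :: "nat \<Rightarrow> real" and L :: real
    and e b s \<delta> :: "nat \<Rightarrow> real" and q :: "nat \<Rightarrow> nat" and H :: "nat \<Rightarrow> nat \<Rightarrow> real \<Rightarrow> real"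
  assumes closed: "closed A" and nonempty: "A \<noteq> {}"
    and M_mult: "M k * M l \<le> M (k + l)" and M_pos: "0 < M k" and M_0: "1 \<le> M 0" and L_nonneg: "0 \<le> L"
    and e_pos: "0 < e j" and e_Suc: "e (Suc j) \<le> e j"
    and H_deriv: "(H j l has_real_derivative H j (Suc l) y) (at y)"
    and H_0: "y \<le> 0 \<Longrightarrow> H j 0 y = 0" and H_1: "e j \<le> y \<Longrightarrow> H j 0 y = 1"
    and H_bound: "\<bar>H j l y\<bar> \<le> b j * L ^ l * M l" and b_ge_1: "1 \<le> b j"
    and q_Suc: "q j \<le> q (Suc j)" and q_lim: "filterlim q at_top at_top"
    and s_pos: "0 < s j" and s_power: "s j ^ l \<le> 4 ^ l * M l * b j" and \<delta>_pos: "0 < \<delta> j"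
    and summable_scale: "summable (\<lambda>j. (1 / e (Suc j)) ^ (2 * CARD('n)) * b j ^ (CARD('n) + 1) * b (Suc j) ^ CARD('n) *
      s j * \<delta> j * exp (real (CARD('n) + 2) * (s j * (real (8 * CARD('n) + 1) * e j))))"
begin

lemma b_nonneg: "0 \<le> b j"
  using b_ge_1[of j] by linarith

lemma e_antimono: "i \<le> j \<Longrightarrow> e j \<le> e i"
  by (rule lift_Suc_antimono_le[of e]) (rule e_Suc)

lemma H_deriv_eq_0:
  "y < 0 \<Longrightarrow> H j l y = 0" "e j < y \<Longrightarrow> H j (Suc l) y = 0"
proof -
  have const: "H j (Suc k) y = 0" if "open T" "y \<in> T" "\<And>z. z \<in> T \<Longrightarrow> H j k z = c" for T c k y
  proof -
    have "(H j k has_real_derivative 0) (at y)"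
      by (rule has_field_derivative_transform_within_open[of "\<lambda>_. c" 0 y T]) (use that in auto)
    then show ?thesis
      using H_deriv DERIV_unique by blast
  qed
  show "y < 0 \<Longrightarrow> H j l y = 0"
  proof (induction l arbitrary: y)
    case (Suc l)
    then show ?case
      by (intro const[of "{..<0}" _ _ 0]) auto
  qed (simp add: H_0)
  show "e j < y \<Longrightarrow> H j (Suc l) y = 0"
  proof (induction l arbitrary: y)
    case 0
    then show ?case
      by (intro const[of "{e j<..}" _ _ 1]) (auto simp: H_1)
  next
    case (Suc l)
    show ?case
      by (rule const[of "{e j<..}" _ _ 0]) (use Suc in auto)
  qed
qed

text \<open>The \<open>l\<close>-th derivative of the difference of two neighbouring steps, which is supported in two adjacent intervals
of the mesh.\<close>

definition cut :: "nat \<Rightarrow> int \<Rightarrow> nat \<Rightarrow> real \<Rightarrow> real" where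
  "cut j k l y = H j l (y - of_int k * e j) - H j l (y - of_int (k + 1) * e j)"

definition cell :: "nat \<Rightarrow> ('n \<Rightarrow> int) \<Rightarrow> real^'n \<Rightarrow> real" where
  "cell j m x = (\<Prod>i\<in>UNIV. cut j (m i) 0 (x $ i))"

text \<open>A closed box outside of which the cell vanishes with all its derivatives.\<close>

definition slab :: "nat \<Rightarrow> ('n \<Rightarrow> int) \<Rightarrow> (real^'n) set" where
  "slab j m = {x. \<forall>i. of_int (m i) * e j \<le> x $ i \<and> x $ i \<le> of_int (m i + 2) * e j}"

definition node :: "nat \<Rightarrow> ('n \<Rightarrow> int) \<Rightarrow> real^'n" where
  "node j m = (\<chi> i. of_int (m i) * e j)"

definition anchor :: "nat \<Rightarrow> ('n \<Rightarrow> int) \<Rightarrow> real^'n" where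
  "anchor j m = closest_point A (node j m)"

text \<open>The constant is chosen such that every cell that does not vanish close to \<open>A\<close> is near \<open>A\<close>.\<close>

definition near :: "nat \<Rightarrow> ('n \<Rightarrow> int) \<Rightarrow> bool" where
  "near j m \<longleftrightarrow> dist (node j m) (anchor j m) \<le> real (2 * CARD('n) + 1) * e j"

lemma cut_deriv: "(cut j k l has_real_derivative cut j k (Suc l) y) (at y)"
proof -
  have "((\<lambda>y. H j l (y - c)) has_real_derivative H j (Suc l) (y - c)) (at y)" for c
    using DERIV_shift[of "H j l" "H j (Suc l) (y - c)" y "- c"] H_deriv[of j l "y - c"] by simp
  then show ?thesis
    unfolding cut_def by (intro DERIV_diff)
qed

lemma cut_eq_0:
  assumes "\<not> (of_int k * e j \<le> y \<and> y \<le> of_int (k + 2) * e j)"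
  shows "cut j k l y = 0"
proof (cases "y < of_int k * e j")
  case True
  then have "y - of_int k * e j < 0" "y - of_int (k + 1) * e j < 0"
    using e_pos[of j] by (auto simp: algebra_simps)
  then show ?thesis
    by (simp add: cut_def H_deriv_eq_0(1))
next
  case False
  then have y: "e j < y - of_int k * e j" "e j < y - of_int (k + 1) * e j"
    using e_pos[of j] assms by (auto simp: algebra_simps)
  show ?thesis
  proof (cases l)
    case 0
    then show ?thesis
      using y by (simp add: cut_def H_1)
  next
    case (Suc l')
    then show ?thesis
      unfolding cut_def Suc by (simp only: H_deriv_eq_0(2)[OF y(1)] H_deriv_eq_0(2)[OF y(2)])
  qed
qed

lemma cut_bound: "\<bar>cut j k l y\<bar> \<le> 2 * b j * L ^ l * M l"
  using H_bound[of j l "y - of_int k * e j"] H_bound[of j l "y - of_int (k + 1) * e j"]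
  unfolding cut_def by linarith

lemma smooth_cell: "smooth_on UNIV (cell j m)"
  unfolding cell_def by (intro smooth_on_prod smooth_on_coordinate[where D = "cut j (m _)"] cut_deriv) auto

lemma partials_cut_coord:
  "partials is (\<lambda>x. cut j k 0 (x $ i)) x = (if set is \<subseteq> {i} then cut j k (length is) (x $ i) else 0)"
  using partials_coordinate[where D = "cut j k" and S = UNIV and k = i, OF open_UNIV cut_deriv] by simp

lemma cell_growth: "growth_at M x ((2 * b j) ^ CARD('n)) (CARD('n) * L) (cell j m)"
proof -
  have "growth_at M x (2 * b j) L (\<lambda>x. cut j k 0 (x $ i))" for k i
    using cut_bound[of j k _ "x $ i"] b_nonneg[of j] L_nonneg M_pos
    by (auto simp: growth_at_def partials_cut_coord less_imp_le)
  moreover have "smooth_on UNIV (\<lambda>x. cut j k 0 (x $ i))" for k i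
    by (rule smooth_on_coordinate[where D = "cut j k"]) (simp_all add: cut_deriv)
  ultimately have "growth_at M x (\<Prod>i\<in>(UNIV :: 'n set). 2 * b j) (\<Sum>i\<in>(UNIV :: 'n set). L)
      (\<lambda>x. \<Prod>i\<in>UNIV. cut j (m i) 0 (x $ i))"
    using b_nonneg[of j] L_nonneg M_pos M_mult M_0
    by (intro growth_at_prod[OF open_UNIV]) (auto simp: less_imp_le)
  then show ?thesis
    unfolding cell_def by simp
qed

lemma partials_cell_eq_0:
  assumes "x \<notin> slab j m"
  shows "partials is (cell j m) x = 0"
proof -
  obtain i where i: "\<not> (of_int (m i) * e j \<le> x $ i \<and> x $ i \<le> of_int (m i + 2) * e j)"
    using assms by (auto simp: slab_def)
  have "cell j m = (\<lambda>x. cut j (m i) 0 (x $ i) * (\<Prod>k\<in>UNIV - {i}. cut j (m k) 0 (x $ k)))"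
    unfolding cell_def by (rule ext, rule prod.remove) auto
  moreover have "partials is (\<lambda>x. cut j (m i) 0 (x $ i) * (\<Prod>k\<in>UNIV - {i}. cut j (m k) 0 (x $ k))) x = 0"
  proof (rule partials_mult_eq_0[OF open_UNIV])
    show "smooth_on UNIV (\<lambda>x. \<Prod>k\<in>UNIV - {i}. cut j (m k) 0 (x $ k))"
      by (intro smooth_on_prod smooth_on_coordinate[where D = "cut j (m _)"] cut_deriv) auto
    show "smooth_on UNIV (\<lambda>x. cut j (m i) 0 (x $ i))"
      by (intro smooth_on_coordinate[where D = "cut j (m _)"] cut_deriv) auto
  qed (use cut_eq_0[OF i] in \<open>auto simp: partials_cut_coord\<close>)
  ultimately show ?thesis by simp
qed

lemma cell_eq_0: "x \<notin> slab j m \<Longrightarrow> cell j m x = 0"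
  using partials_cell_eq_0[of x j m "[]"] by simp

lemma dist_node_le:
  assumes "x \<in> slab j m"
  shows "dist x (node j m) \<le> real (2 * CARD('n)) * e j"
proof -
  have "norm (x - node j m) \<le> (\<Sum>i\<in>UNIV. \<bar>(x - node j m) $ i\<bar>)"
    by (rule norm_le_l1_cart)
  also have "\<dots> \<le> (\<Sum>i\<in>(UNIV :: 'n set). 2 * e j)"
    using assms by (intro sum_mono) (auto simp: slab_def node_def algebra_simps)
  finally show ?thesis
    by (simp add: dist_norm)
qed

lemma anchor_in: "anchor j m \<in> A"
  unfolding anchor_def by (rule closest_point_in_set[OF closed nonempty])

lemma anchor_le: "a \<in> A \<Longrightarrow> dist (node j m) (anchor j m) \<le> dist (node j m) a"
  unfolding anchor_def by (rule closest_point_le[OF closed])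

lemma near_if_close:
  assumes "x \<in> slab j m" "a \<in> A" "dist x a \<le> e j"
  shows "near j m"
proof -
  have "dist (node j m) (anchor j m) \<le> dist (node j m) x + dist x a"
    using anchor_le[OF assms(2), of j m] dist_triangle[of "node j m" a x] by linarith
  then show ?thesis
    using dist_node_le[OF assms(1)] assms(3) unfolding near_def by (simp add: dist_commute algebra_simps)
qed

lemma dist_near_anchor:
  assumes "x \<in> slab j m" "near j m"
  shows "dist x (anchor j m) \<le> real (4 * CARD('n) + 1) * e j"
  using dist_triangle[of x "anchor j m" "node j m"] dist_node_le[OF assms(1)] assms(2)
  unfolding near_def by (simp add: algebra_simps)

lemma dist_anchor:
  assumes "x \<in> slab j m" "a \<in> A" "dist x a \<le> real (4 * CARD('n) + 1) * e j"
  shows "dist x (anchor j m) \<le> real (8 * CARD('n) + 1) * e j"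
proof -
  have "dist x (anchor j m) \<le> dist x (node j m) + (dist (node j m) x + dist x a)"
    using dist_triangle[of x "anchor j m" "node j m"] anchor_le[OF assms(2), of j m]
      dist_triangle[of "node j m" a x] by linarith
  then show ?thesis
    using dist_node_le[OF assms(1)] assms(3) by (simp add: dist_commute algebra_simps)
qed

definition box_size :: "real \<Rightarrow> nat \<Rightarrow> nat" where
  "box_size R j = nat \<lceil>R / e j\<rceil> + 2"

definition box :: "real \<Rightarrow> nat \<Rightarrow> ('n \<Rightarrow> int) set" where
  "box R j = PiE UNIV (\<lambda>_. {- int (box_size R j)..int (box_size R j)})"

lemma finite_box: "finite (box R j)"
  unfolding box_def by (intro finite_PiE) auto

lemma coord_bound:
  assumes "norm (x :: real^'n) < R"
  shows "- R < x $ i" "x $ i < R"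
  using component_le_norm_cart[of x i] assms by auto

lemma box_size_ge: "0 \<le> R \<Longrightarrow> R + 2 * e j \<le> real (box_size R j) * e j"
proof -
  assume "0 \<le> R"
  have "R / e j \<le> real (nat \<lceil>R / e j\<rceil>)"
    by (rule real_nat_ceiling_ge)
  then have "R \<le> real (nat \<lceil>R / e j\<rceil>) * e j"
    using e_pos[of j] by (simp add: pos_divide_le_eq)
  then show ?thesis
    by (simp add: box_size_def algebra_simps)
qed

lemma slab_imp_box:
  assumes "norm x < R" "x \<in> slab j m"
  shows "m \<in> box R j"
proof -
  have R: "0 \<le> R"
    using assms(1) norm_ge_zero[of x] by linarith
  have "m i \<in> {- int (box_size R j)..int (box_size R j)}" for i
  proof -
    have m: "of_int (m i) * e j \<le> x $ i" "x $ i \<le> of_int (m i) * e j + 2 * e j"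
      using assms(2) by (auto simp: slab_def algebra_simps)
    have "of_int (m i) * e j \<le> real (box_size R j) * e j"
      using m(1) coord_bound(2)[OF assms(1), of i] box_size_ge[OF R, of j] e_pos[of j] by linarith
    moreover have "- real (box_size R j) * e j \<le> of_int (m i) * e j"
      using m(2) coord_bound(1)[OF assms(1), of i] box_size_ge[OF R, of j] by linarith
    ultimately have "of_int (m i) \<le> real (box_size R j)" "- real (box_size R j) \<le> of_int (m i)"
      using e_pos[of j] mult_le_cancel_right_pos[of "e j"] by blast+
    then show ?thesis by auto
  qed
  then show ?thesis
    by (auto simp: box_def PiE_def)
qed

text \<open>The crude count of all cells that meet a ball is affordable, as a negative power of the mesh is absorbed by the gain.\<close>

lemma card_box_le:
  assumes "0 \<le> R" "e k \<le> e j"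
  shows "real (card (box R j)) \<le> (2 * R + 7 * e 0) ^ CARD('n) * (1 / e k) ^ CARD('n)"
proof -
  have "card {- int (box_size R j)..int (box_size R j)} = 2 * box_size R j + 1"
    by simp
  then have "card (box R j) = (2 * box_size R j + 1) ^ CARD('n)"
    by (simp only: box_def card_PiE finite_class.finite_UNIV prod_constant)
  moreover have "real (2 * box_size R j + 1) \<le> (2 * R + 7 * e 0) * (1 / e k)"
  proof -
    have "real (nat \<lceil>R / e j\<rceil>) \<le> R / e j + 1"
      using assms(1) e_pos[of j] by (simp add: of_nat_ceiling)
    then have "real (2 * box_size R j + 1) \<le> 2 * (R / e j) + 7 * 1"
      by (simp add: box_size_def)
    also have "\<dots> \<le> 2 * (R / e k) + 7 * (e 0 / e k)"
      using assms e_pos[of j] e_pos[of k] e_antimono[of 0 k]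
      by (intro add_mono mult_left_mono frac_le) auto
    also have "\<dots> = (2 * R + 7 * e 0) * (1 / e k)"
      by (simp add: add_divide_distrib)
    finally show ?thesis .
  qed
  ultimately show ?thesis
    by (simp only: of_nat_power power_mult_distrib[symmetric]) (intro power_mono, auto)
qed

lemma sum_cell_eq_1:
  assumes "norm x < R"
  shows "(\<Sum>m\<in>box R j. cell j m x) = 1"
proof -
  have R: "0 \<le> R"
    using assms norm_ge_zero[of x] by linarith
  let ?N = "box_size R j"
  have "(\<Sum>m\<in>box R j. cell j m x) = (\<Prod>i\<in>UNIV. \<Sum>k\<in>{- int ?N..int ?N}. cut j k 0 (x $ i))"
    unfolding box_def cell_def by (rule prod_sum_PiE[symmetric]) auto
  also have "\<dots> = (\<Prod>i\<in>(UNIV :: 'n set). 1)"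
  proof (rule prod.cong)
    fix i :: 'n
    have "(\<Sum>k\<in>{- int ?N..int ?N}. cut j k 0 (x $ i)) =
        H j 0 (x $ i - of_int (- int ?N) * e j) - H j 0 (x $ i - of_int (int ?N + 1) * e j)"
      unfolding cut_def by (rule sum_int_telescope)
    also have "H j 0 (x $ i - of_int (- int ?N) * e j) = 1"
      using box_size_ge[OF R, of j] coord_bound[OF assms, of i] e_pos[of j] by (intro H_1) simp
    also have "H j 0 (x $ i - of_int (int ?N + 1) * e j) = 0"
      using box_size_ge[OF R, of j] coord_bound[OF assms, of i] e_pos[of j] by (intro H_0) (simp add: algebra_simps)
    finally show "(\<Sum>k\<in>{- int ?N..int ?N}. cut j k 0 (x $ i)) = 1" by simp
  qed simp
  finally show ?thesis by simp
qed

lemma sum_active_cells: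
  assumes "norm x < R"
  shows "(\<Sum>m | cell j m x \<noteq> 0 \<and> P m. cell j m x * f m) = (\<Sum>m\<in>{m \<in> box R j. P m}. cell j m x * f m)"
proof (rule sum.mono_neutral_left)
  show "{m. cell j m x \<noteq> 0 \<and> P m} \<subseteq> {m \<in> box R j. P m}"
    using cell_eq_0 slab_imp_box[OF assms] by blast
qed (use finite_box in auto)

lemma sum_all_cells:
  "norm x < R \<Longrightarrow> (\<Sum>m | cell j m x \<noteq> 0. cell j m x * f m) = (\<Sum>m\<in>box R j. cell j m x * f m)"
  using sum_active_cells[where P = "\<lambda>_. True"] by simp

end

section \<open>The extension operator and its derivatives\<close>

context whitney_scheme
begin

text \<open>The sums extend over the finitely many cells that do not vanish at \<open>x\<close>.\<close>

definition patch :: "'n jet \<Rightarrow> nat \<Rightarrow> real^'n \<Rightarrow> real" where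
  "patch F j x = (\<Sum>m | cell j m x \<noteq> 0. cell j m x * taylor (q j) F (anchor j m) x)"

fun layer :: "'n jet \<Rightarrow> nat \<Rightarrow> real^'n \<Rightarrow> real" where
  "layer F 0 x = (\<Sum>m | cell 0 m x \<noteq> 0 \<and> near 0 m. cell 0 m x * taylor (q 0) F (anchor 0 m) x)"
| "layer F (Suc j) x = (\<Sum>m | cell (Suc j) m x \<noteq> 0 \<and> near (Suc j) m.
     cell (Suc j) m x * (taylor (q (Suc j)) F (anchor (Suc j) m) x - patch F j x))"

definition extension :: "'n jet \<Rightarrow> real^'n \<Rightarrow> real" where
  "extension F x = (\<Sum>j. layer F j x)"

text \<open>The compact part of \<open>A\<close> on which the extension inside the ball of radius \<open>R\<close> depends.\<close>

definition near_part :: "real \<Rightarrow> (real^'n) set" where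
  "near_part R = A \<inter> cball 0 (R + real (8 * CARD('n) + 1) * e 0)"

definition rate :: "nat \<Rightarrow> real" where
  "rate j = (1 / e (Suc j)) ^ (2 * CARD('n)) * b j ^ (CARD('n) + 1) * b (Suc j) ^ CARD('n) *
      s j * \<delta> j * exp (real (CARD('n) + 2) * (s j * (real (8 * CARD('n) + 1) * e j)))"

definition growth_base :: real where
  "growth_base = 2 * (CARD('n) * L) + 4"

lemma patch_box:
  "norm x < R \<Longrightarrow> patch F j x = (\<Sum>m\<in>box R j. cell j m x * taylor (q j) F (anchor j m) x)"
  unfolding patch_def by (rule sum_all_cells)

lemma layer_0_box:
  "norm x < R \<Longrightarrow> layer F 0 x = (\<Sum>m\<in>{m \<in> box R 0. near 0 m}. cell 0 m x * taylor (q 0) F (anchor 0 m) x)"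
  by (simp add: sum_active_cells)

lemma layer_Suc_box:
  assumes x: "norm x < R"
  shows "layer F (Suc j) x = (\<Sum>m\<in>{m \<in> box R (Suc j). near (Suc j) m}. \<Sum>m'\<in>box R j.
    cell (Suc j) m x * (cell j m' x * (taylor (q (Suc j)) F (anchor (Suc j) m) x - taylor (q j) F (anchor j m') x)))"
proof -
  have "T - patch F j x = (\<Sum>m'\<in>box R j. cell j m' x * (T - taylor (q j) F (anchor j m') x))" for T
  proof -
    have "(\<Sum>m'\<in>box R j. cell j m' x * T) = T"
      using sum_cell_eq_1[OF x, of j] by (simp add: sum_distrib_right[symmetric])
    then show ?thesis
      by (simp add: patch_box[OF x] right_diff_distrib sum_subtractf)
  qed
  then show ?thesis
    unfolding layer.simps by (subst sum_active_cells[OF x]) (simp add: sum_distrib_left)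
qed

lemma smooth_taylor_diff: "smooth_on UNIV (\<lambda>x. taylor k' F a x - taylor k F a' x)"
  using smooth_on_add[OF open_UNIV smooth_on_taylor smooth_on_cmult[OF open_UNIV smooth_on_taylor, of "-1"]]
  by simp

lemma open_norm_ball: "open {x :: real^'n. norm x < R}"
proof -
  have "{x :: real^'n. norm x < R} = ball 0 R"
    by auto
  then show ?thesis by simp
qed

lemma smooth_layer: "smooth_on {x. norm x < R} (layer F j)"
proof (cases j)
  case 0
  have "smooth_on {x. norm x < R} (\<lambda>x. \<Sum>m\<in>{m \<in> box R 0. near 0 m}. cell 0 m x * taylor (q 0) F (anchor 0 m) x)"
    using finite_box smooth_on_subset[OF smooth_cell]
    by (intro smooth_on_sum smooth_on_mult open_norm_ball smooth_on_taylor) auto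
  then show ?thesis
    unfolding 0 by (rule smooth_on_cong_open[OF open_norm_ball, rotated]) (simp only: mem_Collect_eq layer_0_box)
next
  case (Suc i)
  have "smooth_on {x. norm x < R} (\<lambda>x. \<Sum>m\<in>{m \<in> box R (Suc i). near (Suc i) m}. \<Sum>m'\<in>box R i.
    cell (Suc i) m x * (cell i m' x * (taylor (q (Suc i)) F (anchor (Suc i) m) x - taylor (q i) F (anchor i m') x)))"
    using finite_box smooth_on_subset[OF smooth_cell] smooth_on_subset[OF smooth_taylor_diff]
    by (intro smooth_on_sum smooth_on_mult open_norm_ball) auto
  then show ?thesis
    unfolding Suc by (rule smooth_on_cong_open[OF open_norm_ball, rotated]) (simp only: mem_Collect_eq layer_Suc_box)
qed

lemma anchor_near_part:
  assumes "norm x < R" "dist x (anchor j m) \<le> real (8 * CARD('n) + 1) * e j"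
  shows "anchor j m \<in> near_part R"
proof -
  have "real (8 * CARD('n) + 1) * e j \<le> real (8 * CARD('n) + 1) * e 0"
    by (intro mult_left_mono e_antimono) auto
  moreover have "norm (anchor j m) \<le> norm x + dist x (anchor j m)"
    using norm_triangle_ineq4[of x "x - anchor j m"] by (simp add: dist_norm)
  ultimately have "norm (anchor j m) \<le> R + real (8 * CARD('n) + 1) * e 0"
    using assms by linarith
  then show ?thesis
    using anchor_in by (simp add: near_part_def)
qed

lemma growth_base_ge: "0 \<le> growth_base" "CARD('n) * L \<le> growth_base" "CARD('n) * L + 4 \<le> growth_base" "4 \<le> growth_base"
  using L_nonneg by (auto simp: growth_base_def)

lemma growth_at_weaken:
  fixes x :: "real^'n"
  assumes "growth_at M x C l f" "C \<le> C'" "0 \<le> l" "l \<le> l'" "0 \<le> C"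
  shows "growth_at M x C' l' f"
  unfolding growth_at_def
proof
  fix "is" :: "'n list"
  have "\<bar>partials is f x\<bar> \<le> C * l ^ length is * M (length is)"
    using assms by (simp add: growth_at_def)
  also have "\<dots> \<le> C' * l' ^ length is * M (length is)"
    using assms M_pos by (intro mult_right_mono mult_mono power_mono) (auto simp: less_imp_le)
  finally show "\<bar>partials is f x\<bar> \<le> C' * l' ^ length is * M (length is)" .
qed

text \<open>The gain in terms of \<open>M\<close>: a derivative of order \<open>l\<close> costs \<open>s j ^ l\<close>, which is traded for \<open>M l\<close> and one more
factor \<open>b j\<close>.\<close>

lemma growth_taylor_diff:
  fixes x :: "real^'n"
  assumes F: "jet_bounded K N B F" and ab: "a \<in> K" "a' \<in> K"
    and r: "norm (x - a) \<le> real (8 * CARD('n) + 1) * e j" "norm (x - a') \<le> real (8 * CARD('n) + 1) * e j"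
    and N: "\<And>p. k \<le> p \<Longrightarrow> p \<le> k' \<Longrightarrow> N p \<le> C * \<delta> j * s j ^ Suc p" and k: "k \<le> k'" and nonneg: "0 \<le> B" "0 \<le> C"
  shows "growth_at M x (2 * B * C * \<delta> j * s j * b j * exp (real (CARD('n) + 2) * (s j * (real (8 * CARD('n) + 1) * e j)))) 4
    (\<lambda>x. taylor k' F a x - taylor k F a' x)"
  unfolding growth_at_def
proof
  fix "is" :: "'n list"
  let ?E = "exp (real (CARD('n) + 2) * (s j * (real (8 * CARD('n) + 1) * e j)))"
  have Q: "0 \<le> 2 * B * (C * \<delta> j) * s j * ?E"
    using nonneg \<delta>_pos[of j] s_pos[of j] by simp
  have "\<bar>partials is (\<lambda>x. taylor k' F a x - taylor k F a' x) x\<bar> \<le>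
      2 * B * (C * \<delta> j) * s j ^ Suc (length is) * ?E"
    by (rule partials_taylor_diff_le[OF F ab r N k]) (use nonneg \<delta>_pos[of j] s_pos[of j] in auto)
  also have "\<dots> = (2 * B * (C * \<delta> j) * s j * ?E) * s j ^ length is"
    by simp
  also have "\<dots> \<le> (2 * B * (C * \<delta> j) * s j * ?E) * (4 ^ length is * M (length is) * b j)"
    by (rule mult_left_mono[OF s_power Q])
  finally show "\<bar>partials is (\<lambda>x. taylor k' F a x - taylor k F a' x) x\<bar> \<le>
      2 * B * C * \<delta> j * s j * b j * ?E * 4 ^ length is * M (length is)"
    by (simp only: mult_ac)
qed

text \<open>A bound for \<open>f\<close> is only needed inside the slab, that is where anchors are close.\<close>

lemma growth_cell_mult:
  fixes x :: "real^'n"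
  assumes "smooth_on UNIV f" "x \<in> slab j m \<Longrightarrow> growth_at M x C l f" "0 \<le> C" "0 \<le> l"
  shows "growth_at M x ((2 * b j) ^ CARD('n) * C) (CARD('n) * L + l) (\<lambda>x. cell j m x * f x)"
proof (cases "x \<in> slab j m")
  case True
  show ?thesis
    by (rule growth_at_mult[OF open_UNIV smooth_cell assms(1) UNIV_I M_mult _ cell_growth assms(2)[OF True]])
      (use assms b_nonneg[of j] L_nonneg M_pos in \<open>auto simp: less_imp_le\<close>)
next
  case False
  have "partials is (\<lambda>x. cell j m x * f x) x = 0" for "is"
    by (rule partials_mult_eq_0[OF open_UNIV smooth_cell assms(1) UNIV_I])
      (use partials_cell_eq_0[OF False] in blast)
  moreover have "0 \<le> (2 * b j) ^ CARD('n) * C * (CARD('n) * L + l) ^ k * M k" for k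
    using assms b_nonneg[of j] L_nonneg M_pos[of k] by (intro mult_nonneg_nonneg) auto
  ultimately show ?thesis
    by (simp add: growth_at_def)
qed

lemma growth_at_sum:
  fixes x :: "real^'n"
  assumes "open S" "x \<in> S" "finite I" "\<And>i. i \<in> I \<Longrightarrow> smooth_on S (f i)"
    and "\<And>i. i \<in> I \<Longrightarrow> growth_at M x C l (f i)"
  shows "growth_at M x (real (card I) * C) l (\<lambda>x. \<Sum>i\<in>I. f i x)"
  unfolding growth_at_def
proof
  fix "is" :: "'n list"
  have "\<bar>\<Sum>i\<in>I. partials is (f i) x\<bar> \<le> (\<Sum>i\<in>I. C * l ^ length is * M (length is))"
    using assms(5) by (intro order.trans[OF sum_abs] sum_mono) (auto simp: growth_at_def)
  then show "\<bar>partials is (\<lambda>x. \<Sum>i\<in>I. f i x) x\<bar> \<le> real (card I) * C * l ^ length is * M (length is)"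
    by (simp add: partials_sum[OF assms(1,3,4,2)] mult.assoc)
qed

lemma growth_at_cong:
  fixes x :: "real^'n"
  assumes "open S" "x \<in> S" "\<And>y. y \<in> S \<Longrightarrow> f y = g y" "growth_at M x C l f"
  shows "growth_at M x C l g"
  using assms(4) partials_cong_open[OF assms(1,3,2)] by (simp add: growth_at_def)

definition box_const :: "real \<Rightarrow> real" where
  "box_const R = ((2 * R + 7 * e 0) ^ CARD('n)) ^ 2"

lemma rate_arith:
  fixes R :: real and j :: nat
  defines "c \<equiv> (2 * R + 7 * e 0) ^ CARD('n) * (1 / e (Suc j)) ^ CARD('n)"
  shows "c * (c * ((2 * b (Suc j)) ^ CARD('n) * ((2 * b j) ^ CARD('n) * (2 * B * C * \<delta> j * s j * b j *
      exp (real (CARD('n) + 2) * (s j * (real (8 * CARD('n) + 1) * e j))))))) =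
    2 * 4 ^ CARD('n) * box_const R * B * C * rate j"
proof -
  have "(4::real) ^ CARD('n) = 2 ^ CARD('n) * 2 ^ CARD('n)"
    by (simp add: power_mult_distrib[symmetric])
  moreover have "(1 / e (Suc j)) ^ (2 * CARD('n)) = (1 / e (Suc j)) ^ CARD('n) * (1 / e (Suc j)) ^ CARD('n)"
    by (simp only: mult_2 power_add)
  ultimately show ?thesis
    unfolding rate_def box_const_def c_def
    by (simp only: power_mult_distrib power_add power_one_right power2_eq_square mult_ac)
qed

text \<open>Each pair of cells of scales \<open>Suc j\<close> and \<open>j\<close> contributes a difference of two Taylor polynomials. Where both cells
live, the first is near \<open>A\<close>, and therefore both anchors are within the distance for which the gain is computed.\<close>

lemma growth_layer_Suc:
  assumes x: "norm x < R" and F: "jet_bounded (near_part R) N B F" and N: "admissible q s \<delta> N C" and B: "0 \<le> B"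
  shows "growth_at M x (2 * 4 ^ CARD('n) * box_const R * B * C * rate j) growth_base (layer F (Suc j))"
proof -
  define E where "E = exp (real (CARD('n) + 2) * (s j * (real (8 * CARD('n) + 1) * e j)))"
  define D where "D = 2 * B * C * \<delta> j * s j * b j * E"
  have C: "0 \<le> C"
    using N by (simp add: admissible_def)
  have R: "0 \<le> R"
    using x norm_ge_zero[of x] by linarith
  have D: "0 \<le> D"
    using B C \<delta>_pos[of j] s_pos[of j] b_nonneg[of j] by (simp add: D_def E_def)
  let ?T = "\<lambda>m m' x. taylor (q (Suc j)) F (anchor (Suc j) m) x - taylor (q j) F (anchor j m') x"
  have T: "growth_at M x ((2 * b (Suc j)) ^ CARD('n) * ((2 * b j) ^ CARD('n) * D)) (CARD('n) * L + (CARD('n) * L + 4))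
      (\<lambda>x. cell (Suc j) m x * (cell j m' x * ?T m m' x))" if near: "near (Suc j) m" for m m'
  proof (rule growth_cell_mult)
    show "smooth_on UNIV (\<lambda>x. cell j m' x * ?T m m' x)"
      by (intro smooth_on_mult open_UNIV smooth_cell smooth_taylor_diff)
    assume slab: "x \<in> slab (Suc j) m"
    show "growth_at M x ((2 * b j) ^ CARD('n) * D) (CARD('n) * L + 4) (\<lambda>x. cell j m' x * ?T m m' x)"
    proof (rule growth_cell_mult[OF smooth_taylor_diff])
      assume slab': "x \<in> slab j m'"
      have 1: "dist x (anchor (Suc j) m) \<le> real (4 * CARD('n) + 1) * e j"
      proof -
        have "real (4 * CARD('n) + 1) * e (Suc j) \<le> real (4 * CARD('n) + 1) * e j"
          by (intro mult_left_mono e_Suc) auto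
        with dist_near_anchor[OF slab near] show ?thesis
          by linarith
      qed
      then have 2: "dist x (anchor j m') \<le> real (8 * CARD('n) + 1) * e j"
        by (rule dist_anchor[OF slab' anchor_in])
      have "real (4 * CARD('n) + 1) * e (Suc j) \<le> real (8 * CARD('n) + 1) * e (Suc j)"
        using e_pos[of "Suc j"] by (intro mult_right_mono) auto
      with dist_near_anchor[OF slab near] have 3: "dist x (anchor (Suc j) m) \<le> real (8 * CARD('n) + 1) * e (Suc j)"
        by linarith
      have "real (4 * CARD('n) + 1) * e j \<le> real (8 * CARD('n) + 1) * e j"
        using e_pos[of j] by (intro mult_right_mono) auto
      with 1 have 4: "dist x (anchor (Suc j) m) \<le> real (8 * CARD('n) + 1) * e j"
        by linarith
      show "growth_at M x D 4 (?T m m')"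
        unfolding D_def E_def
        by (rule growth_taylor_diff[OF F anchor_near_part[OF x 3] anchor_near_part[OF x 2] 4[unfolded dist_norm] 2[unfolded dist_norm]])
          (use N B C q_Suc in \<open>auto simp: admissible_def\<close>)
    qed (use D in auto)
  qed (use D b_nonneg[of j] L_nonneg in auto)
  define G where "G = (2 * b (Suc j)) ^ CARD('n) * ((2 * b j) ^ CARD('n) * D)"
  have G: "0 \<le> G"
    using D b_nonneg[of j] b_nonneg[of "Suc j"] by (simp add: G_def)
  have growth_base: "CARD('n) * L + (CARD('n) * L + 4) = growth_base"
    by (simp add: growth_base_def)
  let ?I = "{m \<in> box R (Suc j). near (Suc j) m}"
  have "growth_at M x (real (card ?I) * (real (card (box R j)) * G)) growth_base
     (\<lambda>x. \<Sum>m\<in>?I. \<Sum>m'\<in>box R j. cell (Suc j) m x * (cell j m' x * ?T m m' x))"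
    using T unfolding growth_base G_def[symmetric]
    by (intro growth_at_sum[OF open_UNIV UNIV_I] smooth_on_sum smooth_on_mult smooth_cell smooth_taylor_diff open_UNIV)
      (auto simp: finite_box)
  then have "growth_at M x (real (card ?I) * (real (card (box R j)) * G)) growth_base (layer F (Suc j))"
    by (rule growth_at_cong[OF open_norm_ball[of R], rotated 2]) (use x in \<open>simp_all only: mem_Collect_eq layer_Suc_box\<close>)
  then show ?thesis
  proof (rule growth_at_weaken)
    let ?c = "(2 * R + 7 * e 0) ^ CARD('n) * (1 / e (Suc j)) ^ CARD('n)"
    have "real (card ?I) \<le> ?c"
      using card_box_le[OF R, of "Suc j" "Suc j"] card_mono[OF finite_box, of ?I R "Suc j"] by fastforce
    moreover have "real (card (box R j)) \<le> ?c"
      by (rule card_box_le[OF R e_Suc])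
    moreover have c: "0 \<le> ?c"
      using R e_pos[of 0] e_pos[of "Suc j"] by simp
    ultimately have "real (card ?I) * (real (card (box R j)) * G) \<le> ?c * (?c * G)"
      using G by (intro mult_mono) auto
    also have "\<dots> = 2 * 4 ^ CARD('n) * box_const R * B * C * rate j"
      unfolding G_def D_def E_def by (rule rate_arith)
    finally show "real (card ?I) * (real (card (box R j)) * G) \<le> 2 * 4 ^ CARD('n) * box_const R * B * C * rate j" .
  qed (use G growth_base_ge in auto)
qed

end

lemma taylor_centre:
  fixes F :: "'n::finite jet"
  assumes "0 < k"
  shows "taylor k F a a = F (\<lambda>_. 0) a"
proof -
  have "mono_term (0 :: real^'n) (\<lambda>_. 0) = 1"
    by (simp add: mono_term_altdef)
  moreover have "mono_term (0 :: real^'n) c = 0" if "c \<noteq> (\<lambda>_. 0)" for c :: "'n mindex"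
  proof -
    obtain i where "c i \<noteq> 0"
      using \<open>c \<noteq> (\<lambda>_. 0)\<close> by auto
    then show ?thesis
      unfolding mono_term_altdef by (intro prod_zero bexI[of _ i]) auto
  qed
  then have "taylor k F a a = (\<Sum>c\<in>{\<lambda>_. 0}. mono_term 0 c * F c a)"
    unfolding taylor_def using assms
    by (intro sum.mono_neutral_cong_right finite_mlen_less) (auto simp: mlen_def)
  ultimately show ?thesis
    by simp
qed

lemma taylor_add: "taylor k (F + G) a x = taylor k F a x + taylor k G a x"
  by (simp add: taylor_def distrib_left sum.distrib)

lemma taylor_scaleR: "taylor k (c *\<^sub>R F) a x = c * taylor k F a x"
  by (simp add: taylor_def scaleR_fun_def sum_distrib_left mult_ac)

lemma taylor_cong: "(\<And>c. F c a = G c a) \<Longrightarrow> taylor k F a x = taylor k G a x"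
  by (simp add: taylor_def)

context whitney_scheme
begin

text \<open>The first layer has no predecessor to be compared with and gets a constant of its own.\<close>

definition layer_const :: "real \<Rightarrow> nat \<Rightarrow> real" where
  "layer_const R j = (case j of
     0 \<Rightarrow> real (card (box R 0)) * ((2 * b 0) ^ CARD('n) * (2 * \<delta> 0 * s 0 * b 0 *
            exp (real (CARD('n) + 2) * (s 0 * (real (8 * CARD('n) + 1) * e 0)))))
   | Suc i \<Rightarrow> 2 * 4 ^ CARD('n) * box_const R * rate i)"

lemma growth_layer_0:
  assumes x: "norm x < R" and F: "jet_bounded (near_part R) N B F" and N: "admissible q s \<delta> N C" and B: "0 \<le> B"
  shows "growth_at M x (layer_const R 0 * B * C) growth_base (layer F 0)"
proof -
  define D where "D = 2 * B * C * \<delta> 0 * s 0 * b 0 * exp (real (CARD('n) + 2) * (s 0 * (real (8 * CARD('n) + 1) * e 0)))"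
  have C: "0 \<le> C"
    using N by (simp add: admissible_def)
  have D: "0 \<le> D"
    using B C \<delta>_pos[of 0] s_pos[of 0] b_nonneg[of 0] by (simp add: D_def)
  have T: "growth_at M x ((2 * b 0) ^ CARD('n) * D) (CARD('n) * L + 4)
      (\<lambda>x. cell 0 m x * taylor (q 0) F (anchor 0 m) x)" if near: "near 0 m" for m
  proof (rule growth_cell_mult[OF smooth_on_taylor[OF open_UNIV]])
    assume slab: "x \<in> slab 0 m"
    have "real (4 * CARD('n) + 1) * e 0 \<le> real (8 * CARD('n) + 1) * e 0"
      using e_pos[of 0] by (intro mult_right_mono) auto
    with dist_near_anchor[OF slab near] have d: "dist x (anchor 0 m) \<le> real (8 * CARD('n) + 1) * e 0"
      by linarith
    have "growth_at M x D 4 (\<lambda>x. taylor (q 0) F (anchor 0 m) x - taylor 0 F (anchor 0 m) x)"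
      unfolding D_def
      by (rule growth_taylor_diff[OF F anchor_near_part[OF x d] anchor_near_part[OF x d] d[unfolded dist_norm] d[unfolded dist_norm]])
        (use N B C q_Suc[of 0] in \<open>auto simp: admissible_def\<close>)
    moreover have "taylor 0 F (anchor 0 m) y = 0" for y
      by (simp add: taylor_def)
    ultimately show "growth_at M x D 4 (taylor (q 0) F (anchor 0 m))"
      by simp
  qed (use D in auto)
  let ?I = "{m \<in> box R 0. near 0 m}"
  have "growth_at M x (real (card ?I) * ((2 * b 0) ^ CARD('n) * D)) (CARD('n) * L + 4)
     (\<lambda>x. \<Sum>m\<in>?I. cell 0 m x * taylor (q 0) F (anchor 0 m) x)"
    using T by (intro growth_at_sum[OF open_UNIV UNIV_I] smooth_on_mult smooth_cell smooth_on_taylor open_UNIV)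
      (auto simp: finite_box)
  then have "growth_at M x (real (card ?I) * ((2 * b 0) ^ CARD('n) * D)) (CARD('n) * L + 4) (layer F 0)"
    by (rule growth_at_cong[OF open_norm_ball[of R], rotated 2]) (use x in \<open>simp_all only: mem_Collect_eq layer_0_box\<close>)
  then show ?thesis
  proof (rule growth_at_weaken)
    have "real (card ?I) \<le> real (card (box R 0))"
      using card_mono[OF finite_box, of ?I R 0] by auto
    then have "real (card ?I) * ((2 * b 0) ^ CARD('n) * D) \<le> real (card (box R 0)) * ((2 * b 0) ^ CARD('n) * D)"
      using D b_nonneg[of 0] by (intro mult_right_mono) auto
    also have "\<dots> = layer_const R 0 * B * C"
      by (simp add: layer_const_def D_def)
    finally show "real (card ?I) * ((2 * b 0) ^ CARD('n) * D) \<le> layer_const R 0 * B * C" .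
  qed (use D b_nonneg[of 0] L_nonneg growth_base_ge in auto)
qed

lemma growth_layer:
  assumes "norm x < R" "jet_bounded (near_part R) N B F" "admissible q s \<delta> N C" "0 \<le> B"
  shows "growth_at M x (layer_const R j * B * C) growth_base (layer F j)"
proof (cases j)
  case 0
  then show ?thesis
    using growth_layer_0[OF assms] by simp
next
  case (Suc i)
  have "2 * 4 ^ CARD('n) * box_const R * B * C * rate i = layer_const R j * B * C"
    by (simp add: layer_const_def Suc)
  then show ?thesis
    using growth_layer_Suc[OF assms, of i] unfolding Suc by (simp only:)
qed

lemma summable_layer_const: "summable (layer_const R)"
proof -
  have "summable (\<lambda>i. 2 * 4 ^ CARD('n) * box_const R * rate i)"
    unfolding rate_def by (intro summable_mult summable_scale)
  then have "summable (\<lambda>i. layer_const R (Suc i))"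
    by (simp add: layer_const_def)
  then show ?thesis
    by (simp only: summable_Suc_iff)
qed

lemma summable_layer_bound: "summable (\<lambda>j. layer_const R j * B * C * growth_base ^ k * M k)"
  by (intro summable_mult2 summable_layer_const)

text \<open>All derivatives of the layers are dominated by one convergent series, on \<open>A\<close> and off \<open>A\<close> alike.\<close>

lemma
  assumes F: "jet_bounded (near_part R) N B F" "admissible q s \<delta> N C" "0 \<le> B"
  shows smooth_extension: "smooth_on {x. norm x < R} (extension F)"
    and partials_extension: "norm x < R \<Longrightarrow> partials is (extension F) x = (\<Sum>j. partials is (layer F j) x)"
    and summable_partials_layer: "norm x < R \<Longrightarrow> summable (\<lambda>j. partials is (layer F j) x)"
    and growth_extension: "norm x < R \<Longrightarrow> growth_at M x (suminf (layer_const R) * B * C) growth_base (extension F)"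
proof -
  have bound: "\<bar>partials is (layer F j) x\<bar> \<le> layer_const R j * B * C * growth_base ^ length is * M (length is)"
    if "x \<in> {x. norm x < R}" for "is" j x
    using growth_layer[OF _ F, of x j] that by (simp add: growth_at_def)
  have ext: "extension F = (\<lambda>x. \<Sum>j. layer F j x)"
    by (simp add: extension_def fun_eq_iff)
  show "smooth_on {x. norm x < R} (extension F)"
    unfolding ext by (rule smooth_on_suminf[OF open_norm_ball smooth_layer summable_layer_bound bound])
  show eq: "partials is (extension F) x = (\<Sum>j. partials is (layer F j) x)" if "norm x < R" for "is" x
    unfolding ext by (rule partials_suminf[OF open_norm_ball smooth_layer summable_layer_bound bound]) (use that in auto)
  show "summable (\<lambda>j. partials is (layer F j) x)" if "norm x < R" for "is" x
    by (rule summable_comparison_test'[OF summable_layer_bound, of 0]) (use bound that in auto)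
  show "growth_at M x (suminf (layer_const R) * B * C) growth_base (extension F)" if x: "norm x < R"
    unfolding growth_at_def
  proof
    fix "is" :: "'n list"
    let ?K = "B * C * growth_base ^ length is * M (length is)"
    have "norm (\<Sum>j. partials is (layer F j) x) \<le> (\<Sum>j. layer_const R j * B * C * growth_base ^ length is * M (length is))"
      by (rule norm_suminf_le[OF _ summable_layer_bound]) (use bound x in auto)
    also have "\<dots> = (\<Sum>j. layer_const R j * ?K)"
      by (simp add: mult.assoc)
    also have "\<dots> = suminf (layer_const R) * ?K"
      by (rule suminf_mult2[symmetric]) (rule summable_layer_const)
    finally show "\<bar>partials is (extension F) x\<bar> \<le> suminf (layer_const R) * B * C * growth_base ^ length is * M (length is)"
      by (simp add: eq[OF x] mult.assoc)
  qed
qed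

text \<open>A cell that does not vanish at \<open>x\<close> is anchored in \<open>near_part R\<close>, provided that it enters the layer.\<close>

lemma extension_cong:
  assumes x: "norm x < R" and FG: "\<And>a c. a \<in> near_part R \<Longrightarrow> F c a = G c a"
  shows "extension F x = extension G x"
proof -
  have close: "dist x (anchor j m) \<le> real (8 * CARD('n) + 1) * e j" if "x \<in> slab j m" "near j m" for j m
  proof -
    have "real (4 * CARD('n) + 1) * e j \<le> real (8 * CARD('n) + 1) * e j"
      using e_pos[of j] by (intro mult_right_mono) auto
    with dist_near_anchor[OF that] show ?thesis
      by linarith
  qed
  have tay: "taylor k F (anchor j m) y = taylor k G (anchor j m) y"
    if "dist x (anchor j m) \<le> real (8 * CARD('n) + 1) * e j" for j m k y
    using FG[OF anchor_near_part[OF x that]] by (rule taylor_cong)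
  have "layer F j x = layer G j x" for j
  proof (cases j)
    case 0
    show ?thesis
      unfolding 0 layer.simps using cell_eq_0 close tay by (intro sum.cong refl) (metis (mono_tags, lifting) mem_Collect_eq)
  next
    case (Suc i)
    have "taylor (q (Suc i)) F (anchor (Suc i) m) x - patch F i x = taylor (q (Suc i)) G (anchor (Suc i) m) x - patch G i x"
      if "cell (Suc i) m x \<noteq> 0" "near (Suc i) m" for m
    proof -
      have slab: "x \<in> slab (Suc i) m"
        using cell_eq_0 that by blast
      have d: "dist x (anchor (Suc i) m) \<le> real (4 * CARD('n) + 1) * e i"
      proof -
        have "real (4 * CARD('n) + 1) * e (Suc i) \<le> real (4 * CARD('n) + 1) * e i"
          by (intro mult_left_mono e_Suc) auto
        with dist_near_anchor[OF slab that(2)] show ?thesis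
          by linarith
      qed
      have "taylor (q i) F (anchor i m') x = taylor (q i) G (anchor i m') x" if "cell i m' x \<noteq> 0" for m'
        using dist_anchor[OF _ anchor_in d] cell_eq_0 that by (intro tay) blast
      then have "patch F i x = patch G i x"
        unfolding patch_def by (intro sum.cong) auto
      then show ?thesis
        using tay[OF close[OF slab that(2)]] by simp
    qed
    then show ?thesis
      unfolding Suc layer.simps by (intro sum.cong) auto
  qed
  then show ?thesis
    by (simp add: extension_def)
qed

lemma patch_add: "patch (F + G) j x = patch F j x + patch G j x"
  by (simp add: patch_def taylor_add distrib_left sum.distrib)

lemma patch_scaleR: "patch (c *\<^sub>R F) j x = c * patch F j x"
  by (simp add: patch_def taylor_scaleR sum_distrib_left mult_ac)

lemma layer_add: "layer (F + G) j x = layer F j x + layer G j x"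
  by (cases j) (simp_all add: taylor_add patch_add sum.distrib[symmetric] algebra_simps)

lemma layer_scaleR: "layer (c *\<^sub>R F) j x = c * layer F j x"
  by (cases j) (simp_all add: taylor_scaleR patch_scaleR sum_distrib_left algebra_simps)

lemma extension_add:
  assumes "summable (\<lambda>j. layer F j x)" "summable (\<lambda>j. layer G j x)"
  shows "extension (F + G) x = extension F x + extension G x"
  unfolding extension_def layer_add by (rule suminf_add[symmetric, OF assms])

lemma extension_scaleR:
  assumes "summable (\<lambda>j. layer F j x)"
  shows "extension (c *\<^sub>R F) x = c * extension F x"
  unfolding extension_def layer_scaleR by (rule suminf_mult[OF assms])

lemma summable_layer:
  assumes "norm x < R" "jet_bounded (near_part R) N B F" "admissible q s \<delta> N C" "0 \<le> B"
  shows "summable (\<lambda>j. layer F j x)"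
  using summable_partials_layer[OF assms(2-4,1), of "[]"] by simp

text \<open>Close to \<open>A\<close> every active cell is near \<open>A\<close>, so the localisation disappears and the layers telescope.\<close>

lemma sum_layers_close:
  assumes x: "norm x < R" and a: "a \<in> A" "dist x a \<le> e J"
  shows "(\<Sum>j\<le>J. layer F j x) = patch F J x"
  using a(2)
proof (induction J)
  case 0
  have "{m. cell 0 m x \<noteq> 0 \<and> near 0 m} = {m. cell 0 m x \<noteq> 0}"
    using near_if_close[OF _ a(1) 0] cell_eq_0 by blast
  then show ?case
    by (simp add: patch_def)
next
  case (Suc J)
  have "{m. cell (Suc J) m x \<noteq> 0 \<and> near (Suc J) m} = {m. cell (Suc J) m x \<noteq> 0}"
    using near_if_close[OF _ a(1) Suc.prems] cell_eq_0 by blast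
  then have "layer F (Suc J) x = (\<Sum>m | cell (Suc J) m x \<noteq> 0. cell (Suc J) m x * taylor (q (Suc J)) F (anchor (Suc J) m) x)
      - (\<Sum>m | cell (Suc J) m x \<noteq> 0. cell (Suc J) m x * patch F J x)"
    by (simp add: right_diff_distrib sum_subtractf)
  also have "(\<Sum>m | cell (Suc J) m x \<noteq> 0. cell (Suc J) m x * patch F J x) = patch F J x"
    using sum_cell_eq_1[OF x, of "Suc J"] unfolding sum_all_cells[OF x] by (simp add: sum_distrib_right[symmetric])
  finally have "layer F (Suc J) x = patch F (Suc J) x - patch F J x"
    by (simp add: patch_def)
  moreover have "(\<Sum>j\<le>J. layer F j x) = patch F J x"
    using Suc.IH Suc.prems e_Suc[of J] by simp
  ultimately show ?case
    by (simp del: layer.simps)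
qed

text \<open>At a point \<open>a\<close> of \<open>A\<close> the partial sums of the layers agree with the patches. A patch differs from the
Taylor polynomial of \<open>F\<close> at \<open>a\<close> by differences of Taylor polynomials with anchors close to \<open>a\<close>, which are bounded like
a layer and thus tend to zero, and the Taylor polynomial has the right derivative at \<open>a\<close> as soon as its degree is
large enough.\<close>

lemma partials_extension_at:
  assumes F: "jet_bounded (near_part R) N B F" "admissible q s \<delta> N C" "0 \<le> B"
    and a: "a \<in> A" "norm a < R"
  shows "partials is (extension F) a = F (count_list is) a"
proof -
  define S where "S = {x :: real^'n. norm x < R}"
  have S: "open S" "a \<in> S"
    using open_norm_ball a by (auto simp: S_def)
  have R: "0 \<le> R"
    using a(2) norm_ge_zero[of a] by linarith
  have C: "0 \<le> C"
    using F(2) by (simp add: admissible_def)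
  have aK: "a \<in> near_part R"
    using a e_pos[of 0] by (simp add: near_part_def add_increasing2)
  define K where "K = 2 * 4 ^ CARD('n) * box_const R * B * C * growth_base ^ length is * M (length is)"
  have main: "\<bar>(\<Sum>j\<le>J. partials is (layer F j) a) - F (count_list is) a\<bar> \<le> K * rate J" if J: "length is < q J" for J
  proof -
    let ?T = "\<lambda>m x. taylor (q J) F (anchor J m) x - taylor (q J) F a x"
    let ?f = "\<lambda>x. \<Sum>m\<in>box R J. cell J m x * ?T m x"
    define D where "D = 2 * B * C * \<delta> J * s J * b J * exp (real (CARD('n) + 2) * (s J * (real (8 * CARD('n) + 1) * e J)))"
    have D: "0 \<le> D"
      using F(3) C \<delta>_pos[of J] s_pos[of J] b_nonneg[of J] by (simp add: D_def)
    have "(\<Sum>j\<le>J. partials is (layer F j) a) = partials is (\<lambda>x. \<Sum>j\<le>J. layer F j x) a"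
      using partials_sum[OF S(1) _ _ S(2), of "{..J}" "layer F"] smooth_layer by (simp add: S_def)
    also have "\<dots> = partials is (\<lambda>x. ?f x + taylor (q J) F a x) a"
    proof (rule partials_cong_open[of "S \<inter> ball a (e J)"])
      show "a \<in> S \<inter> ball a (e J)"
        using S e_pos[of J] by simp
      fix y assume y: "y \<in> S \<inter> ball a (e J)"
      then have ny: "norm y < R"
        by (simp add: S_def)
      have "?f y = patch F J y - (\<Sum>m\<in>box R J. cell J m y) * taylor (q J) F a y"
        by (simp add: patch_box[OF ny] right_diff_distrib sum_subtractf sum_distrib_right)
      then show "(\<Sum>j\<le>J. layer F j y) = ?f y + taylor (q J) F a y"
        using sum_layers_close[OF ny a(1), of J F] y sum_cell_eq_1[OF ny] by (simp add: dist_commute)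
    qed (use S in auto)
    also have "\<dots> = partials is ?f a + partials is (taylor (q J) F a) a"
      by (rule partials_add[OF open_UNIV _ smooth_on_taylor[OF open_UNIV] UNIV_I])
        (intro smooth_on_sum smooth_on_mult smooth_cell smooth_taylor_diff open_UNIV finite_box)
    also have "partials is (taylor (q J) F a) a = F (count_list is) a"
      using J by (simp add: partials_taylor[OF open_UNIV] taylor_centre jet_shift_def)
    finally have eq: "(\<Sum>j\<le>J. partials is (layer F j) a) - F (count_list is) a = partials is ?f a"
      by simp
    have T: "growth_at M a ((2 * b J) ^ CARD('n) * D) (CARD('n) * L + 4) (\<lambda>x. cell J m x * ?T m x)" for m
    proof (rule growth_cell_mult[OF smooth_taylor_diff])
      assume slab: "a \<in> slab J m"
      have d: "dist a (anchor J m) \<le> real (8 * CARD('n) + 1) * e J"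
        using e_pos[of J] by (intro dist_anchor[OF slab a(1)]) simp
      show "growth_at M a D 4 (?T m)"
        unfolding D_def
        by (rule growth_taylor_diff[OF F(1) anchor_near_part[OF a(2) d] aK d[unfolded dist_norm]])
          (use F C q_Suc[of J] e_pos[of J] in \<open>auto simp: admissible_def\<close>)
    qed (use D in auto)
    have "growth_at M a (real (card (box R J)) * ((2 * b J) ^ CARD('n) * D)) (CARD('n) * L + 4) ?f"
      by (rule growth_at_sum[OF open_UNIV UNIV_I finite_box _ T])
        (intro smooth_on_mult smooth_cell smooth_taylor_diff open_UNIV)
    then have "growth_at M a (2 * 4 ^ CARD('n) * box_const R * B * C * rate J) growth_base ?f"
    proof (rule growth_at_weaken)
      let ?c = "(2 * R + 7 * e 0) ^ CARD('n) * (1 / e (Suc J)) ^ CARD('n)"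
      define G where "G = (2 * b J) ^ CARD('n) * D"
      have G: "0 \<le> G"
        using D b_nonneg[of J] by (simp add: G_def)
      have c: "real (card (box R J)) \<le> ?c"
        by (rule card_box_le[OF R e_Suc])
      have c1: "1 \<le> ?c"
      proof -
        have "1 \<le> (2 * R + 7 * e 0) * (1 / e (Suc J))"
          using R e_pos[of "Suc J"] e_antimono[of 0 "Suc J"] by (simp add: pos_le_divide_eq)
        then show ?thesis
          unfolding power_mult_distrib[symmetric] by (rule one_le_power)
      qed
      have b1: "1 \<le> (2 * b (Suc J)) ^ CARD('n)"
        using b_ge_1[of "Suc J"] by (intro one_le_power) simp
      have "1 * G \<le> (2 * b (Suc J)) ^ CARD('n) * G"
        using b1 G by (rule mult_right_mono)
      also have "\<dots> \<le> ?c * ((2 * b (Suc J)) ^ CARD('n) * G)"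
        using mult_right_mono[OF c1, of "(2 * b (Suc J)) ^ CARD('n) * G"] G b1 by simp
      finally have "real (card (box R J)) * G \<le> ?c * (?c * ((2 * b (Suc J)) ^ CARD('n) * G))"
        using c G c1 by (intro mult_mono) auto
      also have "\<dots> = 2 * 4 ^ CARD('n) * box_const R * B * C * rate J"
        unfolding G_def D_def by (rule rate_arith)
      finally show "real (card (box R J)) * ((2 * b J) ^ CARD('n) * D) \<le> 2 * 4 ^ CARD('n) * box_const R * B * C * rate J"
        by (simp only: G_def)
    qed (use D b_nonneg[of J] L_nonneg growth_base_ge in auto)
    then have "\<bar>partials is ?f a\<bar> \<le> 2 * 4 ^ CARD('n) * box_const R * B * C * rate J * growth_base ^ length is * M (length is)"
      by (simp add: growth_at_def)
    then show ?thesis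
      unfolding eq K_def by (simp only: mult_ac)
  qed
  have "(\<lambda>J. \<Sum>j\<le>J. partials is (layer F j) a) \<longlonglongrightarrow> F (count_list is) a"
  proof (rule LIM_zero_cancel, rule Lim_null_comparison)
    have "\<forall>\<^sub>F J in sequentially. length is < q J"
    proof (rule eventually_mono)
      show "\<forall>\<^sub>F J in sequentially. Suc (length is) \<le> q J"
        using q_lim unfolding filterlim_at_top by blast
    qed simp
    then show "\<forall>\<^sub>F J in sequentially. norm ((\<Sum>j\<le>J. partials is (layer F j) a) - F (count_list is) a) \<le> K * rate J"
      by eventually_elim (use main in simp)
    have "rate \<longlonglongrightarrow> 0"
      unfolding rate_def by (rule summable_LIMSEQ_zero[OF summable_scale])
    then show "(\<lambda>J. K * rate J) \<longlonglongrightarrow> 0"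
      using tendsto_mult_right_zero by blast
  qed
  moreover have "(\<lambda>J. \<Sum>j\<le>J. partials is (layer F j) a) \<longlonglongrightarrow> (\<Sum>j. partials is (layer F j) a)"
    by (rule summable_LIMSEQ'[OF summable_partials_layer[OF F a(2)]])
  ultimately show ?thesis
    using partials_extension[OF F a(2)] LIMSEQ_unique by metis
qed

end

section \<open>Scales for a strong pair\<close>

text \<open>The scales are \<open>t = 2 ^ j\<close> and \<open>e j = 2 * J t\<close> with the tail integral \<open>J\<close> of the boosted weight \<open>w\<close>. From one scale to the
next \<open>t * J t\<close> at most doubles, so that the cost at both scales of a layer, and the exponential of \<open>s j * e j\<close>, are
bounded by the exponential of a multiple of \<open>t * J t\<close>. The gain \<open>exp (- S t)\<close> beats this and also the powers of
\<open>t\<close> that come from counting cells.\<close>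

lemma whitney_scheme_exists:
  fixes A :: "(real^'n::finite) set"
  assumes \<omega>: "weight_function \<omega>" and \<sigma>: "weight_function \<sigma>" and \<tau>: "weight_function \<tau>"
    and dom: "dominates \<tau> \<sigma>" and strong: "strong_pair r \<omega> \<sigma>" and r: "r < 1"
    and A: "closed A" "A \<noteq> {}"
  obtains M L e b s \<delta> q H where "whitney_scheme A M L e b s \<delta> q H"
    "\<And>k \<Lambda>. 1 \<le> k \<Longrightarrow> 0 \<le> \<Lambda> \<Longrightarrow> \<exists>C. \<forall>l. \<Lambda> ^ l * M l * weight_factor \<omega> (1 / real k) l \<le> C"
    "\<And>m. 1 \<le> m \<Longrightarrow> \<exists>C. admissible q s \<delta> (\<lambda>p. 1 / weight_factor \<tau> (real m) p) C"
proof -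
  obtain w S where w: "mono w" "\<And>t. 0 \<le> w t" "dominates w \<omega>"
    and fin: "\<And>t. 1 \<le> t \<Longrightarrow> tail_integral w t < \<infinity>"
    and S_dom: "\<And>N. \<exists>C. \<forall>t\<ge>1. N * (t * enn2real (tail_integral w t)) + N * ln t \<le> S t + C"
    and S: "dominates \<tau> S" "convex_on UNIV (\<lambda>t. S (exp t))" "\<And>t u. 1 \<le> t \<Longrightarrow> t \<le> u \<Longrightarrow> S t \<le> S u"
    using boosted_weight[OF \<omega> \<sigma> \<tau> dom strong r] by metis
  define J where "J = (\<lambda>t. enn2real (tail_integral w t))"
  have J_eq: "tail_integral w t = ennreal (J t)" if "1 \<le> t" for t
    using fin[OF that] by (simp add: J_def)
  have J_nonneg: "0 \<le> J t" for t
    by (simp add: J_def)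
  have w_ln: "dominates w ln"
    by (rule dominates_trans[OF w(3) weight_dominates_ln[OF \<omega>]])
  have J_ge: "w t / t \<le> J t" if "1 \<le> t" for t
    using tail_integral_ge[OF w(1,2), of t] that by (simp add: J_eq J_nonneg)
  have J_antimono: "J u \<le> J t" if "1 \<le> t" "t \<le> u" for t u
    using tail_integral_antimono[OF that(2), of w] that by (simp add: J_eq J_nonneg)
  have J_double: "J t \<le> 2 * J (2 * t)" if "1 \<le> t" for t
  proof -
    have "ennreal (J t) \<le> ennreal (2 * J (2 * t))"
      using tail_integral_double[OF w(1,2), of t] that by (simp add: J_eq ennreal_mult J_nonneg)
    then show ?thesis
      using J_nonneg by simp
  qed
  have J_pos: "0 < J t" if t: "1 \<le> t" for t
  proof -
    obtain C where C: "0 \<le> C" "\<And>t. 1 \<le> t \<Longrightarrow> 1 * ln t \<le> w t + C"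
      using dominatesD[OF w_ln, of 1] by metis
    define u where "u = max t (exp (C + 1))"
    have u: "t \<le> u" "1 \<le> u"
      using t by (auto simp: u_def)
    have "C + 1 \<le> ln u"
      using u by (simp add: ln_ge_iff u_def)
    then have "0 < w u / u"
      using C(2)[OF u(2)] u by simp
    then show ?thesis
      using J_ge[OF u(2)] J_antimono[OF t u(1)] by linarith
  qed
  have S_ln: "dominates S ln"
    unfolding dominates_def
  proof
    fix N :: real
    obtain C where C: "\<And>t. 1 \<le> t \<Longrightarrow> \<bar>N\<bar> * (t * J t) + \<bar>N\<bar> * ln t \<le> S t + C"
      using S_dom[of "\<bar>N\<bar>"] by (auto simp: J_def)
    have "N * ln t \<le> S t + C" if t: "1 \<le> t" for t
    proof -
      have "N * ln t \<le> \<bar>N\<bar> * ln t"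
        using t by (intro mult_right_mono) auto
      moreover have "0 \<le> \<bar>N\<bar> * (t * J t)"
        using t J_nonneg by simp
      ultimately show ?thesis
        using C[OF t] by linarith
    qed
    then show "\<exists>C. \<forall>t\<ge>1. N * ln t \<le> S t + C" by blast
  qed
  have pow1: "(1::real) \<le> 2 ^ j" for j
    by simp
  define e where "e = (\<lambda>j::nat. 2 * J (2 ^ j))"
  define b where "b = (\<lambda>j::nat. exp (w (2 ^ j)))"
  define s where "s = (\<lambda>j::nat. 4 * 2 ^ j :: real)"
  define \<delta> where "\<delta> = (\<lambda>j::nat. exp (- S (2 ^ j)))"
  define q where "q = (\<lambda>j. nat \<lfloor>secant_slope S j\<rfloor>)"
  define M where "M = conj_seq w"
  define L :: real where "L = 4 * exp 1"
  have "\<exists>D. (\<forall>l x. (D l has_real_derivative D (Suc l) x) (at x)) \<and> (\<forall>x\<le>0. D 0 x = 0) \<and>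
      (\<forall>x\<ge>e j. D 0 x = 1) \<and> (\<forall>l x. \<bar>D l x\<bar> \<le> b j * L ^ l * M l)" for j
    using conj_seq_cutoff[OF w(1,2) w_ln pow1 fin[OF pow1] J_pos[OF pow1, unfolded J_def], of j]
    unfolding e_def b_def L_def M_def J_def by metis
  then obtain H where H: "\<And>j l x. (H j l has_real_derivative H j (Suc l) x) (at x)" "\<And>j x. x \<le> 0 \<Longrightarrow> H j 0 x = 0"
    "\<And>j x. e j \<le> x \<Longrightarrow> H j 0 x = 1" "\<And>j l x. \<bar>H j l x\<bar> \<le> b j * L ^ l * M l"
    by metis
  define \<kappa> where "\<kappa> = (\<lambda>j::nat. 2 ^ j * J (2 ^ j))"
  have \<kappa>_pos: "0 < \<kappa> j" for j
    using J_pos[OF pow1] by (simp add: \<kappa>_def)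
  have \<kappa>_Suc: "\<kappa> j \<le> \<kappa> (Suc j)" "\<kappa> (Suc j) \<le> 2 * \<kappa> j" for j
    using J_double[OF pow1, of j] J_antimono[OF pow1, of j "2 ^ Suc j"] by (simp_all add: \<kappa>_def)
  have \<kappa>_0: "\<kappa> 0 \<le> \<kappa> j" for j
    by (rule lift_Suc_mono_le[of \<kappa>]) (auto intro: \<kappa>_Suc)
  have b_le: "b j \<le> exp (\<kappa> j)" for j
    using J_ge[OF pow1, of j] by (simp add: b_def \<kappa>_def field_simps)
  have summable: "summable (\<lambda>j. (1 / e (Suc j)) ^ (2 * CARD('n)) * b j ^ (CARD('n) + 1) * b (Suc j) ^ CARD('n) *
      s j * \<delta> j * exp (real (CARD('n) + 2) * (s j * (real (8 * CARD('n) + 1) * e j))))"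
  proof -
    define n where "n = CARD('n)"
    \<comment> \<open>The sum of all multiples of \<open>\<kappa> j\<close> and of \<open>ln (2 ^ j)\<close> in the exponent, and one more of the latter for summability.\<close>
    define N where "N = real ((2 * n + 2) + (n + 1) + 2 * n + (n + 2) * (8 * n + 1) * 8)"
    obtain C where C: "\<And>t. 1 \<le> t \<Longrightarrow> N * (t * J t) + N * ln t \<le> S t + C"
      using S_dom[of N] by (auto simp: J_def)
    define K where "K = (1 / \<kappa> 0) ^ (2 * n) * 4 * exp C"
    have "(1 / e (Suc j)) ^ (2 * n) * b j ^ (n + 1) * b (Suc j) ^ n *
      s j * \<delta> j * exp (real (n + 2) * (s j * (real (8 * n + 1) * e j))) \<le> K * (1 / 2) ^ j" (is "?lhs \<le> _") for j
    proof -
      define x where "x = real j * ln 2"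
      have x: "exp x = 2 ^ j" "0 \<le> x"
        by (simp_all add: x_def exp_nat_ln2)
      have e1: "1 / e (Suc j) \<le> 1 / \<kappa> 0 * exp x"
      proof -
        have "1 / e (Suc j) \<le> 1 / J (2 ^ j)"
          using J_double[OF pow1, of j] J_pos[OF pow1] by (intro frac_le) (auto simp: e_def)
        also have "\<dots> = 2 ^ j / \<kappa> j"
          by (simp add: \<kappa>_def)
        also have "\<dots> \<le> 2 ^ j / \<kappa> 0"
          using \<kappa>_0[of j] \<kappa>_pos[of 0] by (intro divide_left_mono) auto
        finally show ?thesis
          by (simp add: x)
      qed
      have "(1 / e (Suc j)) ^ (2 * n) \<le> (1 / \<kappa> 0 * exp x) ^ (2 * n)"
        using e1 J_nonneg by (intro power_mono) (auto simp: e_def)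
      also have "\<dots> = (1 / \<kappa> 0) ^ (2 * n) * exp (real (2 * n) * x)"
        by (simp only: power_mult_distrib exp_of_nat_mult)
      finally have 1: "(1 / e (Suc j)) ^ (2 * n) \<le> (1 / \<kappa> 0) ^ (2 * n) * exp (real (2 * n) * x)" .
      have "b j ^ (n + 1) \<le> exp (\<kappa> j) ^ (n + 1)"
        by (intro power_mono b_le) (simp add: b_def)
      then have 2: "b j ^ (n + 1) \<le> exp (real (n + 1) * \<kappa> j)"
        by (simp only: exp_of_nat_mult)
      have "b (Suc j) \<le> exp (2 * \<kappa> j)"
        using b_le[of "Suc j"] \<kappa>_Suc(2)[of j] by (meson exp_le_cancel_iff order_trans)
      then have "b (Suc j) ^ n \<le> exp (2 * \<kappa> j) ^ n"
        by (intro power_mono) (auto simp: b_def)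
      then have 3: "b (Suc j) ^ n \<le> exp (real n * (2 * \<kappa> j))"
        by (simp only: exp_of_nat_mult)
      have 4: "s j * (real (8 * n + 1) * e j) = real (8 * n + 1) * 8 * \<kappa> j"
        by (simp add: s_def e_def \<kappa>_def)
      have "?lhs \<le> ((1 / \<kappa> 0) ^ (2 * n) * exp (real (2 * n) * x)) * exp (real (n + 1) * \<kappa> j) * exp (real n * (2 * \<kappa> j)) *
          (4 * exp x) * exp (- S (2 ^ j)) * exp (real (n + 2) * (real (8 * n + 1) * 8 * \<kappa> j))"
        unfolding 4 using \<kappa>_pos[of 0] J_nonneg
        by (intro mult_mono 1 2 3) (auto simp: s_def \<delta>_def x(1) b_def e_def)
      also have "\<dots> = (1 / \<kappa> 0) ^ (2 * n) * 4 * exp (real (2 * n) * x + real (n + 1) * \<kappa> j + real n * (2 * \<kappa> j) +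
          x + - S (2 ^ j) + real (n + 2) * (real (8 * n + 1) * 8 * \<kappa> j))"
        by (simp only: exp_add mult_ac)
      also have "\<dots> \<le> (1 / \<kappa> 0) ^ (2 * n) * 4 * exp (C + - x)"
      proof (intro mult_left_mono)
        have "N * \<kappa> j + N * x \<le> S (2 ^ j) + C"
          using C[OF pow1, of j] by (simp add: \<kappa>_def x_def ln_realpow)
        moreover have "(real (n + 1) + 2 * real n + real ((n + 2) * (8 * n + 1) * 8)) * \<kappa> j \<le> N * \<kappa> j"
          using \<kappa>_pos[of j] by (intro mult_right_mono) (auto simp: N_def)
        moreover have "real (2 * n + 2) * x \<le> N * x"
          using x(2) by (intro mult_right_mono) (auto simp: N_def)
        ultimately show "exp (real (2 * n) * x + real (n + 1) * \<kappa> j + real n * (2 * \<kappa> j) +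
          x + - S (2 ^ j) + real (n + 2) * (real (8 * n + 1) * 8 * \<kappa> j)) \<le> exp (C + - x)"
          by (simp add: algebra_simps)
      qed (use \<kappa>_pos[of 0] in auto)
      also have "\<dots> = K * (1 / 2) ^ j"
      proof -
        have "exp (C + - x) = exp C * (1 / 2) ^ j"
          unfolding exp_add exp_minus x(1) by (simp add: power_one_over inverse_eq_divide)
        then show ?thesis
          by (simp add: K_def)
      qed
      finally show ?thesis .
    qed
    moreover have "0 \<le> (1 / e (Suc j)) ^ (2 * n) * b j ^ (n + 1) * b (Suc j) ^ n *
      s j * \<delta> j * exp (real (n + 2) * (s j * (real (8 * n + 1) * e j)))" for j
      using J_nonneg by (simp add: e_def b_def s_def \<delta>_def)
    ultimately have bound: "norm ((1 / e (Suc j)) ^ (2 * n) * b j ^ (n + 1) * b (Suc j) ^ n *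
      s j * \<delta> j * exp (real (n + 2) * (s j * (real (8 * n + 1) * e j)))) \<le> K * (1 / 2) ^ j" for j
      by (simp only: real_norm_def abs_of_nonneg)
    have geometric: "summable (\<lambda>j. K * (1 / 2 :: real) ^ j)"
      by (rule summable_mult, rule summable_geometric) simp
    show ?thesis
      unfolding n_def[symmetric] by (rule summable_comparison_test'[OF geometric, of 0], rule bound)
  qed
  show thesis
  proof (rule that[of M L e b s \<delta> q H])
    show "whitney_scheme A M L e b s \<delta> q H"
    proof
      show "s j ^ l \<le> 4 ^ l * M l * b j" for j l
        using power_le_conj_seq[OF w_ln w(2) pow1, of j l] by (simp add: s_def power_mult_distrib M_def b_def)
      show "q j \<le> q (Suc j)" for j
        unfolding q_def using mono_degree[OF S(2,3), of j "Suc j"] by simp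
      show "filterlim q at_top at_top"
        unfolding q_def by (rule filterlim_degree[OF S(2,3) S_ln])
      show "e (Suc j) \<le> e j" for j
        using J_antimono[OF pow1, of j "2 ^ Suc j"] by (simp add: e_def)
      show "M k * M l \<le> M (k + l)" "0 < M k" "1 \<le> M 0" for k l
        by (simp_all add: M_def conj_seq_mult_le[OF w_ln] conj_seq_pos)
      show "0 < e j" "1 \<le> b j" "0 < s j" "0 < \<delta> j" for j
        using J_pos[OF pow1] w(2) by (simp_all add: e_def b_def s_def \<delta>_def)
    qed (fact A H summable | simp add: L_def)+
    show "\<exists>C. \<forall>l. \<Lambda> ^ l * M l * weight_factor \<omega> (1 / real k) l \<le> C" if "1 \<le> k" "0 \<le> \<Lambda>" for k \<Lambda>
      unfolding M_def using conj_seq_absorb[OF \<omega> w(3) that] by metis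
    show "\<exists>C. admissible q s \<delta> (\<lambda>p. 1 / weight_factor \<tau> (real m) p) C" if m: "1 \<le> m" for m
    proof -
      define N where "N = (\<lambda>p. 1 / weight_factor \<tau> (real m) p)"
      have N_exp: "N p = exp (1 / real m * young_conj \<tau> (real m * real p))" for p
        by (simp add: N_def weight_factor_def exp_minus field_simps)
      obtain C where C: "\<And>t. 1 \<le> t \<Longrightarrow> real m * S t \<le> \<tau> t + C"
        using dominatesD[OF S(1)] by metis
      have young: "young_conj \<tau> (real m * real p) \<le> real m * young_conj S (real p) + C" for p
      proof (rule young_least)
        fix x :: real assume x: "0 \<le> x"
        have "real m * (x * real p - S (exp x)) \<le> real m * young_conj S (real p)"
          by (intro mult_left_mono young_upper[OF S_ln x]) simp
        then show "x * (real m * real p) - \<tau> (exp x) \<le> real m * young_conj S (real p) + C"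
          using C[of "exp x"] x by (simp add: algebra_simps)
      qed
      have N1: "N p \<le> exp (C / real m) * \<delta> j * s j ^ Suc p" if "q j \<le> p" "p \<le> q (Suc j)" for j p
      proof -
        have "1 / real m * young_conj \<tau> (real m * real p) \<le> young_conj S (real p) + C / real m"
          using young[of p] m by (simp add: field_simps)
        also have "\<dots> \<le> real (Suc p) * ln (4 * 2 ^ j) - S (2 ^ j) + C / real m"
          using young_conj_degree[OF S(2,3), of j p] that unfolding q_def by simp
        finally have "N p \<le> exp (C / real m + - S (2 ^ j) + real (Suc p) * ln (4 * 2 ^ j))"
          unfolding N_exp by simp
        also have "\<dots> = exp (C / real m) * \<delta> j * s j ^ Suc p"
          unfolding exp_add exp_of_nat_mult by (simp add: \<delta>_def s_def)
        finally show ?thesis .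
      qed
      \<comment> \<open>The finitely many degrees up to \<open>q 1\<close> at scale \<open>0\<close> only affect the constant.\<close>
      define D where "D = (\<Sum>p\<le>q 1. N p / (\<delta> 0 * s 0 ^ Suc p))"
      have pos: "0 < \<delta> j * s j ^ Suc p" for j p
        by (simp add: \<delta>_def s_def)
      have N0: "0 \<le> N p" for p
        by (simp add: N_exp)
      have D: "0 \<le> D"
        unfolding D_def using N0 pos by (intro sum_nonneg divide_nonneg_nonneg) (auto intro: less_imp_le)
      have N2: "N p \<le> D * \<delta> 0 * s 0 ^ Suc p" if "p \<le> q 1" for p
      proof -
        have "N p / (\<delta> 0 * s 0 ^ Suc p) \<le> D"
          unfolding D_def using that N0 pos
          by (intro member_le_sum) (auto intro!: divide_nonneg_nonneg intro: less_imp_le)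
        then show ?thesis
          using pos[of 0 p] by (simp add: pos_divide_le_eq mult.assoc)
      qed
      have "admissible q s \<delta> N (exp (C / real m) + D)"
        unfolding admissible_def
      proof (intro conjI allI impI)
        fix j p assume "q j \<le> p \<or> j = 0" "p \<le> q (Suc j)"
        then consider "N p \<le> exp (C / real m) * (\<delta> j * s j ^ Suc p)" | "N p \<le> D * (\<delta> j * s j ^ Suc p)"
          using N1[of j p] N2[of p] by (auto simp: mult.assoc)
        then have "N p \<le> exp (C / real m) * (\<delta> j * s j ^ Suc p) + D * (\<delta> j * s j ^ Suc p)"
        proof cases
          case 1
          moreover have "0 \<le> D * (\<delta> j * s j ^ Suc p)"
            by (rule mult_nonneg_nonneg[OF D less_imp_le[OF pos]])
          ultimately show ?thesis by linarith
        next
          case 2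
          moreover have "0 \<le> exp (C / real m) * (\<delta> j * s j ^ Suc p)"
            by (rule mult_nonneg_nonneg[OF exp_ge_zero less_imp_le[OF pos]])
          ultimately show ?thesis by linarith
        qed
        then show "N p \<le> (exp (C / real m) + D) * \<delta> j * s j ^ Suc p"
          by (simp only: distrib_right mult.assoc)
      qed (use D in simp)
      then show ?thesis
        unfolding N_def by blast
    qed
  qed
qed

section \<open>Norms of jets and of functions\<close>

lemma ex_list_with_counts:
  fixes a :: "'n::finite \<Rightarrow> nat"
  shows "\<exists>is. \<forall>i. count_list is i = a i"
proof -
  have "\<exists>is. \<forall>i. count_list is i = (if i \<in> S then a i else 0)" if "finite S" for S :: "'n set"
    using that
  proof (induction S rule: finite_induct)
    case empty
    show ?case by (intro exI[of _ "[]"]) simp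
  next
    case (insert j S)
    then obtain "is" where "is": "\<forall>i. count_list is i = (if i \<in> S then a i else 0)" by blast
    have rep: "count_list (replicate k j) i = (if i = j then k else 0)" for k i
      by (induction k) auto
    have "\<forall>i. count_list (replicate (a j) j @ is) i = (if i \<in> insert j S then a i else 0)"
      using "is" insert.hyps by (auto simp: rep)
    then show ?case by blast
  qed
  from this[of UNIV] show ?thesis by simp
qed

text \<open>The order of differentiation chosen in the definition of \<open>mderiv\<close> is immaterial in what follows: all bounds
and formulas hold for every list of directions with the given counts.\<close>

lemma mderiv_eq_partials:
  fixes a :: "'n::finite mindex"
  obtains "is" where "count_list is = a" "length is = mlen a" "\<And>f. mderiv a f = partials is f"
proof -
  define js where "js = (SOME is. \<forall>i. count_list is i = a i)"
  have "\<forall>i. count_list js i = a i"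
    unfolding js_def by (rule someI_ex) (rule ex_list_with_counts)
  then have 1: "count_list js = a"
    by auto
  moreover have "length js = mlen a"
    using mlen_count_list[of js] by (simp add: 1)
  moreover have "mderiv a f = partials js f" for f
    by (simp add: mderiv_def js_def)
  ultimately show thesis
    by (rule that)
qed

lemma weight_factor_pos: "0 < weight_factor w \<rho> k"
  by (simp add: weight_factor_def)

lemma jet_remainder_same:
  fixes F :: "'n::finite jet"
  assumes "mlen a \<le> p"
  shows "jet_remainder p F x a x = 0"
proof -
  have "{c :: 'n mindex. mlen c \<le> p - mlen a} = {c. mlen c < Suc (p - mlen a)}"
    by auto
  then have "jet_remainder p F x a x = F a x - taylor (Suc (p - mlen a)) (jet_shift a F) x x"
    by (simp add: jet_remainder_def taylor_def mono_term_def jet_shift_def)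
  then show ?thesis
    by (simp add: taylor_centre jet_shift_def)
qed

lemma jet_norm_imp_bounded:
  fixes F :: "'n::finite jet"
  assumes fin: "jet_norm \<tau> K m F < \<infinity>"
  shows "jet_bounded K (\<lambda>p. 1 / weight_factor \<tau> m p) (enn2real (jet_norm \<tau> K m F)) F"
proof -
  define B where "B = enn2real (jet_norm \<tau> K m F)"
  have B: "jet_norm \<tau> K m F = ennreal B" "0 \<le> B"
    using fin by (simp_all add: B_def)
  have 1: "\<bar>F a x\<bar> * weight_factor \<tau> m (mlen a) \<le> B" if "x \<in> K" for a x
  proof -
    have "ennreal (\<bar>F a x\<bar> * weight_factor \<tau> m (mlen a)) \<le> jet_norm1 \<tau> K m F"
      unfolding jet_norm1_def using that by (intro SUP_upper2[of x] SUP_upper2[of a]) auto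
    also have "\<dots> \<le> ennreal B"
      unfolding B(1)[symmetric] jet_norm_def by simp
    finally show ?thesis
      using B(2) by simp
  qed
  have 2: "\<bar>jet_remainder p F x a y\<bar> * fact (p + 1 - mlen a) / norm (x - y) ^ (p + 1 - mlen a) * weight_factor \<tau> m (p + 1) \<le> B"
    if "x \<in> K" "y \<in> K" "x \<noteq> y" "mlen a \<le> p" for x y p a
  proof -
    have "ennreal (\<bar>jet_remainder p F x a y\<bar> * fact (p + 1 - mlen a) / norm (x - y) ^ (p + 1 - mlen a) * weight_factor \<tau> m (p + 1)) \<le> jet_norm2 \<tau> K m F"
      unfolding jet_norm2_def using that by (intro SUP_upper2[of x] SUP_upper2[of y] SUP_upper2[of p] SUP_upper2[of a]) auto
    also have "\<dots> \<le> ennreal B"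
      unfolding B(1)[symmetric] jet_norm_def by simp
    finally show ?thesis
      using B(2) by simp
  qed
  show ?thesis
    unfolding jet_bounded_def B_def[symmetric]
  proof (intro conjI ballI allI impI)
    show "\<bar>F a x\<bar> \<le> B * (1 / weight_factor \<tau> m (mlen a))" if "x \<in> K" for x a
      using 1[OF that, of a] weight_factor_pos[of \<tau> m "mlen a"] by (simp add: field_simps)
    show "\<bar>jet_remainder p F x a y\<bar> \<le> B * (1 / weight_factor \<tau> m (p + 1)) * norm (x - y) ^ (p + 1 - mlen a) / fact (p + 1 - mlen a)"
      if "x \<in> K" "y \<in> K" "mlen a \<le> p" for x y p a
    proof (cases "x = y")
      case True
      then show ?thesis
        using B(2) weight_factor_pos[of \<tau> m "p + 1"] jet_remainder_same[OF that(3)] by simp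
    next
      case False
      define d where "d = norm (x - y) ^ (p + 1 - mlen a)"
      have d: "0 < d"
        using False unfolding d_def by (intro zero_less_power) auto
      have "\<bar>jet_remainder p F x a y\<bar> * fact (p + 1 - mlen a) / d * weight_factor \<tau> m (p + 1) \<le> B"
        unfolding d_def by (rule 2[OF that(1,2) False that(3)])
      then show ?thesis
        unfolding d_def[symmetric] using d weight_factor_pos[of \<tau> m "p + 1"]
        by (simp add: field_simps)
    qed
  qed
qed

text \<open>Together with the converse above, this transfers the triangle inequality to the norm without computing with suprema in
the extended reals.\<close>

lemma bounded_imp_jet_norm:
  fixes F :: "'n::finite jet"
  assumes F: "jet_bounded K (\<lambda>p. 1 / weight_factor \<tau> m p) B F"
  shows "jet_norm \<tau> K m F < \<infinity>"
proof -
  have "jet_norm1 \<tau> K m F \<le> ennreal B"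
    unfolding jet_norm1_def
  proof (intro SUP_least ennreal_leI)
    fix x and a :: "'n mindex" assume "x \<in> K"
    then have "\<bar>F a x\<bar> \<le> B * (1 / weight_factor \<tau> m (mlen a))"
      using F by (simp add: jet_bounded_def)
    then show "\<bar>F a x\<bar> * weight_factor \<tau> m (mlen a) \<le> B"
      using weight_factor_pos[of \<tau> m "mlen a"] by (simp add: field_simps)
  qed
  moreover have "jet_norm2 \<tau> K m F \<le> ennreal B"
    unfolding jet_norm2_def
  proof (intro SUP_least ennreal_leI)
    fix x y p and a :: "'n mindex" assume xy: "x \<in> K" "y \<in> K - {x}" "a \<in> {a. mlen a \<le> p}"
    define d where "d = norm (x - y) ^ (p + 1 - mlen a)"
    have d: "0 < d"
      using xy unfolding d_def by (intro zero_less_power) auto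
    have "\<bar>jet_remainder p F x a y\<bar> \<le> B * (1 / weight_factor \<tau> m (p + 1)) * d / fact (p + 1 - mlen a)"
      unfolding d_def using F xy unfolding jet_bounded_def by blast
    then show "\<bar>jet_remainder p F x a y\<bar> * fact (p + 1 - mlen a) / norm (x - y) ^ (p + 1 - mlen a) * weight_factor \<tau> m (p + 1) \<le> B"
      unfolding d_def[symmetric] using d weight_factor_pos[of \<tau> m "p + 1"]
      by (simp add: field_simps)
  qed
  ultimately have "jet_norm \<tau> K m F \<le> ennreal B + ennreal B"
    unfolding jet_norm_def by (rule add_mono)
  also have "\<dots> < \<infinity>"
    by simp
  finally show ?thesis .
qed

lemma jet_remainder_diff: "jet_remainder p (F - G) x a y = jet_remainder p F x a y - jet_remainder p G x a y"
  by (simp add: jet_remainder_def right_diff_distrib sum_subtractf)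

lemma jet_bounded_diff:
  assumes "jet_bounded K N B F" "jet_bounded K N B' G"
  shows "jet_bounded K N (B + B') (F - G)"
  unfolding jet_bounded_def
proof (intro conjI ballI allI impI)
  fix x a assume "x \<in> K"
  then have "\<bar>F a x\<bar> \<le> B * N (mlen a)" "\<bar>G a x\<bar> \<le> B' * N (mlen a)"
    using assms by (auto simp: jet_bounded_def)
  then show "\<bar>(F - G) a x\<bar> \<le> (B + B') * N (mlen a)"
    by (simp add: distrib_right)
next
  fix x y p and a :: "'a mindex" assume "x \<in> K" "y \<in> K" "mlen a \<le> p"
  then have "\<bar>jet_remainder p F x a y\<bar> \<le> B * N (p + 1) * norm (x - y) ^ (p + 1 - mlen a) / fact (p + 1 - mlen a)"
    "\<bar>jet_remainder p G x a y\<bar> \<le> B' * N (p + 1) * norm (x - y) ^ (p + 1 - mlen a) / fact (p + 1 - mlen a)"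
    using assms unfolding jet_bounded_def by blast+
  then show "\<bar>jet_remainder p (F - G) x a y\<bar> \<le> (B + B') * N (p + 1) * norm (x - y) ^ (p + 1 - mlen a) / fact (p + 1 - mlen a)"
    unfolding jet_remainder_diff distrib_right add_divide_distrib by linarith
qed

lemma jet_norm_diff_finite:
  assumes "jet_norm \<tau> K m F < \<infinity>" "jet_norm \<tau> K m G < \<infinity>"
  shows "jet_norm \<tau> K m (F - G) < \<infinity>"
  by (rule bounded_imp_jet_norm[OF jet_bounded_diff[OF jet_norm_imp_bounded[OF assms(1)] jet_norm_imp_bounded[OF assms(2)]]])

lemma jet_norm_subset: "K \<subseteq> K' \<Longrightarrow> jet_norm \<tau> K m F \<le> jet_norm \<tau> K' m F"
  unfolding jet_norm_def jet_norm1_def jet_norm2_def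
  by (intro add_mono SUP_subset_mono) auto

lemma jet_remainder_restrict:
  "x \<in> K \<Longrightarrow> y \<in> K \<Longrightarrow> jet_remainder p (jet_restrict K F) x a y = jet_remainder p F x a y"
  by (simp add: jet_remainder_def jet_restrict_def)

lemma jet_norm_restrict: "K \<subseteq> K' \<Longrightarrow> jet_norm \<tau> K m (jet_restrict K' F) = jet_norm \<tau> K m F"
proof -
  assume K: "K \<subseteq> K'"
  have "jet_norm1 \<tau> K m (jet_restrict K' F) = jet_norm1 \<tau> K m F"
    unfolding jet_norm1_def using K by (intro SUP_cong refl) (auto simp: jet_restrict_def)
  moreover have "jet_norm2 \<tau> K m (jet_restrict K' F) = jet_norm2 \<tau> K m F"
    unfolding jet_norm2_def using K by (intro SUP_cong refl) (auto simp: jet_remainder_restrict subset_iff)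
  ultimately show ?thesis
    by (simp add: jet_norm_def)
qed

lemma restrict_ultrajets:
  fixes F :: "'n::finite jet"
  assumes F: "F \<in> ultrajets \<tau> A" and K: "K \<subseteq> A"
  shows "jet_restrict K F \<in> ultrajets \<tau> K"
proof -
  have W: "F \<in> whitney_jets A"
    using F by (simp add: ultrajets_def)
  have "jet_restrict K F \<in> whitney_jets K"
    unfolding whitney_jets_def
  proof (intro CollectI conjI allI impI)
    show "continuous_on K (jet_restrict K F a)" for a
    proof -
      have "continuous_on K (F a)"
        using W K by (auto simp: whitney_jets_def intro: continuous_on_subset)
      then show ?thesis
        by (rule continuous_on_eq) (simp add: jet_restrict_def)
    qed
    show "jet_restrict K F a x = 0" if "x \<notin> K" for a x
      using that by (simp add: jet_restrict_def)
    fix K' p and a :: "'n mindex" and \<epsilon> :: real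
    assume K': "compact K' \<and> K' \<subseteq> K \<and> mlen a \<le> p" and "0 < \<epsilon>"
    then have "compact K' \<and> K' \<subseteq> A \<and> mlen a \<le> p"
      using K by auto
    from W[unfolded whitney_jets_def mem_Collect_eq, THEN conjunct2, THEN conjunct2, rule_format, OF this \<open>0 < \<epsilon>\<close>]
    obtain d where d: "d > 0" "\<forall>x\<in>K'. \<forall>y\<in>K'. norm (y - x) < d \<longrightarrow>
        \<bar>jet_remainder p F x a y\<bar> \<le> \<epsilon> * norm (y - x) ^ (p - mlen a)"
      by blast
    have "\<forall>x\<in>K'. \<forall>y\<in>K'. norm (y - x) < d \<longrightarrow>
        \<bar>jet_remainder p (jet_restrict K F) x a y\<bar> \<le> \<epsilon> * norm (y - x) ^ (p - mlen a)"
      using d(2) K' by (auto simp: jet_remainder_restrict subset_iff)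
    then show "\<exists>d>0. \<forall>x\<in>K'. \<forall>y\<in>K'. norm (y - x) < d \<longrightarrow>
        \<bar>jet_remainder p (jet_restrict K F) x a y\<bar> \<le> \<epsilon> * norm (y - x) ^ (p - mlen a)"
      using d(1) by blast
  qed
  moreover have "\<exists>m::nat. 1 \<le> m \<and> jet_norm \<tau> K' (real m) (jet_restrict K F) < \<infinity>" if "compact K'" "K' \<subseteq> K" for K'
  proof -
    have "\<forall>K. compact K \<and> K \<subseteq> A \<longrightarrow> (\<exists>m::nat. 1 \<le> m \<and> jet_norm \<tau> K (real m) F < \<infinity>)"
      using F by (simp add: ultrajets_def)
    then show ?thesis
      using that K jet_norm_restrict[OF that(2), of \<tau> _ F] by (metis order_trans)
  qed
  ultimately show ?thesis
    by (simp add: ultrajets_def)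
qed

lemma fun_norm_leI:
  assumes "\<And>x a. x \<in> U \<Longrightarrow> \<bar>mderiv a f x\<bar> * weight_factor w \<rho> (mlen a) \<le> C"
  shows "fun_norm w U \<rho> f \<le> ennreal C"
  unfolding fun_norm_def by (intro SUP_least ennreal_leI assms)

lemma fun_norm_triangle:
  fixes f g h :: "real^'n::finite \<Rightarrow> real"
  assumes "\<And>x a. x \<in> U \<Longrightarrow> \<bar>mderiv a h x\<bar> \<le> \<bar>mderiv a f x\<bar> + \<bar>mderiv a g x\<bar>"
  shows "fun_norm w U \<rho> h \<le> fun_norm w U \<rho> f + fun_norm w U \<rho> g"
  unfolding fun_norm_def[of _ _ _ h]
proof (intro SUP_least)
  fix x :: "real^'n" and a :: "'n mindex" assume x: "x \<in> U"
  let ?w = "weight_factor w \<rho> (mlen a)"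
  have up: "ennreal (\<bar>mderiv a u x\<bar> * ?w) \<le> fun_norm w U \<rho> u" for u :: "real^'n \<Rightarrow> real"
    unfolding fun_norm_def using x by (intro SUP_upper2[of x] SUP_upper2[of a]) auto
  have "\<bar>mderiv a h x\<bar> * ?w \<le> (\<bar>mderiv a f x\<bar> + \<bar>mderiv a g x\<bar>) * ?w"
    using assms[OF x] weight_factor_pos[of w \<rho> "mlen a"] by (intro mult_right_mono) auto
  then have "ennreal (\<bar>mderiv a h x\<bar> * ?w) \<le> ennreal (\<bar>mderiv a f x\<bar> * ?w + \<bar>mderiv a g x\<bar> * ?w)"
    by (intro ennreal_leI) (simp add: distrib_right)
  also have "\<dots> = ennreal (\<bar>mderiv a f x\<bar> * ?w) + ennreal (\<bar>mderiv a g x\<bar> * ?w)"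
    using weight_factor_pos[of w \<rho> "mlen a"] by (intro ennreal_plus) auto
  also have "\<dots> \<le> fun_norm w U \<rho> f + fun_norm w U \<rho> g"
    by (intro add_mono up)
  finally show "ennreal (\<bar>mderiv a h x\<bar> * ?w) \<le> fun_norm w U \<rho> f + fun_norm w U \<rho> g" .
qed

lemma fun_norm_scale:
  assumes "\<And>x a. x \<in> U \<Longrightarrow> mderiv a h x = c * mderiv a f x"
  shows "fun_norm w U \<rho> h = ennreal \<bar>c\<bar> * fun_norm w U \<rho> f"
  unfolding fun_norm_def SUP_mult_left_ennreal
  by (intro SUP_cong refl) (auto simp: assms abs_mult mult.assoc ennreal_mult weight_factor_def)

lemma fun_norm_cong:
  assumes "\<And>x a. x \<in> U \<Longrightarrow> mderiv a h x = mderiv a f x"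
  shows "fun_norm w U \<rho> h = fun_norm w U \<rho> f"
  using fun_norm_scale[of U h 1 f] assms by simp

lemma smooth_if_smooth_on_balls:
  assumes "\<And>R. smooth_on {x :: real^'n::finite. norm x < R} f"
  shows "smooth f"
  unfolding smooth_on_UNIV_iff smooth_on_def
proof (intro allI conjI ballI)
  show "continuous_on UNIV (partials is f)" for "is"
  proof -
    have "isCont (partials is f) x" for x
    proof -
      have "continuous_on (ball 0 (norm x + 1)) (partials is f)"
        using smooth_on_cont[OF assms[of "norm x + 1"]] by (rule continuous_on_subset) auto
      then show ?thesis
        by (simp add: continuous_on_eq_continuous_at)
    qed
    then show ?thesis
      by (simp add: continuous_at_imp_continuous_on)
  qed
  show "has_partial i (partials is f) (partials (i # is) f x) x" for "is" i x
    by (rule smooth_on_partial[OF assms[of "norm x + 1"]]) simp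
qed

section \<open>Continuity of the extension operator\<close>

text \<open>Balls around points outside the image of \<open>f\<close> belong to the subbasis as well; the triangle inequality reduces them to
balls around image points.\<close>

lemma continuous_map_seminorm_topologyI:
  assumes img: "\<And>x. x \<in> topspace X \<Longrightarrow> f x \<in> W"
    and small: "\<And>p x e. p \<in> P \<Longrightarrow> x \<in> topspace X \<Longrightarrow> 0 < e \<Longrightarrow>
      \<exists>N. openin X N \<and> x \<in> N \<and> (\<forall>y\<in>N. p (f y - f x) < e)"
    and triangle: "\<And>p x y g. p \<in> P \<Longrightarrow> x \<in> topspace X \<Longrightarrow> y \<in> topspace X \<Longrightarrow> g \<in> W \<Longrightarrow>
      p (f y - g) \<le> p (f y - f x) + p (f x - g)"
  shows "continuous_map X (seminorm_topology W P) f"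
  unfolding seminorm_topology_def continuous_on_generated_topo_iff
proof (intro conjI allI impI)
  fix U assume "U \<in> insert W {{y \<in> W. p (y - x) < e} | p x e. p \<in> P \<and> x \<in> W \<and> 0 < e}"
  then consider "U = W" | p g e where "U = {y \<in> W. p (y - g) < e}" "p \<in> P" "g \<in> W"
    by blast
  then show "openin X (f -` U \<inter> topspace X)"
  proof cases
    case 1
    then have "f -` U \<inter> topspace X = topspace X"
      using img by auto
    then show ?thesis by simp
  next
    case 2
    show ?thesis
    proof (subst openin_subopen, intro ballI)
      fix x assume x: "x \<in> f -` U \<inter> topspace X"
      then have "0 < e - p (f x - g)"
        using 2 by simp
      then obtain N where N: "openin X N" "x \<in> N" "\<forall>y\<in>N. p (f y - f x) < e - p (f x - g)"
        using small[OF 2(2), of x "e - p (f x - g)"] x by auto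
      have "N \<subseteq> f -` U \<inter> topspace X"
      proof
        fix y assume y: "y \<in> N"
        then have yX: "y \<in> topspace X"
          using openin_subset[OF N(1)] by auto
        have "p (f y - g) \<le> p (f y - f x) + p (f x - g)"
          using triangle[OF 2(2) _ yX 2(3), of x] x by simp
        also have "\<dots> < e"
          using N(3) y by force
        finally show "y \<in> f -` U \<inter> topspace X"
          using 2(1) img[OF yX] yX by simp
      qed
      then show "\<exists>T. openin X T \<and> x \<in> T \<and> T \<subseteq> f -` U \<inter> topspace X"
        using N by blast
    qed
  qed
next
  show "f ` topspace X \<subseteq> \<Union> (insert W {{y \<in> W. p (y - x) < e} | p x e. p \<in> P \<and> x \<in> W \<and> 0 < e})"
    using img by auto
qed

lemma enn2real_triangle:
  assumes "a \<le> b + c" "b < \<infinity>" "c < \<infinity>"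
  shows "enn2real a \<le> enn2real b + enn2real c"
proof -
  have "enn2real a \<le> enn2real (b + c)"
    using assms by (intro enn2real_mono) auto
  also have "\<dots> = enn2real b + enn2real c"
    using assms by (intro enn2real_plus) auto
  finally show ?thesis .
qed

lemma mderiv_combination:
  fixes f g h :: "real^'n::finite \<Rightarrow> real"
  assumes "open S" "smooth_on S f" "smooth_on S g" "x \<in> S" "\<And>y. y \<in> S \<Longrightarrow> h y = c * f y + d * g y"
  shows "mderiv a h x = c * mderiv a f x + d * mderiv a g x"
proof -
  obtain "is" where "is": "\<And>f. mderiv a f = partials is f"
    using mderiv_eq_partials[of a] by metis
  have "partials is h x = partials is (\<lambda>y. c * f y + d * g y) x"
    by (rule partials_cong_open[OF assms(1,5,4)])
  also have "\<dots> = partials is (\<lambda>y. c * f y) x + partials is (\<lambda>y. d * g y) x"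
    by (rule partials_add[OF assms(1) smooth_on_cmult[OF assms(1,2)] smooth_on_cmult[OF assms(1,3)] assms(4)])
  also have "\<dots> = c * partials is f x + d * partials is g x"
    using assms by (simp add: partials_cmult)
  finally show ?thesis
    by (simp add: "is")
qed

lemma topspace_initial_topology_on: "topspace (initial_topology_on V I r T) = V"
  by (auto simp: initial_topology_on_def topology_generated_by_topspace)

text \<open>A scheme in which bounds by \<open>M\<close> imply the Beurling bounds for \<open>\<omega>\<close>, and which admits the jets of all the steps of the
Roumieu class of \<open>\<tau>\<close>.\<close>

locale ultrajet_scheme = whitney_scheme A M L e b s \<delta> q H
  for A :: "(real^'n::finite) set" and M L e b s \<delta> q H +
  fixes \<omega> \<tau> :: "real \<Rightarrow> real"
  assumes absorb: "1 \<le> k \<Longrightarrow> 0 \<le> \<Lambda> \<Longrightarrow> \<exists>C. \<forall>l. \<Lambda> ^ l * M l * weight_factor \<omega> (1 / real k) l \<le> C"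
    and weights_admissible: "1 \<le> m \<Longrightarrow> \<exists>C. admissible q s \<delta> (\<lambda>p. 1 / weight_factor \<tau> (real m) p) C"
begin

text \<open>What is common to ultrajets on \<open>A\<close> and to ultrajets on \<open>near_part R\<close>, both of which are extended by the same formula.\<close>

definition tame :: "real \<Rightarrow> 'n jet \<Rightarrow> bool" where
  "tame R F \<longleftrightarrow> (\<exists>m::nat. 1 \<le> m \<and> jet_norm \<tau> (near_part R) (real m) F < \<infinity>)"

lemma tameE:
  assumes "tame R F"
  obtains N B C where "jet_bounded (near_part R) N B F" "admissible q s \<delta> N C" "0 \<le> B"
  using assms weights_admissible jet_norm_imp_bounded enn2real_nonneg unfolding tame_def by metis

lemma smooth_extension_tame: "tame R F \<Longrightarrow> smooth_on {x. norm x < R} (extension F)"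
  by (elim tameE) (rule smooth_extension)

lemma summable_layer_tame: "tame R F \<Longrightarrow> norm x < R \<Longrightarrow> summable (\<lambda>j. layer F j x)"
  by (elim tameE) (rule summable_layer)

lemma extension_combination:
  assumes "tame R F" "tame R G" "norm x < R"
  shows "extension (c *\<^sub>R F + d *\<^sub>R G) x = c * extension F x + d * extension G x"
proof -
  note sF = summable_layer_tame[OF assms(1,3)] and sG = summable_layer_tame[OF assms(2,3)]
  have "summable (\<lambda>j. layer (c *\<^sub>R F) j x)" "summable (\<lambda>j. layer (d *\<^sub>R G) j x)"
    unfolding layer_scaleR by (intro summable_mult sF sG)+
  then have "extension (c *\<^sub>R F + d *\<^sub>R G) x = extension (c *\<^sub>R F) x + extension (d *\<^sub>R G) x"
    by (rule extension_add)
  then show ?thesis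
    by (simp add: extension_scaleR sF sG)
qed

lemma mderiv_extension_combination:
  assumes "tame R F" "tame R G" "norm x < R"
  shows "mderiv a (extension (c *\<^sub>R F + d *\<^sub>R G)) x = c * mderiv a (extension F) x + d * mderiv a (extension G) x"
  by (rule mderiv_combination[OF open_norm_ball[of R] smooth_extension_tame[OF assms(1)] smooth_extension_tame[OF assms(2)]])
    (use assms in \<open>auto intro: extension_combination\<close>)

lemma mderiv_extension_diff:
  assumes "tame R F" "tame R G" "norm x < R"
  shows "mderiv a (extension (F - G)) x = mderiv a (extension F) x - mderiv a (extension G) x"
  using mderiv_extension_combination[OF assms, of a 1 "-1"] by simp

lemma mderiv_diff:
  fixes f g :: "real^'n \<Rightarrow> real"
  assumes "smooth_on {x. norm x < R} f" "smooth_on {x. norm x < R} g" "norm x < R"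
  shows "mderiv a (f - g) x = mderiv a f x - mderiv a g x"
  using mderiv_combination[OF open_norm_ball[of R] assms(1,2), of x "f - g" 1 "-1" a] assms(3) by simp

text \<open>The continuity estimate: one constant serves all jets of a step, because neither cut-offs nor degrees depend on
the jet.\<close>

lemma fun_norm_extension_le:
  assumes m: "1 \<le> (m::nat)" and k: "1 \<le> (k::nat)"
  obtains C where "0 \<le> C" "\<And>F U. jet_norm \<tau> (near_part R) (real m) F < \<infinity> \<Longrightarrow> U \<subseteq> {x. norm x < R} \<Longrightarrow>
    fun_norm \<omega> U (1 / real k) (extension F) \<le> ennreal (C * enn2real (jet_norm \<tau> (near_part R) (real m) F))"
proof -
  obtain C1 where C1: "admissible q s \<delta> (\<lambda>p. 1 / weight_factor \<tau> (real m) p) C1"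
    using weights_admissible[OF m] by blast
  obtain C2 where C2: "\<And>l. growth_base ^ l * M l * weight_factor \<omega> (1 / real k) l \<le> C2"
    using absorb[OF k growth_base_ge(1)] by blast
  have pos: "0 \<le> growth_base ^ l * M l * weight_factor \<omega> (1 / real k) l" for l
    using growth_base_ge(1) M_pos[of l] weight_factor_pos[of \<omega> "1 / real k" l] by simp
  define X where "X = \<bar>suminf (layer_const R) * C1\<bar>"
  show thesis
  proof (rule that[of "X * C2"])
    have "0 \<le> C2"
      using order_trans[OF pos C2] .
    then show "0 \<le> X * C2"
      by (simp add: X_def)
    fix F and U :: "(real^'n) set" assume F: "jet_norm \<tau> (near_part R) (real m) F < \<infinity>" and U: "U \<subseteq> {x. norm x < R}"
    define B where "B = enn2real (jet_norm \<tau> (near_part R) (real m) F)"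
    show "fun_norm \<omega> U (1 / real k) (extension F) \<le> ennreal (X * C2 * enn2real (jet_norm \<tau> (near_part R) (real m) F))"
      unfolding B_def[symmetric]
    proof (rule fun_norm_leI)
      fix x and a :: "'n mindex" assume "x \<in> U"
      then have x: "norm x < R"
        using U by auto
      obtain "is" where "is": "length is = mlen a" "mderiv a (extension F) = partials is (extension F)"
        using mderiv_eq_partials[of a] by metis
      have "growth_at M x (suminf (layer_const R) * B * C1) growth_base (extension F)"
        unfolding B_def by (rule growth_extension[OF jet_norm_imp_bounded[OF F] C1 _ x]) simp
      then have "\<bar>mderiv a (extension F) x\<bar> \<le> suminf (layer_const R) * B * C1 * (growth_base ^ mlen a * M (mlen a))"
        unfolding growth_at_def "is" by (simp only: "is"(1)[symmetric] mult.assoc)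
      also have "\<dots> \<le> (X * B) * (growth_base ^ mlen a * M (mlen a))"
      proof (rule mult_right_mono)
        have "suminf (layer_const R) * B * C1 = (suminf (layer_const R) * C1) * B"
          by simp
        also have "\<dots> \<le> X * B"
          by (intro mult_right_mono) (auto simp: X_def B_def)
        finally show "suminf (layer_const R) * B * C1 \<le> X * B" .
      qed (use growth_base_ge(1) M_pos[of "mlen a"] in auto)
      finally have "\<bar>mderiv a (extension F) x\<bar> * weight_factor \<omega> (1 / real k) (mlen a) \<le>
          (X * B) * (growth_base ^ mlen a * M (mlen a)) * weight_factor \<omega> (1 / real k) (mlen a)"
        using weight_factor_pos by (intro mult_right_mono) (auto intro: less_imp_le)
      also have "\<dots> = (X * B) * (growth_base ^ mlen a * M (mlen a) * weight_factor \<omega> (1 / real k) (mlen a))"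
        by (simp only: mult.assoc)
      also have "\<dots> \<le> (X * B) * C2"
        using C2 by (intro mult_left_mono) (auto simp: X_def B_def)
      finally show "\<bar>mderiv a (extension F) x\<bar> * weight_factor \<omega> (1 / real k) (mlen a) \<le> X * C2 * B"
        by (simp only: mult_ac)
    qed
  qed
qed

lemma fun_norm_extension_finite:
  assumes "tame R F" "1 \<le> k" "U \<subseteq> {x. norm x < R}"
  shows "fun_norm \<omega> U (1 / real k) (extension F) < \<infinity>"
proof -
  obtain m :: nat where m: "1 \<le> m" "jet_norm \<tau> (near_part R) (real m) F < \<infinity>"
    using assms(1) by (auto simp: tame_def)
  obtain C where "fun_norm \<omega> U (1 / real k) (extension F) \<le> ennreal (C * enn2real (jet_norm \<tau> (near_part R) (real m) F))"
    using fun_norm_extension_le[OF m(1) assms(2)] m(2) assms(3) by metis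
  then show ?thesis
    using le_less_trans ennreal_less_top by fastforce
qed

lemma compact_near_part: "compact (near_part R)" "near_part R \<subseteq> A"
  unfolding near_part_def using closed by (auto intro: closed_Int_compact)

lemma tame_ultrajets: "F \<in> ultrajets \<tau> A \<Longrightarrow> tame R F"
  using compact_near_part by (auto simp: ultrajets_def tame_def)

lemma tame_local_ultrajets: "G \<in> ultrajets \<tau> (near_part R) \<Longrightarrow> tame R G"
  using compact_near_part by (auto simp: ultrajets_def tame_def)

lemma smooth_extension_ultrajets: "F \<in> ultrajets \<tau> A \<Longrightarrow> smooth (extension F)"
  by (rule smooth_if_smooth_on_balls) (rule smooth_extension_tame[OF tame_ultrajets])

lemma bounded_in_norm_ball:
  assumes "compact (closure (U :: (real^'n) set))"
  obtains R where "U \<subseteq> {x. norm x < R}" "near_part R \<noteq> {}"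
proof -
  have "bounded U"
    by (rule bounded_subset[OF compact_imp_bounded[OF assms] closure_subset])
  then obtain R1 where R1: "\<And>x. x \<in> U \<Longrightarrow> norm x < R1"
    unfolding bounded_pos_less by blast
  obtain a where a: "a \<in> A"
    using nonempty by blast
  define R where "R = max R1 (norm a)"
  have "a \<in> near_part R"
    using a e_pos[of 0] by (simp add: near_part_def R_def add_increasing2)
  then show thesis
    using R1 by (intro that[of R]) (auto simp: R_def less_max_iff_disj)
qed

lemma extension_in_beurling_class:
  assumes F: "F \<in> ultrajets \<tau> A"
  shows "extension F \<in> beurling_class \<omega>"
  unfolding beurling_class_def
proof (intro CollectI conjI allI impI)
  show "smooth (extension F)"
    by (rule smooth_extension_ultrajets[OF F])
  fix U :: "(real^'n) set" and k :: nat assume U: "open U \<and> compact (closure U) \<and> 1 \<le> k"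
  then obtain R where "U \<subseteq> {x. norm x < R}"
    using bounded_in_norm_ball by metis
  then show "fun_norm \<omega> U (1 / real k) (extension F) < \<infinity>"
    using fun_norm_extension_finite[OF tame_ultrajets[OF F]] U by blast
qed

lemma linear_extension: "linear_map_on (ultrajets \<tau> A) (beurling_class \<omega>) extension"
  unfolding linear_map_on_def
proof (intro conjI ballI allI)
  show "extension ` ultrajets \<tau> A \<subseteq> beurling_class \<omega>"
    using extension_in_beurling_class by blast
  have comb: "extension (c *\<^sub>R F + d *\<^sub>R G) x = c * extension F x + d * extension G x"
    if "F \<in> ultrajets \<tau> A" "G \<in> ultrajets \<tau> A" for F G c d x
    by (rule extension_combination[OF tame_ultrajets[OF that(1), of "norm x + 1"] tame_ultrajets[OF that(2)]]) simp
  fix F assume F: "F \<in> ultrajets \<tau> A"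
  show "extension (F + G) = extension F + extension G" if "G \<in> ultrajets \<tau> A" for G
    using comb[OF F that, of 1 1] by (auto simp: fun_eq_iff)
  show "extension (c *\<^sub>R F) = c *\<^sub>R extension F" for c
  proof
    fix x
    have "extension (c *\<^sub>R F) x = c * extension F x"
      using comb[OF F F, of c 0 x] by simp
    then show "extension (c *\<^sub>R F) x = (c *\<^sub>R extension F) x"
      by (simp add: scaleR_fun_def[of c "extension F"])
  qed
qed

lemma jet_map_extension:
  assumes F: "F \<in> ultrajets \<tau> A"
  shows "jet_map A (extension F) = F"
proof (intro ext)
  fix a x
  show "jet_map A (extension F) a x = F a x"
  proof (cases "x \<in> A")
    case True
    obtain "is" where "is": "count_list is = a" "mderiv a (extension F) = partials is (extension F)"
      using mderiv_eq_partials[of a] by metis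
    obtain N B C where NBC: "jet_bounded (near_part (norm x + 1)) N B F" "admissible q s \<delta> N C" "0 \<le> B"
      using tame_ultrajets[OF F] by (rule tameE)
    have "partials is (extension F) x = F a x"
      using partials_extension_at[OF NBC True, of "is"] by (simp add: "is")
    then show ?thesis
      using True by (simp add: jet_map_def jet_restrict_def "is")
  next
    case False
    then show ?thesis
      using F by (simp add: jet_map_def jet_restrict_def ultrajets_def whitney_jets_def)
  qed
qed

text \<open>The Beurling seminorm of the extension over \<open>U\<close>, as a seminorm on the ultrajets on \<open>near_part R\<close>. It is bounded by a
multiple of the norm of each step, and is therefore among the seminorms whose join is the inductive limit topology.\<close>

lemma local_seminorm:
  fixes U :: "(real^'n) set" and k :: nat
  assumes U: "U \<subseteq> {x. norm x < R}" and k: "1 \<le> k"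
  defines "p \<equiv> \<lambda>G. enn2real (fun_norm \<omega> U (1 / real k) (extension G))"
  shows "seminorm_on (ultrajets \<tau> (near_part R)) p"
    and "\<And>m. 1 \<le> m \<Longrightarrow> continuous_map (ultrajet_step_topology \<tau> (near_part R) m)
          (seminorm_topology (ultrajets \<tau> (near_part R)) {p}) (\<lambda>G. G)"
proof -
  let ?K = "near_part R"
  let ?fn = "fun_norm \<omega> U (1 / real k)"
  have xR: "norm x < R" if "x \<in> U" for x
    using U that by auto
  have fin: "?fn (extension G) < \<infinity>" if "tame R G" for G
    by (rule fun_norm_extension_finite[OF that k U])
  show "seminorm_on (ultrajets \<tau> ?K) p"
    unfolding seminorm_on_def
  proof (intro conjI ballI allI)
    fix G assume "G \<in> ultrajets \<tau> ?K"
    then have G: "tame R G"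
      by (rule tame_local_ultrajets)
    show "0 \<le> p G"
      by (simp add: p_def)
    show "p (c *\<^sub>R G) = \<bar>c\<bar> * p G" for c
    proof -
      have "?fn (extension (c *\<^sub>R G)) = ennreal \<bar>c\<bar> * ?fn (extension G)"
        using mderiv_extension_combination[OF G G xR, of _ _ c 0] by (intro fun_norm_scale) simp
      then show ?thesis
        by (simp add: p_def enn2real_mult)
    qed
    show "p (G + G') \<le> p G + p G'" if "G' \<in> ultrajets \<tau> ?K" for G'
    proof -
      have G': "tame R G'"
        using that by (rule tame_local_ultrajets)
      have "?fn (extension (G + G')) \<le> ?fn (extension G) + ?fn (extension G')"
        using mderiv_extension_combination[OF G G' xR, of _ _ 1 1] by (intro fun_norm_triangle) simp
      then show ?thesis
        unfolding p_def by (rule enn2real_triangle[OF _ fin[OF G] fin[OF G']])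
    qed
  qed
  fix m :: nat assume m: "1 \<le> m"
  let ?S = "{F \<in> whitney_jets ?K. jet_norm \<tau> ?K (real m) F < \<infinity>}"
  have S_sub: "?S \<subseteq> ultrajets \<tau> ?K"
  proof
    fix F assume F: "F \<in> ?S"
    have "jet_norm \<tau> K' (real m) F < \<infinity>" if "K' \<subseteq> ?K" for K'
      using le_less_trans[OF jet_norm_subset[OF that]] F by blast
    then show "F \<in> ultrajets \<tau> ?K"
      using F m by (auto simp: ultrajets_def)
  qed
  obtain C where C: "0 \<le> C" "\<And>F. jet_norm \<tau> ?K (real m) F < \<infinity> \<Longrightarrow>
      ?fn (extension F) \<le> ennreal (C * enn2real (jet_norm \<tau> ?K (real m) F))"
    using fun_norm_extension_le[OF m k, of R] U by metis
  show "continuous_map (ultrajet_step_topology \<tau> ?K m) (seminorm_topology (ultrajets \<tau> ?K) {p}) (\<lambda>G. G)"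
  proof (rule continuous_map_seminorm_topologyI)
    show "x \<in> ultrajets \<tau> ?K" if "x \<in> topspace (ultrajet_step_topology \<tau> ?K m)" for x
      using S_sub that by (auto simp: ultrajet_step_topology_def)
  next
    fix p' x and \<epsilon> :: real
    assume p': "p' \<in> {p}" and x: "x \<in> topspace (ultrajet_step_topology \<tau> ?K m)" and \<epsilon>: "0 < \<epsilon>"
    have xS: "x \<in> ?S"
      using x by (simp add: ultrajet_step_topology_def)
    define \<eta> where "\<eta> = \<epsilon> / (C + 1)"
    have \<eta>: "0 < \<eta>"
      using \<epsilon> C(1) by (simp add: \<eta>_def)
    let ?N = "{y \<in> ?S. (\<lambda>F. enn2real (jet_norm \<tau> ?K (real m) F)) (y - x) < \<eta>}"
    have "openin (ultrajet_step_topology \<tau> ?K m) ?N"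
      unfolding ultrajet_step_topology_def by (rule openin_seminorm_topology_ball[OF _ xS \<eta>]) simp
    moreover have "x \<in> ?N"
    proof -
      have "jet_norm1 \<tau> ?K (real m) (x - x) = 0" "jet_norm2 \<tau> ?K (real m) (x - x) = 0"
        unfolding jet_norm1_def jet_norm2_def jet_remainder_diff
        by (auto simp: SUP_eq_const intro!: antisym SUP_least)
      then show ?thesis
        using xS \<eta> by (simp add: jet_norm_def)
    qed
    moreover have "p' (y - x) < \<epsilon>" if y: "y \<in> ?N" for y
    proof -
      have f: "jet_norm \<tau> ?K (real m) (y - x) < \<infinity>"
        using y xS by (intro jet_norm_diff_finite) auto
      have "p (y - x) \<le> enn2real (ennreal (C * enn2real (jet_norm \<tau> ?K (real m) (y - x))))"
        unfolding p_def by (rule enn2real_mono[OF C(2)[OF f]]) simp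
      also have "\<dots> = C * enn2real (jet_norm \<tau> ?K (real m) (y - x))"
        using C(1) by simp
      also have "\<dots> \<le> C * \<eta>"
        using y C(1) by (intro mult_left_mono) auto
      also have "\<dots> < \<epsilon>"
        using \<epsilon> C(1) by (simp add: \<eta>_def field_simps)
      finally show ?thesis
        using p' by simp
    qed
    ultimately show "\<exists>N. openin (ultrajet_step_topology \<tau> ?K m) N \<and> x \<in> N \<and> (\<forall>y\<in>N. p' (y - x) < \<epsilon>)"
      by blast
  next
    fix p' x y g assume p': "p' \<in> {p}" and xy: "x \<in> topspace (ultrajet_step_topology \<tau> ?K m)"
      "y \<in> topspace (ultrajet_step_topology \<tau> ?K m)" and g: "g \<in> ultrajets \<tau> ?K"
    have t: "tame R x" "tame R y" "tame R g"
      using xy g S_sub tame_local_ultrajets by (auto simp: ultrajet_step_topology_def)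
    have sub_fin: "?fn (extension (u - v)) < \<infinity>" if "tame R u" "tame R v" for u v
    proof -
      have "?fn (extension (u - v)) \<le> ?fn (extension u) + ?fn (extension v)"
        using mderiv_extension_diff[OF that xR] by (intro fun_norm_triangle) simp
      also have "\<dots> < \<infinity>"
        using fin[OF that(1)] fin[OF that(2)] by simp
      finally show ?thesis .
    qed
    have "?fn (extension (y - g)) \<le> ?fn (extension (y - x)) + ?fn (extension (x - g))"
      using mderiv_extension_diff[OF t(2,3) xR] mderiv_extension_diff[OF t(2,1) xR] mderiv_extension_diff[OF t(1,3) xR]
      by (intro fun_norm_triangle) simp
    then have "p (y - g) \<le> p (y - x) + p (x - g)"
      unfolding p_def by (rule enn2real_triangle[OF _ sub_fin[OF t(2,1)] sub_fin[OF t(1,3)]])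
    then show "p' (y - g) \<le> p' (y - x) + p' (x - g)"
      using p' by simp
  qed
qed

text \<open>The extension of \<open>F\<close> and that of its restriction to \<open>near_part R\<close> agree on the ball that contains \<open>U\<close>, so that balls
of \<open>local_seminorm\<close> pull back to neighbourhoods.\<close>

lemma continuous_extension:
  "continuous_map (ultrajet_topology \<tau> A) (beurling_topology \<omega>) extension"
  unfolding beurling_topology_def
proof (rule continuous_map_seminorm_topologyI)
  have top: "topspace (ultrajet_topology \<tau> A) = ultrajets \<tau> A"
    by (simp add: ultrajet_topology_def topspace_initial_topology_on)
  show "extension F \<in> beurling_class \<omega>" if "F \<in> topspace (ultrajet_topology \<tau> A)" for F
    using extension_in_beurling_class that by (simp add: top)
  fix p :: "(real^'n \<Rightarrow> real) \<Rightarrow> real" and F assume "p \<in> {(\<lambda>f. enn2real (fun_norm \<omega> U (1 / real k) f)) | U k. open U \<and> compact (closure U) \<and> 1 \<le> (k::nat)}"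
    and "F \<in> topspace (ultrajet_topology \<tau> A)"
  then obtain U :: "(real^'n) set" and k :: nat where U: "compact (closure U)" "1 \<le> k" "open U"
    and p: "p = (\<lambda>f. enn2real (fun_norm \<omega> U (1 / real k) f))" and F: "F \<in> ultrajets \<tau> A"
    by (auto simp: top)
  obtain R where R: "U \<subseteq> {x. norm x < R}" "near_part R \<noteq> {}"
    using bounded_in_norm_ball[OF U(1)] by metis
  let ?K = "near_part R"
  let ?fn = "fun_norm \<omega> U (1 / real k)"
  have xR: "norm x < R" if "x \<in> U" for x
    using R(1) that by auto
  {
    fix \<epsilon> :: real assume \<epsilon>: "0 < \<epsilon>"
    define pK where "pK = (\<lambda>G. enn2real (?fn (extension G)))"
    let ?rF = "jet_restrict ?K F"
    define B where "B = {G \<in> ultrajets \<tau> ?K. pK (G - ?rF) < \<epsilon>}"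
    have rest: "jet_restrict ?K G \<in> ultrajets \<tau> ?K" if "G \<in> ultrajets \<tau> A" for G
      by (rule restrict_ultrajets[OF that compact_near_part(2)])
    have "openin (ultrajet_compact_topology \<tau> ?K) B"
      unfolding ultrajet_compact_topology_def
    proof (rule openin_lc_inductive_topology)
      show "locally_convex_topology (ultrajets \<tau> ?K) (seminorm_topology (ultrajets \<tau> ?K) {pK})"
        unfolding locally_convex_topology_def
        using local_seminorm(1)[OF R(1) U(2)] by (intro exI[of _ "{pK}"]) (simp add: pK_def)
      show "continuous_map (ultrajet_step_topology \<tau> ?K i) (seminorm_topology (ultrajets \<tau> ?K) {pK}) (\<lambda>x. x)"
        if "i \<in> {1..}" for i
        using local_seminorm(2)[OF R(1) U(2), of i] that by (simp add: pK_def)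
      show "openin (seminorm_topology (ultrajets \<tau> ?K) {pK}) B"
        unfolding B_def by (rule openin_seminorm_topology_ball) (use rest[OF F] \<epsilon> in auto)
    qed
    then have "openin (ultrajet_topology \<tau> A) {G \<in> ultrajets \<tau> A. jet_restrict ?K G \<in> B}"
      unfolding ultrajet_topology_def initial_topology_on_def
      using compact_near_part[of R] R(2) by (intro topology_generated_by_Basis) blast
    moreover have cong: "pK (jet_restrict ?K G - ?rF) = p (extension G - extension F)" if G: "G \<in> ultrajets \<tau> A" for G
    proof -
      have t: "tame R (jet_restrict ?K G)" "tame R ?rF"
        using rest[OF G] rest[OF F] by (auto intro: tame_local_ultrajets)
      have eq: "extension (jet_restrict ?K G') y = extension G' y" if "norm y < R" for G' y
        by (rule extension_cong[OF that]) (simp add: jet_restrict_def)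
      have "mderiv a (extension (jet_restrict ?K G - ?rF)) x = mderiv a (extension G - extension F) x" if "x \<in> U" for a x
      proof -
        have "mderiv a (extension G - extension F) x =
            mderiv a (extension (jet_restrict ?K G)) x - mderiv a (extension ?rF) x"
          using mderiv_combination[OF open_norm_ball[of R] smooth_extension_tame[OF t(1)] smooth_extension_tame[OF t(2)],
              of x "extension G - extension F" 1 "-1" a] xR[OF that] by (simp add: eq)
        then show ?thesis
          using mderiv_extension_diff[OF t xR[OF that]] by simp
      qed
      then have "?fn (extension (jet_restrict ?K G - ?rF)) = ?fn (extension G - extension F)"
        by (rule fun_norm_cong)
      then show ?thesis
        by (simp add: pK_def p)
    qed
    moreover have "p (extension F - extension F) = 0"
    proof -
      have "?fn (extension F - extension F) = ennreal \<bar>0\<bar> * ?fn (extension F)"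
        using mderiv_diff[OF smooth_extension_tame smooth_extension_tame xR, OF tame_ultrajets[OF F] tame_ultrajets[OF F]]
        by (intro fun_norm_scale) simp
      then show ?thesis
        by (simp add: p)
    qed
    ultimately show "\<exists>N. openin (ultrajet_topology \<tau> A) N \<and> F \<in> N \<and> (\<forall>G\<in>N. p (extension G - extension F) < \<epsilon>)"
      using F rest[OF F] \<epsilon> cong[OF F]
      by (intro exI[of _ "{G \<in> ultrajets \<tau> A. jet_restrict ?K G \<in> B}"]) (auto simp: B_def cong)
  }
  fix G and g :: "real^'n \<Rightarrow> real" assume "G \<in> topspace (ultrajet_topology \<tau> A)" and g: "g \<in> beurling_class \<omega>"
  then have G: "G \<in> ultrajets \<tau> A"
    by (simp add: top)
  have fin: "?fn f < \<infinity>" if "f \<in> beurling_class \<omega>" for f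
    using that U by (simp add: beurling_class_def)
  have sm: "smooth_on {x. norm x < R} f" if "f \<in> beurling_class \<omega>" for f
    using that smooth_on_subset unfolding beurling_class_def smooth_on_UNIV_iff by blast
  have diff_fin: "?fn (u - v) < \<infinity>" if "u \<in> beurling_class \<omega>" "v \<in> beurling_class \<omega>" for u v
  proof -
    have "?fn (u - v) \<le> ?fn u + ?fn v"
      using mderiv_diff[OF sm[OF that(1)] sm[OF that(2)] xR] by (intro fun_norm_triangle) simp
    also have "\<dots> < \<infinity>"
      using fin[OF that(1)] fin[OF that(2)] by simp
    finally show ?thesis .
  qed
  note eF = extension_in_beurling_class[OF F] and eG = extension_in_beurling_class[OF G]
  have "?fn (extension G - g) \<le> ?fn (extension G - extension F) + ?fn (extension F - g)"
    using mderiv_diff[OF sm[OF eG] sm[OF g] xR] mderiv_diff[OF sm[OF eG] sm[OF eF] xR] mderiv_diff[OF sm[OF eF] sm[OF g] xR]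
    by (intro fun_norm_triangle) simp
  then show "p (extension G - g) \<le> p (extension G - extension F) + p (extension F - g)"
    unfolding p by (rule enn2real_triangle[OF _ diff_fin[OF eG eF] diff_fin[OF eF g]])
qed

end

theorem theorem5:
  fixes \<omega> \<sigma> \<tau> :: "real \<Rightarrow> real" and r :: real and A :: "(real^'n::finite) set"
  assumes "weight_function \<omega>" and "non_quasianalytic \<omega>" and "concave_on {0..} \<omega>"
    and "weight_function \<sigma>" and "\<sigma> \<in> o[at_top](\<lambda>t. t)"
    and "0 < r" and "r < 1" and "strong_pair r \<omega> \<sigma>"
    and "weight_function \<tau>" and "\<sigma> \<in> o[at_top](\<tau>)"
    and "closed A" and "A \<noteq> {}"
  shows "\<exists>T. linear_map_on (ultrajets \<tau> A) (beurling_class \<omega>) T \<and>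
             continuous_map (ultrajet_topology \<tau> A) (beurling_topology \<omega>) T \<and>
             (\<forall>F\<in>ultrajets \<tau> A. jet_map A (T F) = F)"
proof -
  have "dominates \<tau> \<sigma>"
    using assms(4,9,10) weight_mono[OF assms(4)] weight_nonneg[OF assms(4)] weight_nonneg[OF assms(9)]
    by (intro smallo_imp_dominates) (auto simp: mono_on_def)
  then obtain M L e b s \<delta> q H where scheme: "whitney_scheme A M L e b s \<delta> q H"
    "\<And>k \<Lambda>. 1 \<le> k \<Longrightarrow> 0 \<le> \<Lambda> \<Longrightarrow> \<exists>C. \<forall>l. \<Lambda> ^ l * M l * weight_factor \<omega> (1 / real k) l \<le> C"
    "\<And>m. 1 \<le> m \<Longrightarrow> \<exists>C. admissible q s \<delta> (\<lambda>p. 1 / weight_factor \<tau> (real m) p) C"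
    using whitney_scheme_exists[OF assms(1,4,9) _ assms(8,7,11,12)] by metis
  interpret ultrajet_scheme A M L e b s \<delta> q H \<omega> \<tau>
    by (intro ultrajet_scheme.intro ultrajet_scheme_axioms.intro scheme)
  show ?thesis
    using linear_extension continuous_extension jet_map_extension by blast
qed

end
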